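(* Let $n\ge 5$ be an integer, let $\omega>0$, and consider the differential equation \[ \dot z=z^{n}+P_{n-1}(t)z^{n-1}+\dots+P_{1}(t)z+P_{0}(t), \] where $z$ is complex-valued and $P_0,\dots,P_{n-1}$ are real-valued continuous functions on $[0,\omega]$. Let $K$ be a real number with $K>\max_{0\le t\le\omega}|P_0(t)|$. Suppose that for all $0\le t\le\omega$: \[ P_{n-2}(t)\le 0, \] \[ |P_i(t)|\le \frac{K-K^{(n-2)/n}P_{n-2}(t)-|P_0(t)|}{(n-4)\,K^{i/n}}\sin\!\Big(\frac{\pi}{n-2}\Big)\quad\text{for all } i\in\{2,\dots,n-1\}\setminus\{n-2\}, \] and \[ |P_1(t)|\ge \frac{K+|P_0(t)|-K^{(n-2)/n}P_{n-2}(t)+\frac{n-3}{n-4}\big(K-K^{(n-2)/n}P_{n-2}(t)-|P_0(t)|\big)\sin\!\big(\frac{\pi}{n-2}\big)}{K^{1/n}}. \] Then the equation has exactly $n$ complex periodic solutions (counted with multiplicity).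
   Context: For $c\in\mathbb{C}$ let $z(t,c)$ be the solution with $z(0,c)=c$, and let $Q$ be the (open) set of $c$ for which $z(t,c)$ is defined on all of $[0,\omega]$. The displacement function is $q(c)=z(\omega,c)-c$ on $Q$; it is holomorphic. A solution $\varphi$ is called periodic if $\varphi(0)=\varphi(\omega)$ (the $P_i$ need not be periodic), i.e. $\varphi(0)$ is a zero of $q$; its multiplicity is the multiplicity of $\varphi(0)$ as a zero of $q$, and a periodic solution of multiplicity $k$ is counted as $k$ solutions. $K^{i/n}$ denotes the positive real $n$-th root of $K^i$. *)

theory Defs
  imports "HOL-Complex_Analysis.Complex_Analysis"
begin

definition rhs :: "nat \<Rightarrow> (nat \<Rightarrow> real \<Rightarrow> real) \<Rightarrow> real \<Rightarrow> complex \<Rightarrow> complex" where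
  "rhs n P t w = w ^ n + (\<Sum>i<n. complex_of_real (P i t) * w ^ i)"

definition is_sol :: "nat \<Rightarrow> (nat \<Rightarrow> real \<Rightarrow> real) \<Rightarrow> real \<Rightarrow> complex \<Rightarrow> (real \<Rightarrow> complex) \<Rightarrow> bool" where
  "is_sol n P \<omega> c \<phi> \<longleftrightarrow> \<phi> 0 = c \<and>
     (\<forall>t\<in>{0..\<omega>}. (\<phi> has_vector_derivative rhs n P t (\<phi> t)) (at t within {0..\<omega>}))"

definition Qset :: "nat \<Rightarrow> (nat \<Rightarrow> real \<Rightarrow> real) \<Rightarrow> real \<Rightarrow> complex set" where
  "Qset n P \<omega> = {c. \<exists>\<phi>. is_sol n P \<omega> c \<phi>}"

text \<open>Displacement function q(c) = z(omega,c) - c (the solution is unique).\<close>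
definition displ :: "nat \<Rightarrow> (nat \<Rightarrow> real \<Rightarrow> real) \<Rightarrow> real \<Rightarrow> complex \<Rightarrow> complex" where
  "displ n P \<omega> c = (SOME \<phi>. is_sol n P \<omega> c \<phi>) \<omega> - c"

definition periodic_inits :: "nat \<Rightarrow> (nat \<Rightarrow> real \<Rightarrow> real) \<Rightarrow> real \<Rightarrow> complex set" where
  "periodic_inits n P \<omega> = {c \<in> Qset n P \<omega>. displ n P \<omega> c = 0}"

end

theory Submission
  imports Defs
begin

text \<open>
  The equation is deformed linearly to the Bernoulli equation \<open>z' = z ^ n + \<alpha> * z\<close>, whose periodic
  solutions are the \<open>n\<close> simple equilibria.  The hypotheses survive the deformation, so by Rouche's
  theorem the number of periodic solutions can only change if periodic solutions escape to infinity.

  With \<open>r = K powr (1 / n)\<close>, the term \<open>P 1 t * z\<close> dominates on the circle \<open>cmod z = r\<close>, which is therefore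
  crossed in one direction only; the same holds outside the disc for the rays with argument
  \<open>k * pi / (n - 2)\<close>, where the term of degree \<open>n - 1\<close> does not contribute to the angular
  velocity and the terms of degree \<open>n\<close> and \<open>n - 2\<close> reinforce each other.  Hence a large periodic solution
  in the upper half plane remains in one sector between consecutive rays.  A solution passing
  near infinity turns by about \<open>pi / (n - 1)\<close>, from an asymptotic direction where it grows
  to a neighbouring one where it decays.  In most sectors there is no room for this; in the sectors
  adjacent to the real axis a Lyapunov function shows that it cannot happen periodically.
\<close>

section \<open>Periodic functions of one real variable\<close>

text \<open>Periodic solutions must not escape at any stage of the deformation, so the bound is
  uniform: it depends only on \<open>n\<close>, \<open>\<omega>\<close>, the radius \<open>r\<close>
  and a common bound \<open>M\<close> of the coefficients, and it is fixed before the coefficients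
  are.

  Two obstacles shape the rest. Solutions may blow up before time \<open>\<omega>\<close>, so the
  domain of the displacement function changes with the parameter. A globally Lipschitz truncation
  provides a flow for all initial values; the supremum of the norm along a trajectory tells where
  that flow is genuine, and holomorphy and Rouche's theorem are used only there.

  The second obstacle is convexity. The hypothesis on \<open>P 1\<close> is not convex in the
  coefficients: for \<open>n = 5\<close> its right-hand side contains
  \<open>\<bar>P 0 t\<bar>\<close> with the negative factor \<open>1 - 2 * sin (pi / 3)\<close>.
  What is carried along the deformation is the convex consequence that \<open>P 1\<close> dominates
  on the circle. This also forces a constant sign \<open>\<sigma>\<close> of \<open>P 1\<close>, and
  the end point \<open>\<alpha> = \<sigma> * r ^ (n - 1)\<close> satisfies the same domination with
  equality, so the segment joining the two equations remains admissible.\<close>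

lemma periodic_min_deriv_nonpos:
  fixes g :: "real \<Rightarrow> real"
  assumes "\<omega> > 0" and g': "\<And>t. t \<in> {0..\<omega>} \<Longrightarrow> (g has_real_derivative g' t) (at t within {0..\<omega>})"
    and per: "g \<omega> = g 0"
  shows "\<exists>s\<in>{0..\<omega>}. (\<forall>t\<in>{0..\<omega>}. g s \<le> g t) \<and> g' s \<le> 0"
proof -
  have "continuous_on {0..\<omega>} g"
    using g' by (rule DERIV_continuous_on)
  then obtain s where s: "s \<in> {0..\<omega>}" "\<forall>t\<in>{0..\<omega>}. g s \<le> g t"
    using continuous_attains_inf[of "{0..\<omega>}" g] \<open>\<omega> > 0\<close> by auto
  \<comment> \<open>The sign is read off from points to the left of the minimum. A minimum at
    \<open>0\<close> has none, but equal end values allow it to be moved to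
    \<open>\<omega>\<close>.\<close>
  define s' where "s' = (if s = 0 then \<omega> else s)"
  have s': "s' \<in> {0<..\<omega>}" "\<forall>t\<in>{0..\<omega>}. g s' \<le> g t"
    using s per \<open>\<omega> > 0\<close> by (auto simp: s'_def)
  have "g' s' \<le> 0"
  proof (rule ccontr)
    assume "\<not> g' s' \<le> 0"
    then obtain d where d: "d > 0" "\<forall>h>0. s' - h \<in> {0..\<omega>} \<longrightarrow> h < d \<longrightarrow> g (s' - h) < g s'"
      using has_real_derivative_pos_inc_left[OF g'[of s']] s' by auto
    have "g (s' - min s' (d/2)) < g s'"
      using d s' by auto
    moreover have "s' - min s' (d/2) \<in> {0..\<omega>}"
      using d s' by auto
    ultimately show False
      using s' by fastforce
  qed
  then show ?thesis
    using s' by (intro bexI[of _ s']) auto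
qed

text \<open>Time reversal \<open>t \<mapsto> \<omega> - t\<close> of the preceding lemma: here the
  minimum is tested from the right.\<close>

lemma periodic_min_deriv_nonneg:
  fixes g :: "real \<Rightarrow> real"
  assumes "\<omega> > 0" and g': "\<And>t. t \<in> {0..\<omega>} \<Longrightarrow> (g has_real_derivative g' t) (at t within {0..\<omega>})"
    and per: "g \<omega> = g 0"
  shows "\<exists>s\<in>{0..\<omega>}. (\<forall>t\<in>{0..\<omega>}. g s \<le> g t) \<and> g' s \<ge> 0"
proof -
  have "((\<lambda>t. g (\<omega> - t)) has_real_derivative - g' (\<omega> - t)) (at t within {0..\<omega>})"
    if "t \<in> {0..\<omega>}" for t
  proof -
    have "(g has_real_derivative g' (\<omega> - t)) (at (\<omega> - t) within (\<lambda>t. \<omega> - t) ` {0..\<omega>})"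
      using g'[of "\<omega> - t"] that by (auto simp: image_diff_atLeastAtMost)
    moreover have "((\<lambda>t. \<omega> - t) has_real_derivative - 1) (at t within {0..\<omega>})"
      by (auto intro!: derivative_eq_intros)
    ultimately show ?thesis
      using DERIV_image_chain[of g "g' (\<omega> - t)" "\<lambda>t. \<omega> - t" t "{0..\<omega>}" "- 1"]
      by (simp add: o_def)
  qed
  from periodic_min_deriv_nonpos[OF \<open>\<omega> > 0\<close> this] per
  obtain s where "s \<in> {0..\<omega>}" "\<forall>t\<in>{0..\<omega>}. g (\<omega> - s) \<le> g (\<omega> - t)" "- g' (\<omega> - s) \<le> 0"
    by auto
  moreover from this(2) have "g (\<omega> - s) \<le> g t" if "t \<in> {0..\<omega>}" for t
    using that by (metis atLeastAtMost_iff diff_diff_eq2 diff_ge_0_iff_ge diff_left_mono add_diff_cancel_left' cancel_comm_monoid_add_class.diff_zero)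
  ultimately show ?thesis
    by (intro bexI[of _ "\<omega> - s"]) auto
qed

text \<open>A positive slope at the level \<open>v\<close> means that the level is reached from
  below. The first time after \<open>s\<close> with a value \<open>\<le> v\<close> would be reached
  from above.\<close>

lemma level_crossing_downward:
  fixes g :: "real \<Rightarrow> real"
  assumes g': "\<And>t. t \<in> {a..b} \<Longrightarrow> (g has_real_derivative g' t) (at t within {a..b})"
    and pos: "\<And>t. t \<in> {a..b} \<Longrightarrow> g t = v \<Longrightarrow> g' t > 0"
    and "a \<le> s" "s \<le> t" "t \<le> b" "g s > v"
  shows "g t \<ge> v"
proof (rule ccontr)
  assume neg: "\<not> g t \<ge> v"
  have cont: "continuous_on {s..t} g"
    by (rule continuous_on_subset[OF DERIV_continuous_on[OF g']]) (use assms in auto)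
  define A where "A = {x \<in> {s..t}. g x \<in> {..v}}"
  have "closed A"
    unfolding A_def using cont by (intro continuous_closed_preimage[unfolded vimage_def Int_def, simplified] continuous_on_closed_Collect_le) auto
  moreover have "A \<noteq> {}" "bdd_below A"
    using neg \<open>s \<le> t\<close> by (auto simp: A_def intro!: bdd_belowI[of _ s])
  ultimately have "Inf A \<in> A"
    by (metis closed_contains_Inf)
  define x where "x = Inf A"
  have x: "x \<in> {s..t}" "g x \<le> v"
    using \<open>Inf A \<in> A\<close> by (auto simp: x_def A_def)
  have before: "g y > v" if "s \<le> y" "y < x" for y
  proof (rule ccontr)
    assume "\<not> g y > v"
    then have "y \<in> A"
      using that x by (auto simp: A_def)
    then show False
      using cInf_lower[OF _ \<open>bdd_below A\<close>, of y] that by (auto simp: x_def)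
  qed
  have "s < x"
    using x \<open>g s > v\<close> by (cases "s = x") auto
  have "g x = v"
  proof (rule antisym[OF x(2)], rule ccontr)
    assume "\<not> v \<le> g x"
    then have "\<exists>y. s \<le> y \<and> y \<le> x \<and> g y = v"
      using IVT2'[of g x v s] \<open>g s > v\<close> \<open>s < x\<close> continuous_on_subset[OF cont] x by auto
    then show False
      using before \<open>\<not> v \<le> g x\<close> by (metis less_irrefl linorder_not_less order_le_less)
  qed
  then obtain d where d: "d > 0" "\<forall>h>0. x - h \<in> {a..b} \<longrightarrow> h < d \<longrightarrow> g (x - h) < g x"
    using has_real_derivative_pos_inc_left[OF g'[of x]] pos[of x] x assms by auto
  have "g (x - min (x - s) (d/2)) < g x"
    using d x \<open>s < x\<close> assms by auto
  moreover have "g (x - min (x - s) (d/2)) > v"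
    using \<open>s < x\<close> d by (intro before) auto
  ultimately show False
    using \<open>g x = v\<close> by auto
qed

text \<open>A crossing that is possible in one direction only can never be undone, which contradicts
  the return to the initial value.\<close>

lemma periodic_level:
  fixes g :: "real \<Rightarrow> real"
  assumes "\<omega> > 0" and g': "\<And>t. t \<in> {0..\<omega>} \<Longrightarrow> (g has_real_derivative g' t) (at t within {0..\<omega>})"
    and per: "g \<omega> = g 0"
    and pos: "\<And>t. t \<in> {0..\<omega>} \<Longrightarrow> g t = v \<Longrightarrow> g' t > 0"
  shows "(\<forall>t\<in>{0..\<omega>}. v \<le> g t) \<or> (\<forall>t\<in>{0..\<omega>}. g t \<le> v)"
proof (rule ccontr)
  assume "\<not> ?thesis"
  then obtain s t where st: "s \<in> {0..\<omega>}" "t \<in> {0..\<omega>}" "g s > v" "g t < v"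
    by (auto simp: not_le)
  have *: "g y \<ge> v" if "0 \<le> x" "x \<le> y" "y \<le> \<omega>" "g x > v" for x y
    by (rule level_crossing_downward[OF g' pos]) (use that in auto)
  consider "g 0 > v" | "g 0 < v" | "g 0 = v"
    by linarith
  then show False
  proof cases
    \<comment> \<open>Now \<open>g\<close> arrives at \<open>v\<close> at time
      \<open>\<omega>\<close> with positive slope, hence from below, although it has been at least
      \<open>v\<close> ever since time \<open>s\<close>.\<close>
    case 3
    then have "g \<omega> = v" "s < \<omega>"
      using per st by (auto simp: less_le)
    obtain d where d: "d > 0" "\<forall>h>0. \<omega> - h \<in> {0..\<omega>} \<longrightarrow> h < d \<longrightarrow> g (\<omega> - h) < g \<omega>"
      using has_real_derivative_pos_inc_left[OF g'[of \<omega>]] pos[of \<omega>] \<open>g \<omega> = v\<close> \<open>\<omega> > 0\<close> by auto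
    have "g (\<omega> - min (\<omega> - s) (d/2)) < g \<omega>"
      using d st \<open>s < \<omega>\<close> by auto
    moreover have "g (\<omega> - min (\<omega> - s) (d/2)) \<ge> v"
      using \<open>s < \<omega>\<close> d st by (intro *[of s]) auto
    ultimately show False
      using \<open>g \<omega> = v\<close> by auto
  qed (use *[of 0 t] *[of s \<omega>] st per in auto)
qed

lemma periodic_level_neg:
  fixes g :: "real \<Rightarrow> real"
  assumes "\<omega> > 0" and g': "\<And>t. t \<in> {0..\<omega>} \<Longrightarrow> (g has_real_derivative g' t) (at t within {0..\<omega>})"
    and per: "g \<omega> = g 0"
    and neg: "\<And>t. t \<in> {0..\<omega>} \<Longrightarrow> g t = v \<Longrightarrow> g' t < 0"
  shows "(\<forall>t\<in>{0..\<omega>}. v \<le> g t) \<or> (\<forall>t\<in>{0..\<omega>}. g t \<le> v)"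
  using periodic_level[of \<omega> "\<lambda>t. - g t" "\<lambda>t. - g' t" "- v"] assms
  by (auto intro!: DERIV_minus)

section \<open>Periodic solutions in polar coordinates\<close>

text \<open>The curve \<open>exp (l + \<i> * \<theta>)\<close> is a solution with equal values at \<open>0\<close> and \<open>\<omega>\<close>.\<close>

definition polar_sol ::
    "nat \<Rightarrow> (nat \<Rightarrow> real \<Rightarrow> real) \<Rightarrow> real \<Rightarrow> (real \<Rightarrow> real) \<Rightarrow> (real \<Rightarrow> real) \<Rightarrow> bool" where
  "polar_sol n p \<omega> l \<theta> \<longleftrightarrow> l \<omega> = l 0 \<and> \<theta> \<omega> = \<theta> 0 \<and> (\<forall>t\<in>{0..\<omega>}.
     (l has_real_derivative exp ((real n - 1) * l t) * cos ((real n - 1) * \<theta> t) +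
        (\<Sum>i<n. p i t * exp ((real i - 1) * l t) * cos ((real i - 1) * \<theta> t))) (at t within {0..\<omega>}) \<and>
     (\<theta> has_real_derivative exp ((real n - 1) * l t) * sin ((real n - 1) * \<theta> t) +
        (\<Sum>i<n. p i t * exp ((real i - 1) * l t) * sin ((real i - 1) * \<theta> t))) (at t within {0..\<omega>}))"

definition bounded_coeffs :: "nat \<Rightarrow> real \<Rightarrow> real \<Rightarrow> (nat \<Rightarrow> real \<Rightarrow> real) \<Rightarrow> bool" where
  "bounded_coeffs n \<omega> M p \<longleftrightarrow> (\<forall>i<n. \<forall>t\<in>{0..\<omega>}. \<bar>p i t\<bar> \<le> M)"

lemma abs_sum_coeffs_le:
  fixes p c :: "nat \<Rightarrow> real"
  assumes "\<And>i. i < n \<Longrightarrow> \<bar>p i\<bar> \<le> M" "\<And>i. i < n \<Longrightarrow> \<bar>c i\<bar> \<le> C"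
  shows "\<bar>\<Sum>i<n. p i * c i\<bar> \<le> real n * (M * C)"
proof -
  have "\<bar>\<Sum>i<n. p i * c i\<bar> \<le> (\<Sum>i<n. \<bar>p i * c i\<bar>)"
    by (rule sum_abs)
  also have "\<dots> \<le> (\<Sum>i<n. M * C)"
    using assms by (intro sum_mono) (auto simp: abs_mult intro!: mult_mono' order_trans[OF abs_ge_zero])
  finally show ?thesis
    by simp
qed

text \<open>
  The point \<open>w = z powi (1 - n)\<close> moves with velocity close to \<open>1 - n\<close> when \<open>z\<close> is large.
  If it never enters a sector around the half axis \<open>\<epsilon> * x > 0\<close>, the function \<open>g\<close> in the
  proof is comparable to \<open>cmod w\<close> and strictly monotone in time near \<open>w = 0\<close>.
\<close>

lemma polar_sol_avoiding_cone_bounded: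
  fixes \<omega> M \<kappa> :: real
  assumes n: "n \<ge> 2" and "\<omega> > 0" and \<kappa>: "0 \<le> \<kappa>" "\<kappa> < 1"
  obtains R where "\<And>p l \<theta> \<epsilon> t. polar_sol n p \<omega> l \<theta> \<Longrightarrow> bounded_coeffs n \<omega> M p \<Longrightarrow> \<epsilon> = 1 \<or> \<epsilon> = - 1 \<Longrightarrow>
    (\<And>t. t \<in> {0..\<omega>} \<Longrightarrow> \<epsilon> * cos ((real n - 1) * \<theta> t) \<le> \<kappa>) \<Longrightarrow> t \<in> {0..\<omega>} \<Longrightarrow> l t \<le> R"
proof -
  define m where "m = real n - 1"
  \<comment> \<open>Only \<open>B > 1\<close> and \<open>B * \<kappa> < 1\<close> matter: the first
    gives the leading part of \<open>g'\<close> the sign of \<open>\<epsilon>\<close> in every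
    direction, the second keeps \<open>g\<close> comparable to \<open>exp (- m * l)\<close> on the
    admissible directions.\<close>
  define B where "B = 2 / (1 + \<kappa>)"
  define c where "c = 1 - B * \<kappa>"
  define D where "D = real n * (M * ((1 + 2 * B) * m))"
  \<comment> \<open>Beyond \<open>l1\<close> the leading part of \<open>g'\<close>, at least
    \<open>m * (B - 1)\<close> in size, exceeds the remaining terms, which are at most
    \<open>D * exp (- l)\<close>.\<close>
  define l1 where "l1 = max 0 (ln (max 1 ((D + 1) / (m * (B - 1)))))"
  \<comment> \<open>The additional summand is the loss from comparing two values of \<open>l\<close>
    through \<open>g\<close>, since the constants in \<open>lower\<close> and \<open>upper\<close>
    differ by the factor \<open>(1 + B) / c\<close>.\<close>
  define R where "R = l1 + ln ((1 + B) / c) / m"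
  have m: "m \<ge> 1" using n by (auto simp: m_def)
  have B: "B > 1" "B * \<kappa> < 1" "c > 0"
    using \<kappa> by (auto simp: B_def c_def field_simps)
  show thesis
  proof (rule that[of R], rule ccontr)
    fix p l \<theta> \<epsilon> t0
    assume sol: "polar_sol n p \<omega> l \<theta>" and M: "bounded_coeffs n \<omega> M p" and \<epsilon>: "\<epsilon> = 1 \<or> \<epsilon> = (- 1::real)"
      and cone: "\<And>t. t \<in> {0..\<omega>} \<Longrightarrow> \<epsilon> * cos ((real n - 1) * \<theta> t) \<le> \<kappa>"
      and t0: "t0 \<in> {0..\<omega>}" "\<not> l t0 \<le> R"
    define dl where "dl t = exp (m * l t) * cos (m * \<theta> t) +
        (\<Sum>i<n. p i t * (exp ((real i - 1) * l t) * cos ((real i - 1) * \<theta> t)))" for t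
    define d\<theta> where "d\<theta> t = exp (m * l t) * sin (m * \<theta> t) +
        (\<Sum>i<n. p i t * (exp ((real i - 1) * l t) * sin ((real i - 1) * \<theta> t)))" for t
    have dl: "(l has_real_derivative dl t) (at t within {0..\<omega>})"
     and d\<theta>: "(\<theta> has_real_derivative d\<theta> t) (at t within {0..\<omega>})" if "t \<in> {0..\<omega>}" for t
      using sol that by (auto simp: polar_sol_def dl_def d\<theta>_def m_def mult.assoc)
    \<comment> \<open>For \<open>w = exp (- m * (l + \<i> * \<theta>))\<close> this is
      \<open>cmod w - B * \<epsilon> * Re w\<close>.\<close>
    define g where "g t = exp (- m * l t) * (1 - B * \<epsilon> * cos (m * \<theta> t))" for t
    define g' where "g' t = exp (- m * l t) * m * (B * \<epsilon> * sin (m * \<theta> t) * d\<theta> t - (1 - B * \<epsilon> * cos (m * \<theta> t)) * dl t)" for t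
    have g': "(g has_real_derivative g' t) (at t within {0..\<omega>})" if "t \<in> {0..\<omega>}" for t
      unfolding g_def [abs_def] g'_def using dl[OF that] d\<theta>[OF that]
      by (auto intro!: derivative_eq_intros simp: algebra_simps)
    have per: "g \<omega> = g 0"
      using sol by (simp add: g_def polar_sol_def)
    have lower: "c * exp (- m * l t) \<le> g t" if "t \<in> {0..\<omega>}" for t
    proof -
      have "B * (\<epsilon> * cos (m * \<theta> t)) \<le> B * \<kappa>"
        using cone that B by (intro mult_left_mono) (auto simp: m_def)
      then show ?thesis
        by (auto simp: g_def c_def mult.assoc mult.commute[of _ "exp _"])
    qed
    have upper: "g t \<le> (1 + B) * exp (- m * l t)" for t
    proof -
      have "B * (- (\<epsilon> * cos (m * \<theta> t))) \<le> B * 1"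
        using B \<epsilon> by (intro mult_left_mono) (auto simp: minus_le_iff)
      then show ?thesis
        by (auto simp: g_def mult.assoc mult.commute[of _ "exp _"])
    qed
    have large: "l s > l1" if "s \<in> {0..\<omega>}" "g s \<le> g t0" for s
    proof -
      have "c * exp (- m * l s) \<le> (1 + B) * exp (- m * l t0)"
        using lower[of s] upper[of t0] that by linarith
      then have "exp (m * l t0) \<le> (1 + B) / c * exp (m * l s)"
        using B by (simp add: field_simps exp_minus)
      also have "\<dots> = exp (ln ((1 + B) / c) + m * l s)"
        using B by (simp add: exp_add)
      finally have "m * l t0 \<le> ln ((1 + B) / c) + m * l s"
        by simp
      then have "l t0 \<le> ln ((1 + B) / c) / m + l s"
        using m by (simp add: field_simps)
      then show ?thesis
        using t0 by (simp add: R_def)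
    qed
    have sign: "\<epsilon> * g' s > 0" if s: "s \<in> {0..\<omega>}" and "l s > l1" for s
    proof -
      define x where "x = B * \<epsilon> * sin (m * \<theta> s)"
      define y where "y = 1 - B * \<epsilon> * cos (m * \<theta> s)"
      have "l1 \<ge> 0"
        by (simp add: l1_def)
      then have l0: "l s > 0"
        using \<open>l s > l1\<close> by linarith
      have x: "\<bar>x\<bar> \<le> B" and y: "\<bar>y\<bar> \<le> 1 + B"
      proof -
        have "\<bar>B * \<epsilon> * u\<bar> \<le> B" if "\<bar>u\<bar> \<le> 1" for u
          using that B \<epsilon> by (auto simp: abs_mult mult_left_le)
        from this[of "sin (m * \<theta> s)"] this[of "cos (m * \<theta> s)"] show "\<bar>x\<bar> \<le> B" "\<bar>y\<bar> \<le> 1 + B"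
          by (auto simp: x_def y_def)
      qed
      \<comment> \<open>After division by the leading growth \<open>exp (m * l)\<close>, a term of
        degree \<open>i < n\<close> keeps the exponent \<open>i - n \<le> - 1\<close>.\<close>
      define e where "e i = exp (- m * l s) * exp ((real i - 1) * l s)" for i
      have e: "0 < e i" "e i \<le> exp (- l s)" if "i < n" for i
      proof -
        have "(real i - 1 - m) * l s \<le> (-1) * l s"
          using that n l0 by (intro mult_right_mono) (auto simp: m_def)
        then show "e i \<le> exp (- l s)"
          by (simp add: e_def exp_add[symmetric] algebra_simps)
      qed (simp add: e_def)
      define q where "q i = e i * m * (x * sin ((real i - 1) * \<theta> s) - y * cos ((real i - 1) * \<theta> s))" for i
      have "g' s = exp (- m * l s) * exp (m * l s) * m * (x * sin (m * \<theta> s) - y * cos (m * \<theta> s)) + (\<Sum>i<n. p i s * q i)"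
        by (simp add: g'_def d\<theta>_def dl_def x_def y_def e_def q_def sum_distrib_left sum.distrib sum_subtractf algebra_simps)
      also have "exp (- m * l s) * exp (m * l s) = 1"
        by (simp add: exp_minus)
      also have "x * sin (m * \<theta> s) - y * cos (m * \<theta> s) = B * \<epsilon> * ((sin (m * \<theta> s))\<^sup>2 + (cos (m * \<theta> s))\<^sup>2) - cos (m * \<theta> s)"
        unfolding x_def y_def by algebra
      finally have g's: "g' s = m * (B * \<epsilon> - cos (m * \<theta> s)) + (\<Sum>i<n. p i s * q i)"
        by simp
      have "\<bar>q i\<bar> \<le> exp (- l s) * m * (1 + 2 * B)" if "i < n" for i
      proof -
        have "\<bar>x * sin ((real i - 1) * \<theta> s)\<bar> \<le> B * 1" "\<bar>y * cos ((real i - 1) * \<theta> s)\<bar> \<le> (1 + B) * 1"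
          unfolding abs_mult using x y B by (intro mult_mono; auto)+
        then have "\<bar>x * sin ((real i - 1) * \<theta> s) - y * cos ((real i - 1) * \<theta> s)\<bar> \<le> 1 + 2 * B"
          by (intro order_trans[OF abs_triangle_ineq4]) simp
        then have "e i * m * \<bar>x * sin ((real i - 1) * \<theta> s) - y * cos ((real i - 1) * \<theta> s)\<bar> \<le>
            exp (- l s) * m * (1 + 2 * B)"
          using e[OF that] m by (intro mult_mono) auto
        then show ?thesis
          using e[OF that] m by (simp add: q_def abs_mult)
      qed
      then have "\<bar>\<Sum>i<n. p i s * q i\<bar> \<le> real n * (M * (exp (- l s) * m * (1 + 2 * B)))"
        using M s by (intro abs_sum_coeffs_le) (auto simp: bounded_coeffs_def)
      then have rest: "\<bar>\<Sum>i<n. p i s * q i\<bar> \<le> D * exp (- l s)"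
        by (simp add: D_def algebra_simps)
      have "(D + 1) / (m * (B - 1)) \<le> exp l1"
        by (simp add: l1_def max_def)
      also have "\<dots> < exp (l s)"
        using that by simp
      finally have "D * exp (- l s) < m * (B - 1)"
        using m B by (simp add: field_simps exp_minus)
      moreover have "m * (B - 1) \<le> m * (B - \<epsilon> * cos (m * \<theta> s))"
        using \<epsilon> m by (intro mult_left_mono) (auto simp: minus_le_iff)
      ultimately have "m * (B - \<epsilon> * cos (m * \<theta> s)) > \<bar>\<Sum>i<n. p i s * q i\<bar>"
        using rest by linarith
      moreover have "\<epsilon> * g' s = m * (B - \<epsilon> * cos (m * \<theta> s)) + \<epsilon> * (\<Sum>i<n. p i s * q i)"
        unfolding g's using \<epsilon> by (auto simp: algebra_simps)
      moreover have "\<bar>\<epsilon> * (\<Sum>i<n. p i s * q i)\<bar> = \<bar>\<Sum>i<n. p i s * q i\<bar>"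
        using \<epsilon> by auto
      ultimately show ?thesis
        by linarith
    qed
    \<comment> \<open>At a minimum of \<open>g\<close> the radius is large by \<open>large\<close>,
      so \<open>g'\<close> has the strict sign of \<open>\<epsilon>\<close> there; periodicity
      supplies a minimum with a derivative of the opposite weak sign.\<close>
    show False
      using \<epsilon>
    proof
      assume "\<epsilon> = 1"
      obtain s where "s \<in> {0..\<omega>}" "\<forall>t\<in>{0..\<omega>}. g s \<le> g t" "g' s \<le> 0"
        using periodic_min_deriv_nonpos[OF \<open>\<omega> > 0\<close> g' per] by blast
      then show False
        using sign[OF _ large, of s] t0 \<open>\<epsilon> = 1\<close> by auto
    next
      assume "\<epsilon> = - 1"
      obtain s where "s \<in> {0..\<omega>}" "\<forall>t\<in>{0..\<omega>}. g s \<le> g t" "g' s \<ge> 0"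
        using periodic_min_deriv_nonneg[OF \<open>\<omega> > 0\<close> g' per] by blast
      then show False
        using sign[OF _ large, of s] t0 \<open>\<epsilon> = - 1\<close> by auto
    qed
  qed
qed

lemma DERIV_lower_bound_increment:
  fixes f :: "real \<Rightarrow> real"
  assumes "a \<le> b" and cont: "continuous_on {a..b} f"
    and f': "\<And>t. a < t \<Longrightarrow> t < b \<Longrightarrow> (f has_real_derivative f' t) (at t)"
    and bound: "\<And>t. a < t \<Longrightarrow> t < b \<Longrightarrow> f' t \<ge> - C"
  shows "f b \<ge> f a - C * (b - a)"
proof (cases "a = b")
  case False
  then obtain l z where z: "a < z" "z < b" "(f has_real_derivative l) (at z)" "f b - f a = (b - a) * l"
    using MVT[of a b f] cont f' \<open>a \<le> b\<close> real_differentiable_def by (metis order_less_le)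
  then have "l \<ge> - C"
    using bound[of z] DERIV_unique[OF z(3) f'[of z]] by simp
  then have "(b - a) * l \<ge> (b - a) * (- C)"
    using \<open>a \<le> b\<close> by (intro mult_left_mono) auto
  then show ?thesis
    using z(4) by (simp add: algebra_simps)
qed auto

text \<open>
  In the sector next to the positive real axis a periodic solution could come from infinity in the
  direction \<open>\<pi> / (n - 1)\<close> and go to infinity in the direction \<open>0\<close>.  This is excluded
  by the function \<open>\<Lambda>\<close> below: it shows that the argument, once it has reached
  \<open>\<pi> / (2 * (n - 1))\<close>, stays bounded away from \<open>0\<close> for a whole period.
\<close>

lemma polar_sol_argument_bounded_below:
  fixes \<omega> M l0 \<alpha> :: real
  assumes n: "n \<ge> 3" and "\<omega> > 0" "M \<ge> 0" and \<alpha>: "\<alpha> = pi / (2 * (real n - 1))"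
  obtains \<theta>0 where "\<theta>0 > 0" "\<And>p l \<theta> t0 t. polar_sol n p \<omega> l \<theta> \<Longrightarrow> bounded_coeffs n \<omega> M p \<Longrightarrow>
    (\<And>t. t \<in> {0..\<omega>} \<Longrightarrow> 0 < \<theta> t) \<Longrightarrow> (\<And>t. t \<in> {0..\<omega>} \<Longrightarrow> l t \<ge> l0) \<Longrightarrow>
    t0 \<in> {0..\<omega>} \<Longrightarrow> \<theta> t0 \<ge> \<alpha> \<Longrightarrow> t \<in> {0..\<omega>} \<Longrightarrow> \<theta> t \<ge> \<theta>0"
proof -
  define m where "m = real n - 1"
  define \<kappa> where "\<kappa> = cos ((m - 1) * \<alpha>)"
  \<comment> \<open>Since \<open>l\<close> is only bounded below, possibly by a negative number,
    raising an exponent costs a factor, which \<open>E\<close> bounds.\<close>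
  define E where "E = exp (real n * \<bar>l0\<bar>)"
  define C1 where "C1 = real n * (M * (E * real n))"
  \<comment> \<open>Chosen so that \<open>A * \<kappa> = C1 + 1\<close>: the gain from the second
    part of \<open>\<Lambda>\<close> beats the possible loss \<open>C1 * exp ((m - 1) * l)\<close>
    in \<open>\<theta>' / \<theta>\<close> and leaves one power of that size over.\<close>
  define A where "A = (C1 + 1) / \<kappa>"
  define C2 where "C2 = A * (real n * (M * E))"
  \<comment> \<open>\<open>- C\<close> bounds \<open>x ^ (n - 3) * (x - C2)\<close> from below for
    all \<open>x \<ge> 0\<close>.\<close>
  define C where "C = C2 * C2 ^ (n - 3)"
  define \<Lambda>0 where "\<Lambda>0 = ln \<alpha> - A * exp (- l0)"
  \<comment> \<open>The loss \<open>2 * C * \<omega>\<close> covers two runs, from \<open>t0\<close>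
    to \<open>\<omega>\<close> and from \<open>0\<close> to \<open>t\<close>; the last summand
    converts \<open>\<Lambda>\<close> back into \<open>ln \<theta>\<close>.\<close>
  define \<theta>0 where "\<theta>0 = min \<alpha> (exp (\<Lambda>0 - 2 * C * \<omega> - A * exp (- l0)))"
  have m: "m \<ge> 2" using n by (simp add: m_def)
  have \<alpha>m: "m * \<alpha> = pi / 2" "\<alpha> > 0"
    using m unfolding \<alpha> m_def[symmetric] by (auto simp: field_simps)
  have "(m - 1) * \<alpha> < pi / 2" "(m - 1) * \<alpha> \<ge> 0"
    using \<alpha>m m by (auto simp: algebra_simps)
  then have \<kappa>: "\<kappa> > 0"
    unfolding \<kappa>_def by (intro cos_gt_zero_pi) auto
  have pos: "E > 0" "C1 \<ge> 0" "A > 0" "C2 \<ge> 0" "C \<ge> 0"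
    using \<kappa> \<open>M \<ge> 0\<close> by (auto simp: E_def C1_def A_def C2_def C_def add_nonneg_pos)
  have E: "exp (j * l) \<le> E * exp (k * l)" if "l \<ge> l0" "j \<le> k" "k - j \<le> real n" for l j k
  proof -
    have "- ((k - j) * l) \<le> (k - j) * (- l0)"
      using that mult_left_mono[of l0 l "k - j"] by simp
    also have "\<dots> \<le> (k - j) * \<bar>l0\<bar>"
      using that by (intro mult_left_mono) auto
    also have "\<dots> \<le> real n * \<bar>l0\<bar>"
      using that by (intro mult_right_mono) auto
    finally have "j * l \<le> real n * \<bar>l0\<bar> + k * l"
      by (simp add: algebra_simps)
    then show ?thesis
      unfolding E_def by (simp add: exp_add[symmetric])
  qed
  show thesis
  proof (rule that[of \<theta>0])
    show "\<theta>0 > 0" using \<alpha>m by (simp add: \<theta>0_def)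
  next
    fix p l \<theta> t0 t
    assume sol: "polar_sol n p \<omega> l \<theta>" and M: "bounded_coeffs n \<omega> M p"
      and \<theta>pos: "\<And>t. t \<in> {0..\<omega>} \<Longrightarrow> 0 < \<theta> t" and l0: "\<And>t. t \<in> {0..\<omega>} \<Longrightarrow> l t \<ge> l0"
      and t0: "t0 \<in> {0..\<omega>}" "\<theta> t0 \<ge> \<alpha>" and t: "t \<in> {0..\<omega>}"
    define dl where "dl t = exp (m * l t) * cos (m * \<theta> t) +
        (\<Sum>i<n. p i t * (exp ((real i - 1) * l t) * cos ((real i - 1) * \<theta> t)))" for t
    define d\<theta> where "d\<theta> t = exp (m * l t) * sin (m * \<theta> t) +
        (\<Sum>i<n. p i t * (exp ((real i - 1) * l t) * sin ((real i - 1) * \<theta> t)))" for t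
    have dl: "(l has_real_derivative dl t) (at t within {0..\<omega>})"
     and d\<theta>: "(\<theta> has_real_derivative d\<theta> t) (at t within {0..\<omega>})" if "t \<in> {0..\<omega>}" for t
      using sol that by (auto simp: polar_sol_def dl_def d\<theta>_def m_def mult.assoc)
    have cont_\<theta>: "continuous_on {0..\<omega>} \<theta>"
      by (rule DERIV_continuous_on[OF d\<theta>]) 
    \<comment> \<open>\<open>exp (- l) * cos \<theta>\<close> is the real part of
      \<open>1 / z\<close>. It is bounded, so it does not spoil the comparison with
      \<open>ln \<theta>\<close>, while minus its derivative is the real part of
      \<open>z' / z ^ 2\<close>, with leading term
      \<open>exp ((m - 1) * l) * cos ((m - 1) * \<theta>)\<close>.\<close>
    define \<Lambda> where "\<Lambda> t = ln (\<theta> t) - A * (exp (- l t) * cos (\<theta> t))" for t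
    define \<Lambda>' where "\<Lambda>' t = d\<theta> t / \<theta> t + A * exp (- l t) * (cos (\<theta> t) * dl t + sin (\<theta> t) * d\<theta> t)" for t
    have \<Lambda>': "(\<Lambda> has_real_derivative \<Lambda>' t) (at t within {0..\<omega>})" if "t \<in> {0..\<omega>}" for t
      unfolding \<Lambda>_def [abs_def] \<Lambda>'_def using dl[OF that] d\<theta>[OF that] \<theta>pos[OF that]
      by (auto intro!: derivative_eq_intros simp: field_simps)
    have cont_\<Lambda>: "continuous_on {0..\<omega>} \<Lambda>"
      by (rule DERIV_continuous_on[OF \<Lambda>'])
    have \<Lambda>_close: "\<bar>\<Lambda> t - ln (\<theta> t)\<bar> \<le> A * exp (- l0)" if t: "t \<in> {0..\<omega>}" for t
    proof -
      have "exp (- l t) * \<bar>cos (\<theta> t)\<bar> \<le> exp (- l0) * 1"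
        using l0[OF t] by (intro mult_mono) auto
      then show ?thesis
        using pos by (simp add: \<Lambda>_def abs_mult)
    qed
    have slope: "\<Lambda>' t \<ge> - C" if t: "t \<in> {0..\<omega>}" and small: "\<theta> t \<le> \<alpha>" for t
    proof -
      note \<theta>t = \<theta>pos[OF t] and lt = l0[OF t]
      have mt: "m * \<theta> t \<le> pi / 2" "(m - 1) * \<theta> t \<le> (m - 1) * \<alpha>" "(m - 1) * \<theta> t \<ge> 0"
        using mult_left_mono[OF small, of m] mult_left_mono[OF small, of "m - 1"] \<alpha>m m \<theta>t by auto
      have lead1: "sin (m * \<theta> t) \<ge> 0"
        using mt m \<theta>t pi_gt_zero by (intro sin_ge_zero; linarith?) auto
      have lead2: "cos ((m - 1) * \<theta> t) \<ge> \<kappa>"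
        unfolding \<kappa>_def using mt \<open>(m - 1) * \<alpha> < pi / 2\<close> by (intro cos_monotone_0_pi_le) auto
      define b where "b i = exp ((real i - 1) * l t) * sin ((real i - 1) * \<theta> t)" for i
      have "\<bar>b i\<bar> \<le> E * exp ((m - 1) * l t) * (real n * \<theta> t)" if "i < n" for i
      proof -
        have "\<bar>sin ((real i - 1) * \<theta> t)\<bar> \<le> \<bar>(real i - 1) * \<theta> t\<bar>"
          by (rule abs_sin_x_le_abs_x)
        also have "\<dots> \<le> real n * \<theta> t"
          using that \<theta>t n by (auto simp: abs_mult intro!: mult_right_mono)
        finally show ?thesis
          unfolding b_def abs_mult using that n E[OF lt, of "real i - 1" "m - 1"] \<theta>t pos(1)
          by (intro mult_mono) (auto simp: m_def)
      qed
      then have "\<bar>\<Sum>i<n. p i t * b i\<bar> \<le> real n * (M * (E * exp ((m - 1) * l t) * (real n * \<theta> t)))"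
        using M t by (intro abs_sum_coeffs_le) (auto simp: bounded_coeffs_def)
      also have "\<dots> = C1 * exp ((m - 1) * l t) * \<theta> t"
        by (simp add: C1_def algebra_simps)
      finally have "d\<theta> t \<ge> - (C1 * exp ((m - 1) * l t) * \<theta> t)"
        using lead1 unfolding d\<theta>_def b_def by (smt (verit) exp_gt_zero mult_nonneg_nonneg)
      then have part1: "d\<theta> t / \<theta> t \<ge> - C1 * exp ((m - 1) * l t)"
        using \<theta>t by (simp add: field_simps)
      define d where "d i = exp ((real i - 2) * l t) * cos ((real i - 2) * \<theta> t)" for i
      have ee: "exp (- l t) * exp (x * l t) = exp ((x - 1) * l t)" for x
        by (simp add: exp_add[symmetric] algebra_simps)
      have cs: "cos (\<theta> t) * cos (x * \<theta> t) + sin (\<theta> t) * sin (x * \<theta> t) = cos ((x - 1) * \<theta> t)" for x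
        using cos_diff[of "x * \<theta> t" "\<theta> t"] by (simp add: algebra_simps)
      have "exp (- l t) * (cos (\<theta> t) * dl t + sin (\<theta> t) * d\<theta> t) =
          (exp (- l t) * exp (m * l t)) * (cos (\<theta> t) * cos (m * \<theta> t) + sin (\<theta> t) * sin (m * \<theta> t)) +
          (\<Sum>i<n. p i t * ((exp (- l t) * exp ((real i - 1) * l t)) *
            (cos (\<theta> t) * cos ((real i - 1) * \<theta> t) + sin (\<theta> t) * sin ((real i - 1) * \<theta> t))))"
        by (simp add: dl_def d\<theta>_def sum_distrib_left sum.distrib algebra_simps)
      also have "\<dots> = exp ((m - 1) * l t) * cos ((m - 1) * \<theta> t) + (\<Sum>i<n. p i t * d i)"
        unfolding ee cs d_def by (simp add: diff_diff_eq)
      finally have eq: "exp (- l t) * (cos (\<theta> t) * dl t + sin (\<theta> t) * d\<theta> t) = \<dots>" .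
      have "\<bar>d i\<bar> \<le> E * exp ((m - 2) * l t)" if "i < n" for i
      proof -
        have "\<bar>d i\<bar> \<le> exp ((real i - 2) * l t) * 1"
          unfolding d_def abs_mult by (intro mult_mono) auto
        then show ?thesis
          using that n E[OF lt, of "real i - 2" "m - 2"] by (auto simp: m_def)
      qed
      then have "\<bar>\<Sum>i<n. p i t * d i\<bar> \<le> real n * (M * (E * exp ((m - 2) * l t)))"
        using M t by (intro abs_sum_coeffs_le) (auto simp: bounded_coeffs_def)
      moreover have "exp ((m - 1) * l t) * cos ((m - 1) * \<theta> t) \<ge> exp ((m - 1) * l t) * \<kappa>"
        using lead2 by (intro mult_left_mono) auto
      ultimately have "exp (- l t) * (cos (\<theta> t) * dl t + sin (\<theta> t) * d\<theta> t) \<ge>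
          exp ((m - 1) * l t) * \<kappa> - real n * (M * (E * exp ((m - 2) * l t)))"
        unfolding eq by linarith
      then have "A * (exp (- l t) * (cos (\<theta> t) * dl t + sin (\<theta> t) * d\<theta> t)) \<ge>
          A * (exp ((m - 1) * l t) * \<kappa> - real n * (M * (E * exp ((m - 2) * l t))))"
        using pos by (intro mult_left_mono) auto
      also have "A * (exp ((m - 1) * l t) * \<kappa> - real n * (M * (E * exp ((m - 2) * l t)))) =
          (A * \<kappa>) * exp ((m - 1) * l t) - C2 * exp ((m - 2) * l t)"
        by (simp add: C2_def algebra_simps)
      also have "A * \<kappa> = C1 + 1"
        using \<kappa> by (simp add: A_def)
      finally have "\<Lambda>' t \<ge> exp ((m - 1) * l t) - C2 * exp ((m - 2) * l t)"
        using part1 by (simp add: \<Lambda>'_def algebra_simps)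
      also have "exp ((m - 1) * l t) - C2 * exp ((m - 2) * l t) = exp (l t) ^ (n - 3) * (exp (l t) - C2)"
      proof -
        have "exp (l t) ^ (n - 3) = exp ((m - 2) * l t)"
          using n by (simp add: exp_of_nat_mult[symmetric] m_def of_nat_diff)
        moreover have "exp ((m - 1) * l t) = exp ((m - 2) * l t) * exp (l t)"
          by (simp add: exp_add[symmetric] algebra_simps)
        ultimately show ?thesis
          by (simp add: algebra_simps)
      qed
      also have "\<dots> \<ge> - C"
      proof (cases "exp (l t) \<ge> C2")
        case True
        then have "exp (l t) ^ (n - 3) * (exp (l t) - C2) \<ge> 0"
          by auto
        then show ?thesis
          using pos by linarith
      next
        case False
        then have "exp (l t) ^ (n - 3) * C2 \<le> C2 ^ (n - 3) * C2"
          using pos by (intro mult_right_mono power_mono) auto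
        moreover have "exp (l t) ^ (n - 3) * exp (l t) \<ge> 0"
          by auto
        ultimately show ?thesis
          unfolding C_def right_diff_distrib by (smt (verit) mult.commute)
      qed
      finally show ?thesis .
    qed
    have \<Lambda>_start: "\<Lambda> t \<ge> \<Lambda>0" if "t \<in> {0..\<omega>}" "\<theta> t \<ge> \<alpha>" for t
      using \<Lambda>_close[of t] that \<alpha>m \<theta>pos[of t] ln_le_cancel_iff[of \<alpha> "\<theta> t"] unfolding \<Lambda>0_def by linarith
    \<comment> \<open>The slope bound holds only where \<open>\<theta> \<le> \<alpha>\<close>. The
      estimate is therefore restarted at the last time with \<open>\<theta> \<ge> \<alpha>\<close>,
      where \<open>\<Lambda> \<ge> \<Lambda>0\<close>, or at \<open>a\<close> if there is
      none.\<close>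
    have propagate: "\<theta> b \<ge> \<alpha> \<or> \<Lambda> b \<ge> x - C * \<omega>"
      if ab: "0 \<le> a" "a \<le> b" "b \<le> \<omega>" and x: "x \<le> \<Lambda>0" "\<theta> a \<ge> \<alpha> \<or> \<Lambda> a \<ge> x" for a b x
    proof (cases "\<theta> b \<ge> \<alpha>")
      case False
      define S where "S = insert a {t \<in> {a..b}. \<theta> t \<in> {\<alpha>..}}"
      have "closed S"
        unfolding S_def using continuous_on_subset[OF cont_\<theta>, of "{a..b}"] ab
        by (intro closed_insert continuous_closed_preimage[unfolded vimage_def Int_def, simplified] continuous_on_closed_Collect_le) auto
      moreover have S: "S \<noteq> {}" "bdd_above S"
        using ab by (auto simp: S_def intro!: bdd_aboveI[of _ b])
      ultimately have "Sup S \<in> S"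
        by (metis closed_contains_Sup)
      define c where "c = Sup S"
      have c: "c \<in> {a..b}" "\<Lambda> c \<ge> x"
        using \<open>Sup S \<in> S\<close> x ab \<Lambda>_start[of c] \<Lambda>_start[of a] by (auto simp: c_def S_def)
      have after: "\<theta> t < \<alpha>" if "c < t" "t \<le> b" for t
        using cSup_upper[OF _ S(2), of t] that c by (force simp: c_def S_def)
      have "\<Lambda> b \<ge> \<Lambda> c - C * (b - c)"
      proof (rule DERIV_lower_bound_increment)
        show "continuous_on {c..b} \<Lambda>"
          using c ab by (intro continuous_on_subset[OF cont_\<Lambda>]) auto
        show "(\<Lambda> has_real_derivative \<Lambda>' t) (at t)" if "c < t" "t < b" for t
          using \<Lambda>'[of t] that c ab by (auto simp: at_within_Icc_at)
        show "\<Lambda>' t \<ge> - C" if "c < t" "t < b" for t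
          using slope[of t] after[of t] that c ab by auto
      qed (use c in auto)
      moreover have "C * (b - c) \<le> C * \<omega>"
        using pos c ab by (intro mult_left_mono) auto
      ultimately show ?thesis
        using c by linarith
    qed auto
    have per: "\<theta> \<omega> = \<theta> 0" "\<Lambda> \<omega> = \<Lambda> 0"
      using sol by (auto simp: polar_sol_def \<Lambda>_def)
    have C\<omega>: "C * \<omega> \<ge> 0"
      using pos \<open>\<omega> > 0\<close> by simp
    have "\<theta> 0 \<ge> \<alpha> \<or> \<Lambda> 0 \<ge> \<Lambda>0 - C * \<omega>"
      using propagate[of t0 \<omega> \<Lambda>0] t0 per by auto
    then have "\<theta> t \<ge> \<alpha> \<or> \<Lambda> t \<ge> \<Lambda>0 - C * \<omega> - C * \<omega>"
      using t C\<omega> by (intro propagate[of 0 t]) auto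
    moreover have "\<theta> t \<ge> exp (\<Lambda>0 - 2 * C * \<omega> - A * exp (- l0))" if "\<Lambda> t \<ge> \<Lambda>0 - C * \<omega> - C * \<omega>"
    proof -
      have "ln (\<theta> t) \<ge> \<Lambda>0 - 2 * C * \<omega> - A * exp (- l0)"
        using \<Lambda>_close[OF t] that by linarith
      then show ?thesis
        using \<theta>pos[OF t] by (simp add: ln_ge_iff)
    qed
    ultimately show "\<theta> t \<ge> \<theta>0"
      by (auto simp: \<theta>0_def)
  qed
qed

section \<open>Boundedness of periodic solutions sector by sector\<close>

lemma cos_le_cos_of_mem_Icc:
  fixes x y :: real
  assumes "0 \<le> y" "y \<le> x" "x \<le> 2 * pi - y"
  shows "cos x \<le> cos y"
proof (cases "x \<le> pi")
  case False
  have "cos (2 * pi - x) \<le> cos y"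
    using assms False by (intro cos_monotone_0_pi_le) auto
  then show ?thesis
    by (simp add: cos_diff)
qed (use assms in \<open>auto intro!: cos_monotone_0_pi_le\<close>)

text \<open>Either \<open>\<theta>\<close> reaches \<open>\<alpha>\<close> at some time; then it is
  bounded away from \<open>0\<close>, so \<open>(n - 1) * \<theta>\<close> avoids a neighbourhood of
  the multiples of \<open>2 * pi\<close>. Or \<open>(n - 1) * \<theta>\<close> stays below
  \<open>pi / 2\<close> and its cosine is never negative. Each alternative omits a cone around one
  half axis.\<close>

lemma polar_sol_first_sector_bounded:
  fixes \<omega> M l0 :: real
  assumes n: "n \<ge> 4" and "\<omega> > 0" "M \<ge> 0"
  obtains R where "\<And>p l \<theta> t. polar_sol n p \<omega> l \<theta> \<Longrightarrow> bounded_coeffs n \<omega> M p \<Longrightarrow>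
    (\<And>t. t \<in> {0..\<omega>} \<Longrightarrow> 0 < \<theta> t) \<Longrightarrow> (\<And>t. t \<in> {0..\<omega>} \<Longrightarrow> \<theta> t \<le> pi / (real n - 2)) \<Longrightarrow>
    (\<And>t. t \<in> {0..\<omega>} \<Longrightarrow> l t \<ge> l0) \<Longrightarrow> t \<in> {0..\<omega>} \<Longrightarrow> l t \<le> R"
proof -
  have "n \<ge> 3" "n \<ge> 2"
    using n by auto
  define \<alpha> where "\<alpha> = pi / (2 * (real n - 1))"
  obtain \<theta>0 where "\<theta>0 > 0" and \<theta>0: "\<And>p l \<theta> t0 t. polar_sol n p \<omega> l \<theta> \<Longrightarrow> bounded_coeffs n \<omega> M p \<Longrightarrow>
    (\<And>t. t \<in> {0..\<omega>} \<Longrightarrow> 0 < \<theta> t) \<Longrightarrow> (\<And>t. t \<in> {0..\<omega>} \<Longrightarrow> l t \<ge> l0) \<Longrightarrow>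
    t0 \<in> {0..\<omega>} \<Longrightarrow> \<theta> t0 \<ge> \<alpha> \<Longrightarrow> t \<in> {0..\<omega>} \<Longrightarrow> \<theta> t \<ge> \<theta>0"
    by (rule polar_sol_argument_bounded_below[OF \<open>n \<ge> 3\<close> \<open>\<omega> > 0\<close> \<open>M \<ge> 0\<close> \<alpha>_def, of l0]) blast
  \<comment> \<open>The lower bound on \<open>\<theta>\<close> keeps
    \<open>(n - 1) * \<theta>\<close> away from \<open>0\<close>; the edge of the sector gives
    \<open>(n - 1) * \<theta> \<le> pi + pi / (n - 2)\<close>, at distance
    \<open>pi - pi / (n - 2)\<close> from \<open>2 * pi\<close>.\<close>
  define x0 where "x0 = min ((real n - 1) * \<theta>0) (pi - pi / (real n - 2))"
  have "pi / (real n - 2) < pi"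
    using n by (simp add: field_simps)
  then have x0: "0 < x0" "x0 \<le> pi"
    using \<open>\<theta>0 > 0\<close> n by (auto simp: x0_def min_le_iff_disj)
  define \<kappa> where "\<kappa> = max 0 (cos x0)"
  have "cos x0 < cos 0"
    using x0 by (intro cos_monotone_0_pi) auto
  then have \<kappa>: "0 \<le> \<kappa>" "\<kappa> < 1"
    by (auto simp: \<kappa>_def)
  obtain R where R: "\<And>p l \<theta> \<epsilon> t. polar_sol n p \<omega> l \<theta> \<Longrightarrow> bounded_coeffs n \<omega> M p \<Longrightarrow> \<epsilon> = 1 \<or> \<epsilon> = - 1 \<Longrightarrow>
    (\<And>t. t \<in> {0..\<omega>} \<Longrightarrow> \<epsilon> * cos ((real n - 1) * \<theta> t) \<le> \<kappa>) \<Longrightarrow> t \<in> {0..\<omega>} \<Longrightarrow> l t \<le> R"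
    by (rule polar_sol_avoiding_cone_bounded[OF \<open>n \<ge> 2\<close> \<open>\<omega> > 0\<close> \<kappa>, of M]) blast
  show thesis
  proof (rule that[of R])
    fix p l \<theta> s
    assume sol: "polar_sol n p \<omega> l \<theta>" and M: "bounded_coeffs n \<omega> M p"
      and pos: "\<And>t. t \<in> {0..\<omega>} \<Longrightarrow> 0 < \<theta> t"
      and upper: "\<And>t. t \<in> {0..\<omega>} \<Longrightarrow> \<theta> t \<le> pi / (real n - 2)"
      and l0: "\<And>t. t \<in> {0..\<omega>} \<Longrightarrow> l t \<ge> l0"
      and s: "s \<in> {0..\<omega>}"
    show "l s \<le> R"
    proof (cases "\<exists>t\<in>{0..\<omega>}. \<theta> t \<ge> \<alpha>")
      case True
      then obtain t0 where t0: "t0 \<in> {0..\<omega>}" "\<theta> t0 \<ge> \<alpha>"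
        by blast
      have "1 * cos ((real n - 1) * \<theta> t) \<le> \<kappa>" if t: "t \<in> {0..\<omega>}" for t
      proof -
        have "\<theta> t \<ge> \<theta>0"
          by (rule \<theta>0[OF sol M pos l0 t0 t])
        then have "(real n - 1) * \<theta> t \<ge> (real n - 1) * \<theta>0"
          using n by (intro mult_left_mono) auto
        moreover have "(real n - 1) * \<theta> t \<le> (real n - 1) * (pi / (real n - 2))"
          using n upper[OF t] by (intro mult_left_mono) auto
        moreover have "(real n - 1) * (pi / (real n - 2)) = pi + pi / (real n - 2)"
          using n by (simp add: field_simps)
        ultimately have "x0 \<le> (real n - 1) * \<theta> t" "(real n - 1) * \<theta> t \<le> 2 * pi - x0"
          unfolding x0_def by linarith+
        then show ?thesis
          using cos_le_cos_of_mem_Icc[of x0 "(real n - 1) * \<theta> t"] x0 by (auto simp: \<kappa>_def)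
      qed
      then show ?thesis
        by (intro R[OF sol M _ _ s, of 1]) auto
    next
      case False
      have "- 1 * cos ((real n - 1) * \<theta> t) \<le> \<kappa>" if t: "t \<in> {0..\<omega>}" for t
      proof -
        have "(real n - 1) * \<theta> t \<le> (real n - 1) * \<alpha>"
          using n False t by (intro mult_left_mono) (auto simp: not_le less_imp_le)
        moreover have "(real n - 1) * \<alpha> = pi / 2"
          using n unfolding \<alpha>_def by (subst times_divide_eq_right, subst nonzero_divide_eq_eq) auto
        moreover have "(real n - 1) * \<theta> t \<ge> 0"
          using n pos[OF t] by (intro mult_nonneg_nonneg) auto
        ultimately have "cos ((real n - 1) * \<theta> t) \<ge> 0"
          by (intro cos_ge_zero) auto
        then show ?thesis
          using \<kappa> by linarith
      qed
      then show ?thesis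
        by (intro R[OF sol M _ _ s, of "- 1"]) auto
    qed
  qed
qed

lemma cos_sin_reflect:
  fixes x :: real
  shows "cos ((real i - 1) * (pi - x)) = (-1) ^ (i + 1) * cos ((real i - 1) * x)"
    and "sin ((real i - 1) * (pi - x)) = (-1) ^ i * sin ((real i - 1) * x)"
proof -
  have "(real i - 1) * (pi - x) = real i * pi - (pi + (real i - 1) * x)"
    by (simp add: algebra_simps)
  then show "cos ((real i - 1) * (pi - x)) = (-1) ^ (i + 1) * cos ((real i - 1) * x)"
    and "sin ((real i - 1) * (pi - x)) = (-1) ^ i * sin ((real i - 1) * x)"
    by (simp_all only: cos_diff sin_diff cos_npi sin_npi) (simp_all add: cos_add sin_add)
qed

text \<open>
  The reflection \<open>z \<mapsto> - cnj z\<close> multiplies the leading coefficient by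
  \<open>(-1) ^ (n + 1)\<close>; for even \<open>n\<close> time is reversed to make it \<open>1\<close> again.
\<close>

lemma polar_sol_reflect:
  assumes sol: "polar_sol n p \<omega> l \<theta>"
    and \<tau>_def: "\<tau> = (\<lambda>t. if even n then \<omega> - t else t)"
  shows "polar_sol n (\<lambda>i t. (-1) ^ (n + i) * p i (\<tau> t)) \<omega> (\<lambda>t. l (\<tau> t)) (\<lambda>t. pi - \<theta> (\<tau> t))"
proof -
  have \<tau>: "\<tau> t \<in> {0..\<omega>}" if "t \<in> {0..\<omega>}" for t
    using that by (auto simp: \<tau>_def)
  have \<tau>_image: "\<tau> ` {0..\<omega>} = {0..\<omega>}"
    by (auto simp: \<tau>_def image_diff_atLeastAtMost)
  \<comment> \<open>The sign of the time change cancels the sign that the reflection puts on the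
    leading term, and leaves \<open>(-1) ^ (n + i)\<close> on the coefficient of degree
    \<open>i\<close>.\<close>
  have \<tau>': "(\<tau> has_real_derivative (-1) ^ (n + 1)) (at t within {0..\<omega>})" for t
    unfolding \<tau>_def by (cases "even n") (auto intro!: derivative_eq_intros)
  have chain: "((\<lambda>t. f (\<tau> t)) has_real_derivative d * (-1) ^ (n + 1)) (at t within {0..\<omega>})"
    if "(f has_real_derivative d) (at (\<tau> t) within {0..\<omega>})" for f d t
    using DERIV_image_chain[of f d \<tau> t "{0..\<omega>}", OF _ \<tau>'] that \<tau>_image by (simp add: o_def)
  have sgn: "(-1) ^ (n + i) * a * e * ((-1) ^ (i + 1) * c) = (-1) ^ (n + 1) * (a * e * (c::real))"
    "(-1) ^ (n + i) * a * e * ((-1) ^ i * c) = - ((-1) ^ (n + 1) * (a * e * c))" for a e c :: real and i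
    by (auto simp: power_add)
  show ?thesis
    unfolding polar_sol_def
  proof (intro conjI ballI)
    show "l (\<tau> \<omega>) = l (\<tau> 0)" "pi - \<theta> (\<tau> \<omega>) = pi - \<theta> (\<tau> 0)"
      using sol by (auto simp: \<tau>_def polar_sol_def)
  next
    fix t assume t: "t \<in> {0..\<omega>}"
    define s where "s = \<tau> t"
    note sol_s = sol[unfolded polar_sol_def, THEN conjunct2, THEN conjunct2, rule_format, OF \<tau>[OF t], folded s_def]
    show "((\<lambda>t. l (\<tau> t)) has_real_derivative exp ((real n - 1) * l (\<tau> t)) * cos ((real n - 1) * (pi - \<theta> (\<tau> t))) +
        (\<Sum>i<n. (-1) ^ (n + i) * p i (\<tau> t) * exp ((real i - 1) * l (\<tau> t)) * cos ((real i - 1) * (pi - \<theta> (\<tau> t)))))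
        (at t within {0..\<omega>})"
      unfolding cos_sin_reflect sgn s_def[symmetric]
      using chain[of l _ t, folded s_def, OF sol_s[THEN conjunct1]]
      by (simp add: sum_distrib_left algebra_simps)
    show "((\<lambda>t. pi - \<theta> (\<tau> t)) has_real_derivative exp ((real n - 1) * l (\<tau> t)) * sin ((real n - 1) * (pi - \<theta> (\<tau> t))) +
        (\<Sum>i<n. (-1) ^ (n + i) * p i (\<tau> t) * exp ((real i - 1) * l (\<tau> t)) * sin ((real i - 1) * (pi - \<theta> (\<tau> t)))))
        (at t within {0..\<omega>})"
      unfolding cos_sin_reflect sgn s_def[symmetric]
      using DERIV_diff[OF DERIV_const chain[of \<theta> _ t, folded s_def, OF sol_s[THEN conjunct2]], of pi]
      by (simp add: sum_distrib_left sum_negf algebra_simps)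
  qed
qed

text \<open>Mirror image of the sector at the positive axis. The reflection changes only signs of
  coefficients and possibly the direction of time, so the same bound \<open>M\<close> and the same
  \<open>R\<close> serve.\<close>

lemma polar_sol_last_sector_bounded:
  fixes \<omega> M l0 :: real
  assumes n: "n \<ge> 4" and "\<omega> > 0" "M \<ge> 0"
  obtains R where "\<And>p l \<theta> t. polar_sol n p \<omega> l \<theta> \<Longrightarrow> bounded_coeffs n \<omega> M p \<Longrightarrow>
    (\<And>t. t \<in> {0..\<omega>} \<Longrightarrow> \<theta> t < pi) \<Longrightarrow> (\<And>t. t \<in> {0..\<omega>} \<Longrightarrow> \<theta> t \<ge> pi - pi / (real n - 2)) \<Longrightarrow>
    (\<And>t. t \<in> {0..\<omega>} \<Longrightarrow> l t \<ge> l0) \<Longrightarrow> t \<in> {0..\<omega>} \<Longrightarrow> l t \<le> R"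
proof -
  obtain R where R: "\<And>p l \<theta> t. polar_sol n p \<omega> l \<theta> \<Longrightarrow> bounded_coeffs n \<omega> M p \<Longrightarrow>
    (\<And>t. t \<in> {0..\<omega>} \<Longrightarrow> 0 < \<theta> t) \<Longrightarrow> (\<And>t. t \<in> {0..\<omega>} \<Longrightarrow> \<theta> t \<le> pi / (real n - 2)) \<Longrightarrow>
    (\<And>t. t \<in> {0..\<omega>} \<Longrightarrow> l t \<ge> l0) \<Longrightarrow> t \<in> {0..\<omega>} \<Longrightarrow> l t \<le> R"
    by (rule polar_sol_first_sector_bounded[OF assms, of l0]) blast
  show thesis
  proof (rule that[of R])
    fix p l \<theta> s
    assume sol: "polar_sol n p \<omega> l \<theta>" and M: "bounded_coeffs n \<omega> M p"
      and less: "\<And>t. t \<in> {0..\<omega>} \<Longrightarrow> \<theta> t < pi"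
      and lower: "\<And>t. t \<in> {0..\<omega>} \<Longrightarrow> \<theta> t \<ge> pi - pi / (real n - 2)"
      and l0: "\<And>t. t \<in> {0..\<omega>} \<Longrightarrow> l t \<ge> l0"
      and s: "s \<in> {0..\<omega>}"
    define \<tau> where "\<tau> = (\<lambda>t. if even n then \<omega> - t else t)"
    have \<tau>: "\<tau> t \<in> {0..\<omega>}" if "t \<in> {0..\<omega>}" for t
      using that by (auto simp: \<tau>_def)
    have "bounded_coeffs n \<omega> M (\<lambda>i t. (-1) ^ (n + i) * p i (\<tau> t))"
      using M \<tau> by (auto simp: bounded_coeffs_def abs_mult)
    then have "l (\<tau> (\<tau> s)) \<le> R"
      using less lower l0 \<tau> s
      by (intro R[OF polar_sol_reflect[OF sol \<tau>_def]]) (auto simp: algebra_simps)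
    then show "l s \<le> R"
      by (cases "even n") (simp_all add: \<tau>_def)
  qed
qed

text \<open>With \<open>h = pi / (n - 2)\<close>, write \<open>(n - 1) * x\<close> as
  \<open>(n - 2) * x + x\<close>. The first summand runs from \<open>k * pi\<close> to
  \<open>(k + 1) * pi\<close>, the second from \<open>k * h\<close> to \<open>(k + 1) * h\<close>.
  As \<open>1 \<le> k\<close> and \<open>k + 1 \<le> n - 3\<close>, the total minus
  \<open>k * pi\<close> stays between \<open>h\<close> and \<open>2 * pi - h\<close>, so one
  asymptotic type of direction is missed by at least \<open>h\<close>.\<close>

lemma middle_sector_cos_le:
  fixes n k :: nat and x :: real
  assumes "1 \<le> k" "k + 3 < n"
    and x: "real k * pi / (real n - 2) \<le> x" "x \<le> real (k + 1) * pi / (real n - 2)"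
  shows "(-1) ^ k * cos ((real n - 1) * x) \<le> cos (pi / (real n - 2))"
proof -
  define h where "h = pi / (real n - 2)"
  have h: "h > 0" "(real n - 2) * h = pi"
    using assms(2) by (simp_all add: h_def)
  define y where "y = (real n - 1) * x - real k * pi"
  have "(real n - 1) * (real k * h) \<le> (real n - 1) * x" "(real n - 1) * x \<le> (real n - 1) * (real (k + 1) * h)"
    using x assms by (intro mult_left_mono; simp add: h_def)+
  moreover have "(real n - 1) * (real k * h) = real k * ((real n - 2) * h) + real k * h" 
    "(real n - 1) * (real (k + 1) * h) = real (k + 1) * ((real n - 2) * h) + real (k + 1) * h"
    by (simp_all add: algebra_simps)
  ultimately have y: "real k * h \<le> y" "y \<le> pi + real (k + 1) * h"
    unfolding h by (simp_all add: y_def algebra_simps)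
  have "1 * h \<le> real k * h"
    using assms h by (intro mult_right_mono) auto
  then have "h \<le> y"
    using y(1) by simp
  have "real (k + 1) * h \<le> (real n - 3) * h"
    using assms h(1) by (intro mult_right_mono) auto
  also have "(real n - 3) * h = pi - h"
    using h(2) by (simp add: algebra_simps)
  finally have "y \<le> 2 * pi - h"
    using y(2) by simp
  have "cos y \<le> cos h"
    by (rule cos_le_cos_of_mem_Icc) (use h(1) \<open>h \<le> y\<close> \<open>y \<le> 2 * pi - h\<close> in auto)
  also have "cos y = (-1) ^ k * cos ((real n - 1) * x)"
    by (simp add: y_def cos_diff)
  finally show ?thesis
    by (simp add: h_def)
qed

text \<open>The disjunction separates real solutions, whose constant direction trivially avoids one
  cone, from those with \<open>\<theta>\<close> strictly between \<open>0\<close> and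
  \<open>pi\<close>; the strictness is what permits \<open>ln \<theta>\<close> in the sectors next
  to the real axis.\<close>

lemma polar_sol_in_sector_bounded:
  fixes \<omega> M l0 :: real
  assumes n: "n \<ge> 5" and "\<omega> > 0" "M \<ge> 0"
  obtains R where "\<And>p l \<theta> k t. polar_sol n p \<omega> l \<theta> \<Longrightarrow> bounded_coeffs n \<omega> M p \<Longrightarrow>
    (\<forall>t\<in>{0..\<omega>}. \<theta> t = 0) \<or> (\<forall>t\<in>{0..\<omega>}. \<theta> t = pi) \<or> (\<forall>t\<in>{0..\<omega>}. 0 < \<theta> t \<and> \<theta> t < pi) \<Longrightarrow>
    k + 2 < n \<Longrightarrow> (\<And>t. t \<in> {0..\<omega>} \<Longrightarrow> real k * pi / (real n - 2) \<le> \<theta> t) \<Longrightarrow>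
    (\<And>t. t \<in> {0..\<omega>} \<Longrightarrow> \<theta> t \<le> real (k + 1) * pi / (real n - 2)) \<Longrightarrow>
    (\<And>t. t \<in> {0..\<omega>} \<Longrightarrow> l t \<ge> l0) \<Longrightarrow> t \<in> {0..\<omega>} \<Longrightarrow> l t \<le> R"
proof -
  have n': "n \<ge> 4" "n \<ge> 2"
    using n by auto
  obtain R1 where R1: "\<And>p l \<theta> t. polar_sol n p \<omega> l \<theta> \<Longrightarrow> bounded_coeffs n \<omega> M p \<Longrightarrow>
    (\<And>t. t \<in> {0..\<omega>} \<Longrightarrow> 0 < \<theta> t) \<Longrightarrow> (\<And>t. t \<in> {0..\<omega>} \<Longrightarrow> \<theta> t \<le> pi / (real n - 2)) \<Longrightarrow>
    (\<And>t. t \<in> {0..\<omega>} \<Longrightarrow> l t \<ge> l0) \<Longrightarrow> t \<in> {0..\<omega>} \<Longrightarrow> l t \<le> R1"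
    by (rule polar_sol_first_sector_bounded[OF n'(1) assms(2,3), of l0]) blast
  obtain R2 where R2: "\<And>p l \<theta> t. polar_sol n p \<omega> l \<theta> \<Longrightarrow> bounded_coeffs n \<omega> M p \<Longrightarrow>
    (\<And>t. t \<in> {0..\<omega>} \<Longrightarrow> \<theta> t < pi) \<Longrightarrow> (\<And>t. t \<in> {0..\<omega>} \<Longrightarrow> \<theta> t \<ge> pi - pi / (real n - 2)) \<Longrightarrow>
    (\<And>t. t \<in> {0..\<omega>} \<Longrightarrow> l t \<ge> l0) \<Longrightarrow> t \<in> {0..\<omega>} \<Longrightarrow> l t \<le> R2"
    by (rule polar_sol_last_sector_bounded[OF n'(1) assms(2,3), of l0]) blast
  have "pi / (real n - 2) \<le> pi / 2" "pi / (real n - 2) > 0"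
    using n divide_left_mono[of 2 "real n - 2" pi] by auto
  moreover from this have "pi / (real n - 2) \<le> pi"
    using pi_gt_zero by linarith
  ultimately have \<kappa>: "0 \<le> cos (pi / (real n - 2))" "cos (pi / (real n - 2)) < 1"
    using cos_monotone_0_pi[of 0 "pi / (real n - 2)"] by (auto intro!: cos_ge_zero)
  obtain R3 where R3: "\<And>p l \<theta> \<epsilon> t. polar_sol n p \<omega> l \<theta> \<Longrightarrow> bounded_coeffs n \<omega> M p \<Longrightarrow> \<epsilon> = 1 \<or> \<epsilon> = - 1 \<Longrightarrow>
    (\<And>t. t \<in> {0..\<omega>} \<Longrightarrow> \<epsilon> * cos ((real n - 1) * \<theta> t) \<le> cos (pi / (real n - 2))) \<Longrightarrow> t \<in> {0..\<omega>} \<Longrightarrow> l t \<le> R3"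
    by (rule polar_sol_avoiding_cone_bounded[OF n'(2) \<open>\<omega> > 0\<close> \<kappa>, of M]) blast
  show thesis
  proof (rule that[of "max R1 (max R2 R3)"])
    fix p l \<theta> k s
    assume sol: "polar_sol n p \<omega> l \<theta>" and M: "bounded_coeffs n \<omega> M p"
      and cases: "(\<forall>t\<in>{0..\<omega>}. \<theta> t = 0) \<or> (\<forall>t\<in>{0..\<omega>}. \<theta> t = pi) \<or> (\<forall>t\<in>{0..\<omega>}. 0 < \<theta> t \<and> \<theta> t < pi)"
      and k: "k + 2 < n" and lower: "\<And>t. t \<in> {0..\<omega>} \<Longrightarrow> real k * pi / (real n - 2) \<le> \<theta> t"
      and upper: "\<And>t. t \<in> {0..\<omega>} \<Longrightarrow> \<theta> t \<le> real (k + 1) * pi / (real n - 2)"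
      and l0: "\<And>t. t \<in> {0..\<omega>} \<Longrightarrow> l t \<ge> l0"
      and s: "s \<in> {0..\<omega>}"
    from cases show "l s \<le> max R1 (max R2 R3)"
    proof (elim disjE)
      assume "\<forall>t\<in>{0..\<omega>}. \<theta> t = 0"
      then have "l s \<le> R3"
        using \<kappa> by (intro R3[OF sol M _ _ s, of "- 1"]) auto
      then show ?thesis
        by simp
    next
      assume *: "\<forall>t\<in>{0..\<omega>}. \<theta> t = pi"
      \<comment> \<open>Hence \<open>\<epsilon> = (-1) ^ n\<close> makes
        \<open>\<epsilon> * cos ((n - 1) * \<theta>)\<close> equal to \<open>- 1\<close>.\<close>
      have "cos ((real n - 1) * pi) = (-1) ^ (n + 1)"
        using cos_sin_reflect(1)[of n 0] by simp
      then have "l s \<le> R3"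
        using \<kappa> * by (intro R3[OF sol M _ _ s, of "(-1) ^ n"]) (auto simp: uminus_power_if)
      then show ?thesis
        by simp
    next
      assume *: "\<forall>t\<in>{0..\<omega>}. 0 < \<theta> t \<and> \<theta> t < pi"
      consider "k = 0" | "k + 3 = n" | "1 \<le> k" "k + 3 < n"
        using k by linarith
      then show ?thesis
      proof cases
        case 1
        then have "l s \<le> R1"
          using * upper by (intro R1[OF sol M _ _ l0 s]) auto
        then show ?thesis
          by simp
      next
        case 2
        then have "real k * pi / (real n - 2) = pi - pi / (real n - 2)"
          using n by (auto simp: field_simps)
        then have "l s \<le> R2"
          using * lower by (intro R2[OF sol M _ _ l0 s]) auto
        then show ?thesis
          by simp
      next
        case 3
        have "(-1) ^ k = (1::real) \<or> (-1) ^ k = (- 1 :: real)"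
          by (auto simp: uminus_power_if)
        then have "l s \<le> R3"
          by (intro R3[OF sol M _ _ s, of "(-1) ^ k"] middle_sector_cos_le[OF 3] lower upper)
        then show ?thesis
          by simp
      qed
    qed
  qed
qed

section \<open>Initial value problems with Lipschitz right-hand side\<close>

lemma norm_increment_le:
  fixes f :: "real \<Rightarrow> 'a::real_normed_vector"
  assumes "a \<le> b"
    and f': "\<And>t. t \<in> {a..b} \<Longrightarrow> (f has_vector_derivative f' t) (at t within {a..b})"
    and g': "\<And>t. t \<in> {a..b} \<Longrightarrow> (g has_real_derivative g' t) (at t within {a..b})"
    and bound: "\<And>t. t \<in> {a..b} \<Longrightarrow> norm (f' t) \<le> g' t"
  shows "norm (f b - f a) \<le> g b - g a"
proof (cases "a < b")
  case True
  have "continuous_on {a..b} f"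
    using f' by (rule continuous_on_vector_derivative)
  moreover have "continuous_on {a..b} g"
    using g' by (rule DERIV_continuous_on)
  moreover have "(f has_vector_derivative f' t) (at t)" "(g has_vector_derivative g' t) (at t)" if "a < t" "t < b" for t
    using f'[of t] g'[of t] that
    by (auto simp: at_within_Icc_at has_real_derivative_iff_has_vector_derivative)
  ultimately show ?thesis
    using True bound by (intro differentiable_bound_general) auto
qed (use \<open>a \<le> b\<close> in auto)

text \<open>Let \<open>s\<close> maximise \<open>exp (- 2 * L * t) * norm (y t)\<close>, with
  maximum \<open>N\<close>. Integrating the bound up to \<open>s\<close> returns at most half of
  \<open>N * exp (2 * L * s)\<close>, which is absorbed on the left. The factors \<open>2\<close>
  are the price of this shortcut and are harmless.\<close>

lemma gronwall_bound:
  fixes y :: "real \<Rightarrow> 'a::real_normed_vector"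
  assumes "L > 0" "e \<ge> 0"
    and y': "\<And>t. t \<in> {0..\<omega>} \<Longrightarrow> (y has_vector_derivative y' t) (at t within {0..\<omega>})"
    and bound: "\<And>t. t \<in> {0..\<omega>} \<Longrightarrow> norm (y' t) \<le> L * norm (y t) + e"
    and t: "t \<in> {0..\<omega>}"
  shows "norm (y t) \<le> 2 * (norm (y 0) + e * \<omega>) * exp (2 * L * t)"
proof -
  have cont: "continuous_on {0..\<omega>} y"
    using y' by (rule continuous_on_vector_derivative)
  have "\<exists>s\<in>{0..\<omega>}. \<forall>t\<in>{0..\<omega>}. exp (- 2 * L * t) * norm (y t) \<le> exp (- 2 * L * s) * norm (y s)"
    using t by (intro continuous_attains_sup continuous_intros cont) auto
  then obtain s where s: "s \<in> {0..\<omega>}"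
      "\<And>t. t \<in> {0..\<omega>} \<Longrightarrow> exp (- 2 * L * t) * norm (y t) \<le> exp (- 2 * L * s) * norm (y s)"
    by blast
  define N where "N = exp (- 2 * L * s) * norm (y s)"
  have N: "norm (y t) \<le> N * exp (2 * L * t)" if "t \<in> {0..\<omega>}" for t
    using s(2)[OF that] by (simp add: N_def exp_minus field_simps)
  have "N \<ge> 0"
    by (simp add: N_def)
  have "norm (y s - y 0) \<le> (N / 2 * exp (2 * L * s) + e * s) - (N / 2 * exp (2 * L * 0) + e * 0)"
  proof (rule norm_increment_le)
    show "(y has_vector_derivative y' t) (at t within {0..s})" if "t \<in> {0..s}" for t
      using that s y'[of t] by (auto intro: has_vector_derivative_within_subset)
    show "((\<lambda>t. N / 2 * exp (2 * L * t) + e * t) has_real_derivative (N * L * exp (2 * L * t) + e)) (at t within {0..s})" for t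
      by (auto intro!: derivative_eq_intros)
    show "norm (y' t) \<le> N * L * exp (2 * L * t) + e" if "t \<in> {0..s}" for t
    proof -
      have "L * norm (y t) \<le> L * (N * exp (2 * L * t))"
        using that s \<open>L > 0\<close> by (intro mult_left_mono N) auto
      then show ?thesis
        using bound[of t] that s by (simp add: algebra_simps)
    qed
  qed (use s in auto)
  also have "\<dots> \<le> N / 2 * exp (2 * L * s) + e * \<omega>"
    using \<open>N \<ge> 0\<close> \<open>e \<ge> 0\<close> s mult_left_mono[of s \<omega> e] by auto
  finally have "norm (y s) \<le> norm (y 0) + e * \<omega> + N / 2 * exp (2 * L * s)"
    using norm_triangle_ineq2[of "y s" "y 0"] by linarith
  moreover have "norm (y s) = N * exp (2 * L * s)"
    by (simp add: N_def exp_minus)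
  ultimately have "N * exp (2 * L * s) \<le> 2 * (norm (y 0) + e * \<omega>)"
    by simp
  moreover have "N * 1 \<le> N * exp (2 * L * s)"
    using \<open>N \<ge> 0\<close> s \<open>L > 0\<close> by (intro mult_left_mono) auto
  ultimately have "N \<le> 2 * (norm (y 0) + e * \<omega>)"
    by linarith
  then have "N * exp (2 * L * t) \<le> 2 * (norm (y 0) + e * \<omega>) * exp (2 * L * t)"
    by (intro mult_right_mono) auto
  then show ?thesis
    using N[OF t] by linarith
qed

text \<open>Picard iteration in Bielecki's weighted norm: for
  \<open>u t = exp (- 2 * L * t) * \<phi> t\<close> the integral operator contracts by
  \<open>1 / 2\<close> on the whole interval, so no subdivision is necessary.\<close>

theorem lipschitz_ivp_solution_exists:
  fixes F :: "real \<Rightarrow> 'a::banach \<Rightarrow> 'a"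
  assumes "\<omega> \<ge> 0" "L > 0"
    and cont: "continuous_on ({0..\<omega>} \<times> UNIV) (\<lambda>(t, z). F t z)"
    and lip: "\<And>t z w. t \<in> {0..\<omega>} \<Longrightarrow> norm (F t z - F t w) \<le> L * norm (z - w)"
  shows "\<exists>\<phi>. \<phi> 0 = c \<and> (\<forall>t\<in>{0..\<omega>}. (\<phi> has_vector_derivative F t (\<phi> t)) (at t within {0..\<omega>}))"
proof -
  \<comment> \<open>Clamping time to the interval lets the fixed point be sought among bounded
    continuous functions on the whole real line.\<close>
  define k where "k t = max 0 (min \<omega> t)" for t
  have k: "k t \<in> {0..\<omega>}" for t
    using \<open>\<omega> \<ge> 0\<close> by (auto simp: k_def)
  have cont_k: "continuous_on UNIV k"
    unfolding k_def by (intro continuous_intros)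
  define E where "E t = exp (2 * L * t)" for t
  define G where "G u t = F t (E t *\<^sub>R apply_bcontfun u t)" for u :: "real \<Rightarrow>\<^sub>C 'a" and t
  have cont_G: "continuous_on {0..\<omega>} (G u)" for u
  proof -
    have "continuous_on {0..\<omega>} (\<lambda>t. (\<lambda>(t, z). F t z) (t, E t *\<^sub>R apply_bcontfun u t))"
      unfolding E_def
      by (rule continuous_on_compose2[OF cont]) (auto intro!: continuous_intros continuous_on_apply_bcontfun)
    then show ?thesis
      by (simp add: G_def [abs_def])
  qed
  have int_G: "((\<lambda>t. integral {0..t} (G u)) has_vector_derivative G u t) (at t within {0..\<omega>})"
    if "t \<in> {0..\<omega>}" for u t
    using cont_G that by (rule integral_has_vector_derivative)
  define S where "S u t = (1 / E t) *\<^sub>R (c + integral {0..t} (G u))" for u t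
  have cont_S: "continuous_on {0..\<omega>} (S u)" for u
  proof -
    have "continuous_on {0..\<omega>} (\<lambda>t. integral {0..t} (G u))"
      using int_G by (rule continuous_on_vector_derivative)
    then show ?thesis
      unfolding S_def [abs_def] E_def by (intro continuous_intros) auto
  qed
  have S: "(\<lambda>t. S u (k t)) \<in> bcontfun" for u
  proof -
    have "compact (S u ` {0..\<omega>})"
      by (intro compact_continuous_image cont_S) auto
    then obtain b where "\<And>t. t \<in> {0..\<omega>} \<Longrightarrow> norm (S u t) \<le> b"
      by (meson compact_imp_bounded bounded_iff imageI)
    moreover have "continuous_on UNIV (\<lambda>t. S u (k t))"
      by (rule continuous_on_compose2[OF cont_S cont_k]) (use k in auto)
    ultimately show ?thesis
      using k by (intro bcontfun_normI[of _ b]) auto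
  qed
  define \<Phi> where "\<Phi> u = Bcontfun (\<lambda>t. S u (k t))" for u
  have \<Phi>: "apply_bcontfun (\<Phi> u) t = S u (k t)" for u t
    unfolding \<Phi>_def using S by (simp add: Bcontfun_inverse)
  have "dist (\<Phi> u) (\<Phi> v) \<le> 1 / 2 * dist u v" for u v
  proof (rule dist_bound)
    fix t
    define s where "s = k t"
    define d where "d = dist u v"
    have s: "s \<in> {0..\<omega>}"
      using k by (simp add: s_def)
    have "norm ((integral {0..s} (G u) - integral {0..s} (G v)) - (integral {0..0} (G u) - integral {0..0} (G v)))
        \<le> d / 2 * E s - d / 2 * E 0"
    proof (rule norm_increment_le[where f = "\<lambda>s. integral {0..s} (G u) - integral {0..s} (G v)"])
      show "((\<lambda>s. integral {0..s} (G u) - integral {0..s} (G v)) has_vector_derivative G u t - G v t) (at t within {0..s})"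
        if "t \<in> {0..s}" for t
        using that s by (intro has_vector_derivative_within_subset[OF has_vector_derivative_diff[OF int_G int_G]]) auto
      show "((\<lambda>t. d / 2 * E t) has_real_derivative L * (E t * d)) (at t within {0..s})" for t
        unfolding E_def by (auto intro!: derivative_eq_intros)
      show "norm (G u t - G v t) \<le> L * (E t * d)" if "t \<in> {0..s}" for t
      proof -
        have "norm (G u t - G v t) \<le> L * norm (E t *\<^sub>R apply_bcontfun u t - E t *\<^sub>R apply_bcontfun v t)"
          unfolding G_def using that s by (intro lip) auto
        also have "norm (E t *\<^sub>R apply_bcontfun u t - E t *\<^sub>R apply_bcontfun v t) = E t * dist (apply_bcontfun u t) (apply_bcontfun v t)"
          by (simp add: scaleR_diff_right[symmetric] dist_norm E_def)
        also have "L * \<dots> \<le> L * (E t * d)"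
          using \<open>L > 0\<close> dist_bounded[of u t v] by (intro mult_left_mono) (auto simp: E_def d_def)
        finally show ?thesis .
      qed
    qed (use s in auto)
    moreover have "E 0 = 1" "d \<ge> 0"
      by (simp_all add: E_def d_def)
    ultimately have *: "norm (integral {0..s} (G u) - integral {0..s} (G v)) \<le> d / 2 * E s"
      by simp
    have "dist (apply_bcontfun (\<Phi> u) t) (apply_bcontfun (\<Phi> v) t) = norm (integral {0..s} (G u) - integral {0..s} (G v)) / E s"
      unfolding \<Phi> S_def s_def[symmetric] dist_norm scaleR_diff_right[symmetric] by (simp add: E_def)
    also have "\<dots> \<le> d / 2"
      using * by (simp add: E_def field_simps)
    finally show "dist (apply_bcontfun (\<Phi> u) t) (apply_bcontfun (\<Phi> v) t) \<le> 1 / 2 * dist u v"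
      by (simp add: d_def)
  qed
  then obtain u where u: "\<Phi> u = u"
    using banach_fix_type[of "1 / 2" \<Phi>] by auto
  define \<phi> where "\<phi> t = c + integral {0..t} (G u)" for t
  have "G u t = F t (\<phi> t)" if "t \<in> {0..\<omega>}" for t
  proof -
    have "apply_bcontfun u t = S u t"
      using \<Phi>[of u t] that by (simp add: u k_def)
    then show ?thesis
      by (simp add: G_def \<phi>_def S_def E_def)
  qed
  then have "(\<phi> has_vector_derivative F t (\<phi> t)) (at t within {0..\<omega>})" if "t \<in> {0..\<omega>}" for t
    using int_G[OF that, of u] that unfolding \<phi>_def [abs_def] by (auto intro!: derivative_eq_intros)
  then show ?thesis
    by (intro exI[of _ \<phi>]) (auto simp: \<phi>_def)
qed

text \<open>Gronwall without inhomogeneity, run forwards from \<open>s\<close> and, for earlier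
  times, in reversed time. Allowing any \<open>s\<close> shows that a solution neither enters nor
  leaves the real axis or an equilibrium.\<close>

lemma zero_of_linear_growth_bound:
  fixes y :: "real \<Rightarrow> 'a::real_normed_vector"
  assumes "L > 0"
    and y': "\<And>t. t \<in> {0..\<omega>} \<Longrightarrow> (y has_vector_derivative y' t) (at t within {0..\<omega>})"
    and bound: "\<And>t. t \<in> {0..\<omega>} \<Longrightarrow> norm (y' t) \<le> L * norm (y t)"
    and s: "s \<in> {0..\<omega>}" "y s = 0" and t: "t \<in> {0..\<omega>}"
  shows "y t = 0"
proof (cases "s \<le> t")
  case True
  have "((\<lambda>x. y (s + x)) has_vector_derivative y' (s + x)) (at x within {0..\<omega> - s})"
    if "x \<in> {0..\<omega> - s}" for x
  proof -
    have "(y has_vector_derivative y' (s + x)) (at (s + x) within (\<lambda>x. s + x) ` {0..\<omega> - s})"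
      using that s by (intro has_vector_derivative_within_subset[OF y']) auto
    moreover have "((\<lambda>x. s + x) has_vector_derivative 1) (at x within {0..\<omega> - s})"
      by (auto intro!: derivative_eq_intros)
    ultimately show ?thesis
      using vector_diff_chain_within[of "\<lambda>x. s + x" 1 x "{0..\<omega> - s}" y] by (simp add: o_def)
  qed
  then have "norm (y (s + (t - s))) \<le> 2 * (norm (y (s + 0)) + 0 * (\<omega> - s)) * exp (2 * L * (t - s))"
    using True s t bound \<open>L > 0\<close> by (intro gronwall_bound) auto
  then show ?thesis
    using s by simp
next
  case False
  have "((\<lambda>x. y (s - x)) has_vector_derivative - y' (s - x)) (at x within {0..s})"
    if "x \<in> {0..s}" for x
  proof -
    have "(y has_vector_derivative y' (s - x)) (at (s - x) within (\<lambda>x. s - x) ` {0..s})"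
      using that s by (intro has_vector_derivative_within_subset[OF y']) auto
    moreover have "((\<lambda>x. s - x) has_vector_derivative - 1) (at x within {0..s})"
      by (auto intro!: derivative_eq_intros)
    ultimately show ?thesis
      using vector_diff_chain_within[of "\<lambda>x. s - x" "- 1" x "{0..s}" y] by (simp add: o_def)
  qed
  then have "norm (y (s - (s - t))) \<le> 2 * (norm (y (s - 0)) + 0 * s) * exp (2 * L * (s - t))"
    using False s t bound \<open>L > 0\<close> by (intro gronwall_bound) auto
  then show ?thesis
    using s by simp
qed

section \<open>Polynomial right-hand sides on a ball: Taylor estimates and uniqueness\<close>

lemma power_taylor_on_ball:
  fixes R :: real
  shows "\<exists>C\<ge>0. \<forall>z w :: complex. norm z \<le> R \<longrightarrow> norm w \<le> R \<longrightarrow>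
           norm (z ^ i - w ^ i) \<le> C * norm (z - w) \<and>
           norm (z ^ i - w ^ i - of_nat i * w ^ (i - 1) * (z - w)) \<le> C * (norm (z - w))\<^sup>2"
proof (cases "R \<ge> 0")
  case R: True
  show ?thesis
  proof (induction i)
    case (Suc i)
    then obtain C where "C \<ge> 0" and C: "\<And>z w :: complex. norm z \<le> R \<Longrightarrow> norm w \<le> R \<Longrightarrow>
        norm (z ^ i - w ^ i) \<le> C * norm (z - w) \<and>
        norm (z ^ i - w ^ i - of_nat i * w ^ (i - 1) * (z - w)) \<le> C * (norm (z - w))\<^sup>2"
      by blast
    define C' where "C' = R * C + R ^ i + real i * R ^ (i - 1)"
    have "norm (z ^ Suc i - w ^ Suc i) \<le> C' * norm (z - w)"
      "norm (z ^ Suc i - w ^ Suc i - of_nat (Suc i) * w ^ (Suc i - 1) * (z - w)) \<le> C' * (norm (z - w))\<^sup>2"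
      if zw: "norm z \<le> R" "norm w \<le> R" for z w :: complex
    proof -
      have "z ^ Suc i - w ^ Suc i = z * (z ^ i - w ^ i) + w ^ i * (z - w)"
        by (simp add: algebra_simps)
      also have "norm \<dots> \<le> R * (C * norm (z - w)) + R ^ i * norm (z - w)"
        using C[OF zw] zw \<open>C \<ge> 0\<close> R
        by (intro order_trans[OF norm_triangle_ineq] add_mono) (auto simp: norm_mult norm_power intro!: mult_mono power_mono)
      also have "\<dots> \<le> C' * norm (z - w)"
        using R by (simp add: C'_def algebra_simps)
      finally show "norm (z ^ Suc i - w ^ Suc i) \<le> C' * norm (z - w)" .
      have "z ^ Suc i - w ^ Suc i - of_nat (Suc i) * w ^ (Suc i - 1) * (z - w) =
          z * (z ^ i - w ^ i - of_nat i * w ^ (i - 1) * (z - w)) + of_nat i * w ^ (i - 1) * (z - w)\<^sup>2"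
        by (cases i) (simp_all add: algebra_simps power2_eq_square)
      also have "norm \<dots> \<le> R * (C * (norm (z - w))\<^sup>2) + real i * R ^ (i - 1) * (norm (z - w))\<^sup>2"
        using C[OF zw] zw \<open>C \<ge> 0\<close> R
        by (intro order_trans[OF norm_triangle_ineq] add_mono) (auto simp: norm_mult norm_power intro!: mult_mono power_mono)
      also have "\<dots> \<le> C' * (norm (z - w))\<^sup>2"
        using R by (simp add: C'_def algebra_simps)
      finally show "norm (z ^ Suc i - w ^ Suc i - of_nat (Suc i) * w ^ (Suc i - 1) * (z - w)) \<le> C' * (norm (z - w))\<^sup>2" .
    qed
    then show ?case
      using R \<open>C \<ge> 0\<close> by (intro exI[of _ C']) (auto simp: C'_def)
  qed auto
qed (auto intro!: exI[of _ 0] dest: order_trans[OF norm_ge_zero])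

text \<open>The derivative of \<open>rhs\<close> in \<open>w\<close>. At \<open>i = 0\<close> the
  truncated exponent is harmless because the factor \<open>of_nat i\<close> vanishes.\<close>

definition drhs :: "nat \<Rightarrow> (nat \<Rightarrow> real \<Rightarrow> real) \<Rightarrow> real \<Rightarrow> complex \<Rightarrow> complex" where
  "drhs n p t w = of_nat n * w ^ (n - 1) + (\<Sum>i<n. complex_of_real (p i t) * (of_nat i * w ^ (i - 1)))"

text \<open>\<open>C\<close> is produced before \<open>p\<close> is chosen, so that one constant
  serves all members of the deformation.\<close>

lemma rhs_taylor_on_ball:
  fixes M R :: real
  assumes "M \<ge> 0"
  obtains C where "C > 0"
    "\<And>p t z w. bounded_coeffs n \<omega> M p \<Longrightarrow> t \<in> {0..\<omega>} \<Longrightarrow> norm z \<le> R \<Longrightarrow> norm w \<le> R \<Longrightarrow>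
       norm (rhs n p t z - rhs n p t w) \<le> C * norm (z - w)"
    "\<And>p t z w. bounded_coeffs n \<omega> M p \<Longrightarrow> t \<in> {0..\<omega>} \<Longrightarrow> norm z \<le> R \<Longrightarrow> norm w \<le> R \<Longrightarrow>
       norm (rhs n p t z - rhs n p t w - drhs n p t w * (z - w)) \<le> C * (norm (z - w))\<^sup>2"
    "\<And>p t w. bounded_coeffs n \<omega> M p \<Longrightarrow> t \<in> {0..\<omega>} \<Longrightarrow> norm w \<le> R \<Longrightarrow> norm (drhs n p t w) \<le> C"
proof -
  obtain K where K0: "\<And>i. K i \<ge> 0" and K: "\<And>i (z::complex) w. norm z \<le> R \<Longrightarrow> norm w \<le> R \<Longrightarrow>
        norm (z ^ i - w ^ i) \<le> K i * norm (z - w)"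
       "\<And>i (z::complex) w. norm z \<le> R \<Longrightarrow> norm w \<le> R \<Longrightarrow>
        norm (z ^ i - w ^ i - of_nat i * w ^ (i - 1) * (z - w)) \<le> K i * (norm (z - w))\<^sup>2"
    using power_taylor_on_ball[of R] by metis
  define J where "J i = real i * \<bar>R\<bar> ^ (i - 1)" for i
  have J: "norm (of_nat i * w ^ (i - 1)) \<le> J i" if "norm w \<le> R" for w :: complex and i
    using that by (auto simp: J_def norm_mult norm_power intro!: mult_left_mono power_mono)
  have J0: "J i \<ge> 0" for i
    by (simp add: J_def)
  define C where "C = 1 + (K n + (\<Sum>i<n. M * K i)) + (J n + (\<Sum>i<n. M * J i))"
  have sums: "(\<Sum>i<n. M * K i) \<ge> 0" "(\<Sum>i<n. M * J i) \<ge> 0"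
    using \<open>M \<ge> 0\<close> K0 J0 by (auto intro!: sum_nonneg)
  have C: "C \<ge> K n + (\<Sum>i<n. M * K i)" "C \<ge> J n + (\<Sum>i<n. M * J i)" "C > 0"
    using K0[of n] J0[of n] sums by (auto simp: C_def)
  have comb: "norm (f n + (\<Sum>i<n. complex_of_real (p i t) * f i)) \<le> (k n + (\<Sum>i<n. M * k i)) * x"
    if "bounded_coeffs n \<omega> M p" "t \<in> {0..\<omega>}" "\<And>i. norm (f i) \<le> k i * x" for p t f x and k :: "nat \<Rightarrow> real"
  proof -
    have "norm (\<Sum>i<n. complex_of_real (p i t) * f i) \<le> (\<Sum>i<n. M * (k i * x))"
      using that \<open>M \<ge> 0\<close> by (intro sum_norm_le) (auto simp: norm_mult bounded_coeffs_def intro!: mult_mono)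
    also have "\<dots> = (\<Sum>i<n. M * k i) * x"
      by (simp add: sum_distrib_right mult.assoc)
    finally show ?thesis
      using that(3)[of n] by (intro order_trans[OF norm_triangle_ineq]) (auto simp: distrib_right intro!: add_mono)
  qed
  show thesis
  proof (rule that[OF C(3)])
    fix p t and z w :: complex
    assume p: "bounded_coeffs n \<omega> M p" "t \<in> {0..\<omega>}" and zw: "norm z \<le> R" "norm w \<le> R"
    have "rhs n p t z - rhs n p t w = (z ^ n - w ^ n) + (\<Sum>i<n. complex_of_real (p i t) * (z ^ i - w ^ i))"
      by (simp add: rhs_def sum_subtractf algebra_simps)
    also have "norm \<dots> \<le> (K n + (\<Sum>i<n. M * K i)) * norm (z - w)"
      by (rule comb[OF p, of "\<lambda>i. z ^ i - w ^ i"]) (rule K[OF zw])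
    also have "\<dots> \<le> C * norm (z - w)"
      using C by (intro mult_right_mono) auto
    finally show "norm (rhs n p t z - rhs n p t w) \<le> C * norm (z - w)" .
    have "rhs n p t z - rhs n p t w - drhs n p t w * (z - w) = (z ^ n - w ^ n - of_nat n * w ^ (n - 1) * (z - w)) +
        (\<Sum>i<n. complex_of_real (p i t) * (z ^ i - w ^ i - of_nat i * w ^ (i - 1) * (z - w)))"
      by (simp add: rhs_def drhs_def sum_subtractf sum_distrib_right sum_distrib_left sum.distrib algebra_simps)
    also have "norm \<dots> \<le> (K n + (\<Sum>i<n. M * K i)) * (norm (z - w))\<^sup>2"
      by (rule comb[OF p, of "\<lambda>i. z ^ i - w ^ i - of_nat i * w ^ (i - 1) * (z - w)"]) (rule K[OF zw])
    also have "\<dots> \<le> C * (norm (z - w))\<^sup>2"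
      using C by (intro mult_right_mono) auto
    finally show "norm (rhs n p t z - rhs n p t w - drhs n p t w * (z - w)) \<le> C * (norm (z - w))\<^sup>2" .
  next
    fix p t and w :: complex
    assume p: "bounded_coeffs n \<omega> M p" "t \<in> {0..\<omega>}" and w: "norm w \<le> R"
    have "norm (drhs n p t w) \<le> (J n + (\<Sum>i<n. M * J i)) * 1"
      unfolding drhs_def by (rule comb[OF p, of "\<lambda>i. of_nat i * w ^ (i - 1)"]) (use J[OF w] in simp)
    then show "norm (drhs n p t w) \<le> C"
      using C by simp
  qed
qed

lemma rhs_lipschitz_on_ball:
  fixes M R :: real
  assumes "M \<ge> 0"
  obtains L where "L > 0"
    "\<And>p t z w. bounded_coeffs n \<omega> M p \<Longrightarrow> t \<in> {0..\<omega>} \<Longrightarrow> norm z \<le> R \<Longrightarrow> norm w \<le> R \<Longrightarrow>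
       norm (rhs n p t z - rhs n p t w) \<le> L * norm (z - w)"
proof (rule rhs_taylor_on_ball[OF assms, of n \<omega> R])
  fix C :: real
  assume C: "C > 0"
    "\<And>p t z w. bounded_coeffs n \<omega> M p \<Longrightarrow> t \<in> {0..\<omega>} \<Longrightarrow> norm z \<le> R \<Longrightarrow> norm w \<le> R \<Longrightarrow>
       norm (rhs n p t z - rhs n p t w) \<le> C * norm (z - w)"
  show thesis
    using C by (rule that)
qed

lemma rhs_coeff_perturbation:
  assumes "\<And>i. i < n \<Longrightarrow> \<bar>p i t - q i t\<bar> \<le> e" "norm z \<le> R"
  shows "norm (rhs n p t z - rhs n q t z) \<le> e * (\<Sum>i<n. R ^ i)"
proof -
  have *: "\<bar>p i t - q i t\<bar> * norm z ^ i \<le> e * R ^ i" if "i < n" for i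
    using order_trans[OF abs_ge_zero assms(1)[OF that]] assms that
    by (intro mult_mono power_mono) auto
  have "rhs n p t z - rhs n q t z = (\<Sum>i<n. complex_of_real (p i t - q i t) * z ^ i)"
    by (simp add: rhs_def sum_subtractf algebra_simps)
  also have "norm \<dots> \<le> (\<Sum>i<n. e * R ^ i)"
    by (intro sum_norm_le) (use * in \<open>simp add: norm_mult norm_power del: of_real_diff\<close>)
  finally show ?thesis
    by (simp add: sum_distrib_left)
qed

lemma is_sol_continuous:
  assumes "is_sol n p \<omega> c \<phi>"
  shows "continuous_on {0..\<omega>} \<phi>"
  by (rule continuous_on_vector_derivative) (use assms in \<open>auto simp: is_sol_def\<close>)

lemma is_sol_bounded:
  assumes "is_sol n p \<omega> c \<phi>"
  shows "bounded (\<phi> ` {0..\<omega>})"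
  using assms by (intro compact_imp_bounded compact_continuous_image is_sol_continuous) auto

lemma is_sol_unique:
  assumes M: "bounded_coeffs n \<omega> M p" and "M \<ge> 0"
    and sol: "is_sol n p \<omega> c \<phi>" "is_sol n p \<omega> c \<psi>" and t: "t \<in> {0..\<omega>}"
  shows "\<phi> t = \<psi> t"
proof -
  have "bounded (\<phi> ` {0..\<omega>} \<union> \<psi> ` {0..\<omega>})"
    using is_sol_bounded[OF sol(1)] is_sol_bounded[OF sol(2)] by simp
  then obtain R where "\<forall>z\<in>\<phi> ` {0..\<omega>} \<union> \<psi> ` {0..\<omega>}. norm z \<le> R"
    unfolding bounded_iff ..
  then have R: "norm (\<phi> t) \<le> R \<and> norm (\<psi> t) \<le> R" if "t \<in> {0..\<omega>}" for t
    using that by auto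
  obtain L where "L > 0" and L: "\<And>p t z w. bounded_coeffs n \<omega> M p \<Longrightarrow> t \<in> {0..\<omega>} \<Longrightarrow>
      norm z \<le> R \<Longrightarrow> norm w \<le> R \<Longrightarrow> norm (rhs n p t z - rhs n p t w) \<le> L * norm (z - w)"
    by (rule rhs_lipschitz_on_ball[OF \<open>M \<ge> 0\<close>, of n \<omega> R]) blast
  have "\<phi> t - \<psi> t = 0"
  proof (rule zero_of_linear_growth_bound[OF \<open>L > 0\<close>])
    show "((\<lambda>t. \<phi> t - \<psi> t) has_vector_derivative rhs n p t (\<phi> t) - rhs n p t (\<psi> t)) (at t within {0..\<omega>})"
      if "t \<in> {0..\<omega>}" for t
      using sol that by (auto simp: is_sol_def intro!: has_vector_derivative_diff)
    show "norm (rhs n p t (\<phi> t) - rhs n p t (\<psi> t)) \<le> L * norm (\<phi> t - \<psi> t)" if "t \<in> {0..\<omega>}" for t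
      using R[OF that] that by (intro L[OF M]) auto
    show "0 \<in> {0..\<omega>}" "\<phi> 0 - \<psi> 0 = 0" "t \<in> {0..\<omega>}"
      using sol t by (auto simp: is_sol_def)
  qed
  then show ?thesis
    by simp
qed

section \<open>The a priori bound\<close>

text \<open>
  Here \<open>r = K powr (1 / n)\<close>.  The last condition is weaker than the hypothesis on \<open>P 1\<close>, but it is convex
  in the coefficients.
\<close>

definition sector_conditions :: "nat \<Rightarrow> real \<Rightarrow> real \<Rightarrow> real \<Rightarrow> (nat \<Rightarrow> real \<Rightarrow> real) \<Rightarrow> bool" where
  "sector_conditions n r \<sigma> \<omega> p \<longleftrightarrow> (\<sigma> = 1 \<or> \<sigma> = - 1) \<and> (\<forall>t\<in>{0..\<omega>}.
     \<bar>p 0 t\<bar> < r ^ n \<and> p (n - 2) t \<le> 0 \<and>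
     (\<forall>i\<in>{2..n-3}. \<bar>p i t\<bar> * r ^ i \<le>
        (r ^ n - r ^ (n - 2) * p (n - 2) t - \<bar>p 0 t\<bar>) / real (n - 4) * sin (pi / real (n - 2))) \<and>
     \<sigma> * p 1 t * r \<ge> r ^ n + \<bar>p 0 t\<bar> + (\<Sum>i\<in>{2..<n}. \<bar>p i t\<bar> * r ^ i))"

section \<open>Direction of the vector field on rays and near the circle\<close>

lemma sin_le_sin_of_mem_Icc:
  fixes x y :: real
  assumes "0 \<le> y" "y \<le> x" "x \<le> pi - y"
  shows "sin y \<le> sin x"
proof (cases "x \<le> pi / 2")
  case False
  have "sin y \<le> sin (pi - x)"
    using assms False by (intro sin_monotone_2pi_le) auto
  then show ?thesis
    by simp
qed (use assms in \<open>auto intro!: sin_monotone_2pi_le\<close>)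

text \<open>There are \<open>n - 4\<close> summands, which explains the divisor in the hypothesis.
  Bounding every sine by \<open>1\<close> would give only \<open>s \<le> sin x\<close>, where
  \<open>s = sin (pi / (n - 2))\<close>. The summand \<open>i = 2\<close> has the factor
  \<open>sin x\<close> itself, and \<open>s < 1\<close> then makes the inequality strict.\<close>

lemma ray_inequality:
  fixes n :: nat and a :: "nat \<Rightarrow> real"
  assumes n: "n \<ge> 5" and r: "r > 0" "r \<le> \<rho>"
    and a0: "\<bar>a 0\<bar> < r ^ n" and a2: "a (n - 2) \<le> 0"
    and a: "\<And>i. i \<in> {2..n-3} \<Longrightarrow> \<bar>a i\<bar> * r ^ i \<le>
        (r ^ n - r ^ (n - 2) * a (n - 2) - \<bar>a 0\<bar>) / real (n - 4) * sin (pi / real (n - 2))"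
    and x: "pi / real (n - 2) \<le> x" "x \<le> pi - pi / real (n - 2)"
  shows "(\<Sum>i\<in>{2..n-3}. \<bar>a i\<bar> * \<rho> ^ i * \<bar>sin ((real i - 1) * x)\<bar>) <
           sin x * (\<rho> ^ n - a (n - 2) * \<rho> ^ (n - 2) - \<bar>a 0\<bar>)"
proof -
  define s where "s = sin (pi / real (n - 2))"
  define S where "S = r ^ n - r ^ (n - 2) * a (n - 2) - \<bar>a 0\<bar>"
  define \<mu> where "\<mu> = \<rho> / r"
  have \<rho>: "\<rho> = \<mu> * r" and \<mu>: "\<mu> \<ge> 1"
    using r by (auto simp: \<mu>_def)
  have "r ^ (n - 2) * a (n - 2) \<le> 0"
    using r a2 by (simp add: mult_nonneg_nonpos)
  then have S: "S > 0"
    using a0 by (simp add: S_def)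
  have "pi / real (n - 2) < pi / 2" "pi / real (n - 2) > 0"
    using n divide_strict_left_mono[of 2 "real (n - 2)" pi] by auto
  moreover from this(1) have "pi / real (n - 2) < pi"
    by (rule less_trans) simp
  ultimately have s: "0 < s" "s < 1" "s \<le> sin x"
    using sin_monotone_2pi[of "pi / real (n - 2)" "pi / 2"] x
    by (auto simp: s_def intro!: sin_gt_zero sin_le_sin_of_mem_Icc)
  have term_le: "\<bar>a i\<bar> * \<rho> ^ i * \<bar>sin ((real i - 1) * x)\<bar> \<le> \<mu> ^ (n - 3) * (S / real (n - 4) * s) * c"
    if i: "i \<in> {2..n-3}" and c: "\<bar>sin ((real i - 1) * x)\<bar> \<le> c" for i c
  proof -
    have "\<bar>a i\<bar> * \<rho> ^ i = \<mu> ^ i * (\<bar>a i\<bar> * r ^ i)"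
      by (simp add: \<rho> power_mult_distrib)
    also have "\<dots> \<le> \<mu> ^ (n - 3) * (S / real (n - 4) * s)"
    proof (rule mult_mono)
      show "\<bar>a i\<bar> * r ^ i \<le> S / real (n - 4) * s"
        using a[OF i] by (simp only: S_def s_def)
    qed (use i \<mu> r in \<open>auto intro!: power_increasing\<close>)
    finally have "\<bar>a i\<bar> * \<rho> ^ i \<le> \<mu> ^ (n - 3) * (S / real (n - 4) * s)" .
    then show ?thesis
      by (rule mult_mono[OF _ c]) (use S s \<mu> in auto)
  qed
  have "{2..n-3} = insert 2 {3..n-3}"
    using n by auto
  then have "(\<Sum>i\<in>{2..n-3}. \<bar>a i\<bar> * \<rho> ^ i * \<bar>sin ((real i - 1) * x)\<bar>) =
      \<bar>a 2\<bar> * \<rho> ^ 2 * \<bar>sin ((real 2 - 1) * x)\<bar> + (\<Sum>i\<in>{3..n-3}. \<bar>a i\<bar> * \<rho> ^ i * \<bar>sin ((real i - 1) * x)\<bar>)"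
    by simp
  also have "\<dots> \<le> \<mu> ^ (n - 3) * (S / real (n - 4) * s) * sin x +
      (\<Sum>i\<in>{3..n-3}. \<mu> ^ (n - 3) * (S / real (n - 4) * s) * 1)"
    using n s by (intro add_mono sum_mono term_le) auto
  also have "\<dots> = \<mu> ^ (n - 3) * S * (s * (sin x + (real n - 5)) / (real n - 4))"
    using n by (simp add: of_nat_diff divide_inverse algebra_simps)
  also have "\<dots> < \<mu> ^ (n - 3) * S * sin x"
  proof (intro mult_strict_left_mono)
    have "0 < sin x * (1 - s)"
      using s by (intro mult_pos_pos) auto
    moreover have "0 \<le> (real n - 5) * (sin x - s)"
      using s n by (intro mult_nonneg_nonneg) auto
    ultimately have "s * (sin x + (real n - 5)) < sin x * (real n - 4)"
      by (simp add: algebra_simps)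
    then show "s * (sin x + (real n - 5)) / (real n - 4) < sin x"
      using n by (simp add: field_simps)
  qed (use S \<mu> in auto)
  \<comment> \<open>Passing from radius \<open>r\<close> to \<open>\<mu> * r\<close> multiplies the
    left side by at most \<open>\<mu> ^ (n - 3)\<close>; the positive terms on the right gain at
    least that, and the subtracted constant term does not grow.\<close>
  also have "\<mu> ^ (n - 3) * S \<le> \<rho> ^ n - a (n - 2) * \<rho> ^ (n - 2) - \<bar>a 0\<bar>"
  proof -
    have "\<mu> ^ (n - 3) * r ^ n \<le> \<mu> ^ n * r ^ n" "\<mu> ^ (n - 3) * (- a (n - 2) * r ^ (n - 2)) \<le> \<mu> ^ (n - 2) * (- a (n - 2) * r ^ (n - 2))"
      "1 * \<bar>a 0\<bar> \<le> \<mu> ^ (n - 3) * \<bar>a 0\<bar>"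
      using \<mu> r a2 n by (intro mult_right_mono power_increasing one_le_power; auto simp: mult_nonpos_nonneg)+
    then show ?thesis
      by (simp add: S_def \<rho> power_mult_distrib algebra_simps)
  qed
  then have "\<mu> ^ (n - 3) * S * sin x \<le> sin x * (\<rho> ^ n - a (n - 2) * \<rho> ^ (n - 2) - \<bar>a 0\<bar>)"
    using s by (simp add: mult.commute)
  finally show ?thesis .
qed

text \<open>On the ray \<open>(n - 2) * x = k * pi\<close>, hence
  \<open>(n - 1) * x = k * pi + x\<close> and \<open>(n - 3) * x = k * pi - x\<close>. The linear
  term never turns, the constant term contributes at most \<open>\<bar>a 0\<bar> * sin x\<close>
  after multiplication by \<open>exp l\<close>, and \<open>ray_inequality\<close> handles the
  rest.\<close>

lemma angular_velocity_on_ray: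
  fixes n k :: nat and a :: "nat \<Rightarrow> real"
  assumes n: "n \<ge> 5" and r: "r > 0" "ln r \<le> l"
    and a0: "\<bar>a 0\<bar> < r ^ n" and a2: "a (n - 2) \<le> 0"
    and a: "\<And>i. i \<in> {2..n-3} \<Longrightarrow> \<bar>a i\<bar> * r ^ i \<le>
        (r ^ n - r ^ (n - 2) * a (n - 2) - \<bar>a 0\<bar>) / real (n - 4) * sin (pi / real (n - 2))"
    and k: "1 \<le> k" "k \<le> n - 3" and x: "x = real k * pi / (real n - 2)"
  shows "(-1) ^ k * (exp ((real n - 1) * l) * sin ((real n - 1) * x) +
           (\<Sum>i<n. a i * exp ((real i - 1) * l) * sin ((real i - 1) * x))) > 0"
proof -
  define \<rho> where "\<rho> = exp l"
  have "r \<le> \<rho>"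
    using r by (simp add: \<rho>_def flip: ln_le_cancel_iff[of r "exp l"])
  have \<rho>: "\<rho> * exp ((real i - 1) * l) = \<rho> ^ i" for i
    by (simp add: \<rho>_def exp_add[symmetric] exp_of_nat_mult[symmetric] algebra_simps)
  have kx: "(real n - 2) * x = real k * pi"
    using n by (simp add: x)
  have "(real n - 1) * x = real k * pi + x"
    using kx by (simp add: algebra_simps)
  then have s1: "sin ((real n - 1) * x) = (-1) ^ k * sin x"
    by (simp add: sin_add)
  have "(real (n - 2) - 1) * x = real k * pi - x"
    using n kx by (simp add: of_nat_diff algebra_simps)
  then have s2: "sin ((real (n - 2) - 1) * x) = - ((-1) ^ k * sin x)"
    by (simp add: sin_diff)
  have s3: "sin ((real (n - 1) - 1) * x) = 0"
    using n kx by (simp add: of_nat_diff)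
  have "{..<n} = insert 0 (insert 1 (insert (n - 1) (insert (n - 2) {2..n-3})))"
    using n by auto
  moreover have "0 \<notin> insert 1 (insert (n - 1) (insert (n - 2) {2..n-3}))"
    "1 \<notin> insert (n - 1) (insert (n - 2) {2..n-3})" "n - 1 \<notin> insert (n - 2) {2..n-3}" "n - 2 \<notin> {2..n-3}"
    using n by auto
  ultimately have sum: "(\<Sum>i<n. f i) = f 0 + f 1 + f (n - 1) + f (n - 2) + (\<Sum>i\<in>{2..n-3}. f i)" for f :: "nat \<Rightarrow> real"
    by (simp only: sum.insert finite_insert finite_atLeastAtMost not_False_eq_True add.assoc)
  define T where "T = (\<Sum>i\<in>{2..n-3}. a i * \<rho> ^ i * sin ((real i - 1) * x))"
  have "\<rho> * (exp ((real n - 1) * l) * sin ((real n - 1) * x) +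
           (\<Sum>i<n. a i * exp ((real i - 1) * l) * sin ((real i - 1) * x))) =
        (\<rho> * exp ((real n - 1) * l)) * sin ((real n - 1) * x) +
           (\<Sum>i<n. a i * (\<rho> * exp ((real i - 1) * l)) * sin ((real i - 1) * x))"
    by (simp add: sum_distrib_left algebra_simps)
  also have "\<dots> = \<rho> ^ n * ((-1) ^ k * sin x) - a 0 * sin x - a (n - 2) * \<rho> ^ (n - 2) * ((-1) ^ k * sin x) + T"
    unfolding \<rho> sum s1 s2 s3 T_def by simp
  finally have "\<rho> * ((-1) ^ k * (exp ((real n - 1) * l) * sin ((real n - 1) * x) +
           (\<Sum>i<n. a i * exp ((real i - 1) * l) * sin ((real i - 1) * x)))) =
      (-1) ^ k * (\<rho> ^ n * ((-1) ^ k * sin x) - a 0 * sin x - a (n - 2) * \<rho> ^ (n - 2) * ((-1) ^ k * sin x) + T)"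
    by (simp add: mult.left_commute)
  also have "\<dots> = sin x * (\<rho> ^ n - a (n - 2) * \<rho> ^ (n - 2) - (-1) ^ k * a 0) + (-1) ^ k * T"
    by (cases "even k") (simp_all add: algebra_simps)
  also have "\<dots> > 0"
  proof -
    have x': "pi / real (n - 2) \<le> x" "x \<le> pi - pi / real (n - 2)"
    proof -
      have "pi - pi / real (n - 2) = (real n - 3) * pi / (real n - 2)"
        using n by (simp add: of_nat_diff field_simps)
      moreover have "1 * pi / (real n - 2) \<le> x" "x \<le> (real n - 3) * pi / (real n - 2)"
        using n k unfolding x by (intro divide_right_mono mult_right_mono; simp)+
      ultimately show "pi / real (n - 2) \<le> x" "x \<le> pi - pi / real (n - 2)"
        using n by (simp_all add: of_nat_diff)
    qed
    have "pi / real (n - 2) > 0"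
      using n by simp
    then have "0 \<le> x" "x \<le> pi"
      using order_trans[OF less_imp_le x'(1)] order_trans[OF x'(2), of pi] by simp_all
    then have "sin x \<ge> 0"
      by (rule sin_ge_zero)
    have "\<bar>(-1) ^ k * T\<bar> = \<bar>T\<bar>"
      by (simp add: abs_mult)
    also have "\<dots> \<le> (\<Sum>i\<in>{2..n-3}. \<bar>a i * \<rho> ^ i * sin ((real i - 1) * x)\<bar>)"
      unfolding T_def by (rule sum_abs)
    also have "\<dots> = (\<Sum>i\<in>{2..n-3}. \<bar>a i\<bar> * \<rho> ^ i * \<bar>sin ((real i - 1) * x)\<bar>)"
      using r \<open>r \<le> \<rho>\<close> by (simp add: abs_mult)
    also have "\<dots> < sin x * (\<rho> ^ n - a (n - 2) * \<rho> ^ (n - 2) - \<bar>a 0\<bar>)"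
      by (rule ray_inequality[OF n r(1) \<open>r \<le> \<rho>\<close> a0 a2 a x'])
    also have "\<dots> \<le> sin x * (\<rho> ^ n - a (n - 2) * \<rho> ^ (n - 2) - (-1) ^ k * a 0)"
      using \<open>sin x \<ge> 0\<close> by (intro mult_left_mono) (auto simp: uminus_power_if)
    finally show ?thesis
      by linarith
  qed
  finally show ?thesis
    using r \<open>r \<le> \<rho>\<close> by (simp add: zero_less_mult_iff)
qed

text \<open>On the circle of radius \<open>r\<close> the hypotheses give only a weak inequality.
  Slightly inside, the terms of degree at least \<open>2\<close> lose against the linear one. The
  constant term does not shrink, but its relative gain is outweighed by the loss of the leading term
  because \<open>\<bar>p 0 t\<bar> < r ^ n\<close>.\<close>

lemma radial_velocity_inside:
  fixes n :: nat and z :: complex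
  assumes n: "n \<ge> 3" and r: "r > 0" and z: "norm z = \<mu> * r" and \<mu>: "3 / 4 \<le> \<mu>" "\<mu> < 1"
    and \<sigma>: "\<sigma> = 1 \<or> \<sigma> = - 1" and p0: "\<bar>p 0 t\<bar> < r ^ n"
    and p1: "\<sigma> * p 1 t * r \<ge> r ^ n + \<bar>p 0 t\<bar> + (\<Sum>i\<in>{2..<n}. \<bar>p i t\<bar> * r ^ i)"
  shows "\<sigma> * (z \<bullet> rhs n p t z) > 0"
proof -
  define w where "w = z ^ n + of_real (p 0 t) + (\<Sum>i\<in>{2..<n}. of_real (p i t) * z ^ i)"
  have "{..<n} = insert 0 (insert 1 {2..<n})"
    using n by auto
  then have rhs: "rhs n p t z = p 1 t *\<^sub>R z + w"
    by (simp add: rhs_def w_def scaleR_conv_of_real add.assoc)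
  have mu_i: "\<mu> ^ i \<le> \<mu>" if "i \<ge> 1" for i
    using that \<mu> power_decreasing[of 1 i \<mu>] by simp
  have "norm w \<le> norm z ^ n + \<bar>p 0 t\<bar> + (\<Sum>i\<in>{2..<n}. \<bar>p i t\<bar> * norm z ^ i)"
    unfolding w_def
    by (intro order_trans[OF norm_triangle_ineq] add_mono sum_norm_le) (auto simp: norm_mult norm_power)
  also have "norm z ^ n \<le> \<mu> ^ 3 * r ^ n"
    using n \<mu> r by (auto simp: z power_mult_distrib intro!: mult_right_mono power_decreasing)
  also have "(\<Sum>i\<in>{2..<n}. \<bar>p i t\<bar> * norm z ^ i) \<le> (\<Sum>i\<in>{2..<n}. \<mu> * (\<bar>p i t\<bar> * r ^ i))"
  proof (intro sum_mono)
    fix i assume "i \<in> {2..<n}"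
    then have "\<mu> ^ i * (\<bar>p i t\<bar> * r ^ i) \<le> \<mu> * (\<bar>p i t\<bar> * r ^ i)"
      using r by (intro mult_right_mono mu_i) auto
    then show "\<bar>p i t\<bar> * norm z ^ i \<le> \<mu> * (\<bar>p i t\<bar> * r ^ i)"
      by (simp add: z power_mult_distrib mult_ac)
  qed
  also have "\<mu> ^ 3 * r ^ n + \<bar>p 0 t\<bar> + \<dots> < \<mu> * (r ^ n + \<bar>p 0 t\<bar> + (\<Sum>i\<in>{2..<n}. \<bar>p i t\<bar> * r ^ i))"
  proof -
    \<comment> \<open>What is needed is \<open>\<mu> * (1 + \<mu>) \<ge> 1\<close>, true from
      \<open>(sqrt 5 - 1) / 2\<close> on; \<open>3 / 4\<close> is a convenient larger
      number.\<close>
    have "(3 / 4) * (1 + 3 / 4) \<le> \<mu> * (1 + \<mu>)"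
      using \<mu> by (intro mult_mono) auto
    then have "\<mu> * (1 + \<mu>) \<ge> 1"
      by simp
    then have "1 * r ^ n \<le> (\<mu> * (1 + \<mu>)) * r ^ n"
      using r by (intro mult_right_mono) auto
    then have "(1 - \<mu>) * \<bar>p 0 t\<bar> < (1 - \<mu>) * (\<mu> * (1 + \<mu>) * r ^ n)"
      using \<mu> p0 by (intro mult_strict_left_mono) auto
    then show ?thesis
      by (simp add: algebra_simps power3_eq_cube sum_distrib_left)
  qed
  also have "\<dots> \<le> \<mu> * (\<sigma> * p 1 t * r)"
    using p1 \<mu> by (intro mult_left_mono) auto
  finally have "norm w < \<sigma> * p 1 t * norm z"
    by (simp add: z mult_ac)
  then have "norm z * norm w < norm z * (\<sigma> * p 1 t * norm z)"
    using z r \<mu> by (intro mult_strict_left_mono) auto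
  moreover have "\<bar>\<sigma> * (z \<bullet> w)\<bar> \<le> norm z * norm w"
    using \<sigma> Cauchy_Schwarz_ineq2[of z w] by auto
  moreover have "\<sigma> * (z \<bullet> rhs n p t z) = norm z * (\<sigma> * p 1 t * norm z) + \<sigma> * (z \<bullet> w)"
    unfolding rhs by (simp add: inner_add_right dot_square_norm power2_eq_square algebra_simps)
  ultimately show ?thesis
    by linarith
qed

text \<open>The sign \<open>\<sigma>\<close> fixes in which direction circles slightly smaller than
  the given one are crossed, so a periodic solution cannot visit both sides of such a
  circle.\<close>

lemma periodic_sol_outside_disc:
  assumes n: "n \<ge> 3" and "\<omega> > 0" "r > 0" and cond: "sector_conditions n r \<sigma> \<omega> p"
    and sol: "is_sol n p \<omega> c \<phi>" "\<phi> \<omega> = c"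
    and t0: "t0 \<in> {0..\<omega>}" "norm (\<phi> t0) > r" and t: "t \<in> {0..\<omega>}"
  shows "norm (\<phi> t) \<ge> r"
proof (rule ccontr)
  assume neg: "\<not> norm (\<phi> t) \<ge> r"
  \<comment> \<open>Any level strictly between the supposed small value and \<open>r\<close>, yet
    not below \<open>3 / 4 * r\<close>.\<close>
  define \<mu> where "\<mu> = max (3 / 4) ((norm (\<phi> t) / r + 1) / 2)"
  have \<mu>: "3 / 4 \<le> \<mu>" "\<mu> < 1" "norm (\<phi> t) < \<mu> * r"
  proof -
    define u where "u = norm (\<phi> t) / r"
    have "u < 1"
      using neg \<open>r > 0\<close> by (simp add: u_def)
    then show "3 / 4 \<le> \<mu>" "\<mu> < 1"
      by (auto simp: \<mu>_def simp flip: u_def)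
    have "u < \<mu>"
      using \<open>u < 1\<close> by (auto simp: \<mu>_def less_max_iff_disj simp flip: u_def)
    then show "norm (\<phi> t) < \<mu> * r"
      using \<open>r > 0\<close> by (simp add: u_def field_simps)
  qed
  have \<sigma>: "\<sigma> = 1 \<or> \<sigma> = - 1"
    using cond by (simp add: sector_conditions_def)
  define g where "g t = \<sigma> * (\<phi> t \<bullet> \<phi> t)" for t
  have g': "(g has_real_derivative 2 * (\<sigma> * (\<phi> t \<bullet> rhs n p t (\<phi> t)))) (at t within {0..\<omega>})"
    if "t \<in> {0..\<omega>}" for t
  proof -
    have "(\<phi> has_vector_derivative rhs n p t (\<phi> t)) (at t within {0..\<omega>})"
      using sol that by (simp add: is_sol_def)
    from bounded_bilinear.has_vector_derivative[OF bounded_bilinear_inner this this]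
    have "((\<lambda>t. \<phi> t \<bullet> \<phi> t) has_real_derivative 2 * (\<phi> t \<bullet> rhs n p t (\<phi> t))) (at t within {0..\<omega>})"
      by (simp add: has_real_derivative_iff_has_vector_derivative inner_commute)
    from DERIV_cmult[OF this, of \<sigma>] show ?thesis
      by (simp add: g_def [abs_def] mult.left_commute)
  qed
  have per: "g \<omega> = g 0"
    using sol by (simp add: g_def is_sol_def)
  define v where "v = \<sigma> * (\<mu> * r)\<^sup>2"
  have pos: "2 * (\<sigma> * (\<phi> t \<bullet> rhs n p t (\<phi> t))) > 0" if "t \<in> {0..\<omega>}" "g t = v" for t
  proof -
    have "(norm (\<phi> t))\<^sup>2 = (\<mu> * r)\<^sup>2"
      using that \<sigma> by (auto simp: g_def v_def dot_square_norm)
    then have "norm (\<phi> t) = \<mu> * r"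
      using \<mu> \<open>r > 0\<close> by (subst (asm) power2_eq_iff_nonneg) auto
    then show ?thesis
      using radial_velocity_inside[OF n \<open>r > 0\<close> _ \<mu>(1,2) \<sigma>, of "\<phi> t" p t] cond that
      by (auto simp: sector_conditions_def)
  qed
  have "(norm (\<phi> t))\<^sup>2 < (\<mu> * r)\<^sup>2"
    using \<mu> by (intro power_strict_mono) auto
  moreover have "(\<mu> * r)\<^sup>2 < (norm (\<phi> t0))\<^sup>2"
  proof (intro power_strict_mono)
    have "\<mu> * r < 1 * r"
      using \<mu> \<open>r > 0\<close> by (intro mult_strict_right_mono) auto
    then show "\<mu> * r < norm (\<phi> t0)"
      using t0 by simp
  qed (use \<mu> \<open>r > 0\<close> in auto)
  ultimately show False
    using periodic_level[OF \<open>\<omega> > 0\<close> g' per pos] t t0 \<sigma> by (force simp: g_def v_def dot_square_norm)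
qed

text \<open>Each inner ray is crossed in one direction only, given by the parity of its index, so a
  periodic angle stays on one side of it. The sector begins at the last ray that stays below the
  angle.\<close>

lemma periodic_polar_sol_in_sector:
  assumes n: "n \<ge> 5" and "\<omega> > 0" "r > 0" and cond: "sector_conditions n r \<sigma> \<omega> p"
    and sol: "polar_sol n p \<omega> l \<theta>" and l: "\<And>t. t \<in> {0..\<omega>} \<Longrightarrow> l t \<ge> ln r"
    and \<theta>: "\<And>t. t \<in> {0..\<omega>} \<Longrightarrow> 0 \<le> \<theta> t \<and> \<theta> t \<le> pi"
  obtains k where "k + 2 < n" "\<And>t. t \<in> {0..\<omega>} \<Longrightarrow> real k * pi / (real n - 2) \<le> \<theta> t"
    "\<And>t. t \<in> {0..\<omega>} \<Longrightarrow> \<theta> t \<le> real (k + 1) * pi / (real n - 2)"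
proof -
  define \<beta> where "\<beta> k = real k * pi / (real n - 2)" for k
  define \<theta>' where "\<theta>' t = exp ((real n - 1) * l t) * sin ((real n - 1) * \<theta> t) +
        (\<Sum>i<n. p i t * exp ((real i - 1) * l t) * sin ((real i - 1) * \<theta> t))" for t
  have \<theta>': "(\<theta> has_real_derivative \<theta>' t) (at t within {0..\<omega>})" if "t \<in> {0..\<omega>}" for t
    using sol that by (simp add: polar_sol_def \<theta>'_def)
  have per: "\<theta> \<omega> = \<theta> 0"
    using sol by (simp add: polar_sol_def)
  have one_side: "(\<forall>t\<in>{0..\<omega>}. \<beta> k \<le> \<theta> t) \<or> (\<forall>t\<in>{0..\<omega>}. \<theta> t \<le> \<beta> k)" if k: "1 \<le> k" "k \<le> n - 3" for k
  proof -
    have sgn: "(-1) ^ k * \<theta>' t > 0" if "t \<in> {0..\<omega>}" "\<theta> t = \<beta> k" for t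
      unfolding \<theta>'_def
      by (rule angular_velocity_on_ray[OF n \<open>r > 0\<close> l _ _ _ k])
        (use that cond in \<open>auto simp: sector_conditions_def \<beta>_def\<close>)
    show ?thesis
    proof (cases "even k")
      case True
      then show ?thesis
        using periodic_level[OF \<open>\<omega> > 0\<close> \<theta>' per, of "\<beta> k"] sgn by auto
    next
      case False
      then show ?thesis
        using periodic_level_neg[OF \<open>\<omega> > 0\<close> \<theta>' per, of "\<beta> k"] sgn by auto
    qed
  qed
  define A where "A = {k. k \<le> n - 3 \<and> (\<forall>t\<in>{0..\<omega>}. \<beta> k \<le> \<theta> t)}"
  have A: "finite A" "A \<noteq> {}"
  proof -
    show "finite A"
      by (rule finite_subset[of _ "{..n - 3}"]) (auto simp: A_def)
    have "0 \<in> A"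
      using \<theta> by (auto simp: A_def \<beta>_def)
    then show "A \<noteq> {}"
      by auto
  qed
  define k where "k = Max A"
  have k: "k \<in> A"
    unfolding k_def using A by (rule Max_in)
  have upper: "\<theta> t \<le> \<beta> (k + 1)" if t: "t \<in> {0..\<omega>}" for t
  proof (cases "k = n - 3")
    case True
    then have "\<beta> (k + 1) = pi"
      using n by (simp add: \<beta>_def of_nat_diff)
    then show ?thesis
      using \<theta>[OF t] by simp
  next
    case False
    have "k + 1 \<notin> A"
      using Max_ge[OF A(1), of "k + 1"] by (auto simp: k_def)
    then show ?thesis
      using one_side[of "k + 1"] False k t by (auto simp: A_def)
  qed
  show thesis
    using k upper n by (intro that[of k]) (auto simp: A_def \<beta>_def)
qed

section \<open>Passage to logarithms and the uniform bound\<close>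

lemma polar_sol_of_logarithm:
  assumes sol: "is_sol n p \<omega> c \<phi>" "\<phi> \<omega> = c"
    and L: "\<And>t. t \<in> {0..\<omega>} \<Longrightarrow> exp (L t) = \<phi> t" "L \<omega> = L 0"
    and L': "\<And>t. t \<in> {0..\<omega>} \<Longrightarrow> (L has_vector_derivative rhs n p t (\<phi> t) / \<phi> t) (at t within {0..\<omega>})"
  shows "polar_sol n p \<omega> (\<lambda>t. Re (L t)) (\<lambda>t. Im (L t))"
  unfolding polar_sol_def
proof (intro conjI ballI)
  show "Re (L \<omega>) = Re (L 0)" "Im (L \<omega>) = Im (L 0)"
    using L by simp_all
next
  fix t assume t: "t \<in> {0..\<omega>}"
  have pow: "\<phi> t ^ i / \<phi> t = exp (complex_of_real (real i - 1) * L t)" for i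
    unfolding L(1)[OF t, symmetric] by (simp add: exp_of_nat_mult[symmetric] exp_diff[symmetric] algebra_simps)
  have "rhs n p t (\<phi> t) / \<phi> t = \<phi> t ^ n / \<phi> t + (\<Sum>i<n. complex_of_real (p i t) * (\<phi> t ^ i / \<phi> t))"
    by (simp add: rhs_def add_divide_distrib sum_divide_distrib)
  then have eq: "rhs n p t (\<phi> t) / \<phi> t = exp (complex_of_real (real n - 1) * L t) +
      (\<Sum>i<n. complex_of_real (p i t) * exp (complex_of_real (real i - 1) * L t))"
    by (simp only: pow)
  have Re: "Re (exp (complex_of_real x * L t)) = exp (x * Re (L t)) * cos (x * Im (L t))"
    and Im: "Im (exp (complex_of_real x * L t)) = exp (x * Re (L t)) * sin (x * Im (L t))" for x
    by (simp_all add: Re_exp Im_exp)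
  show "((\<lambda>t. Re (L t)) has_real_derivative exp ((real n - 1) * Re (L t)) * cos ((real n - 1) * Im (L t)) +
        (\<Sum>i<n. p i t * exp ((real i - 1) * Re (L t)) * cos ((real i - 1) * Im (L t)))) (at t within {0..\<omega>})"
    using bounded_linear.has_vector_derivative[OF bounded_linear_Re L'[OF t]] unfolding eq
    by (simp add: has_real_derivative_iff_has_vector_derivative Re Im Re_sum Re_complex_of_real mult.assoc del: of_real_diff)
  show "((\<lambda>t. Im (L t)) has_real_derivative exp ((real n - 1) * Re (L t)) * sin ((real n - 1) * Im (L t)) +
        (\<Sum>i<n. p i t * exp ((real i - 1) * Re (L t)) * sin ((real i - 1) * Im (L t)))) (at t within {0..\<omega>})"
    using bounded_linear.has_vector_derivative[OF bounded_linear_Im L'[OF t]] unfolding eq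
    by (simp add: has_real_derivative_iff_has_vector_derivative Re Im Im_sum mult.assoc del: of_real_diff)
qed

lemma logarithm_has_vector_derivative:
  assumes "(\<phi> has_vector_derivative d) (at t within S)" "\<phi> t \<notin> \<real>\<^sub>\<le>\<^sub>0"
  shows "((\<lambda>t. Ln (\<phi> t)) has_vector_derivative d / \<phi> t) (at t within S)"
proof -
  have "(Ln has_field_derivative inverse (\<phi> t)) (at (\<phi> t) within \<phi> ` S)"
    using assms(2) by (intro has_field_derivative_at_within[OF has_field_derivative_Ln])
  from field_vector_diff_chain_within[OF assms(1) this] show ?thesis
    by (simp add: o_def field_simps)
qed

text \<open>The coefficients are real, so \<open>cnj (\<phi> t)\<close> solves the same equation,
  and the difference vanishes at time \<open>s\<close>. Hence a solution is real throughout or stays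
  in one open half plane.\<close>

lemma is_sol_real:
  assumes M: "bounded_coeffs n \<omega> M p" "M \<ge> 0" and sol: "is_sol n p \<omega> c \<phi>"
    and s: "s \<in> {0..\<omega>}" "Im (\<phi> s) = 0" and t: "t \<in> {0..\<omega>}"
  shows "Im (\<phi> t) = 0"
proof -
  obtain R where "\<forall>z\<in>\<phi> ` {0..\<omega>}. norm z \<le> R"
    using is_sol_bounded[OF sol] unfolding bounded_iff ..
  then have R: "norm (\<phi> t) \<le> R" if "t \<in> {0..\<omega>}" for t
    using that by auto
  obtain L where "L > 0" and L: "\<And>p t z w. bounded_coeffs n \<omega> M p \<Longrightarrow> t \<in> {0..\<omega>} \<Longrightarrow>
      norm z \<le> R \<Longrightarrow> norm w \<le> R \<Longrightarrow> norm (rhs n p t z - rhs n p t w) \<le> L * norm (z - w)"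
    by (rule rhs_lipschitz_on_ball[OF \<open>M \<ge> 0\<close>, of n \<omega> R]) blast
  have cnj: "cnj (rhs n p t z) = rhs n p t (cnj z)" for t z
    by (simp add: rhs_def)
  have "\<phi> t - cnj (\<phi> t) = 0"
  proof (rule zero_of_linear_growth_bound[OF \<open>L > 0\<close>])
    show "((\<lambda>t. \<phi> t - cnj (\<phi> t)) has_vector_derivative rhs n p t (\<phi> t) - cnj (rhs n p t (\<phi> t))) (at t within {0..\<omega>})"
      if "t \<in> {0..\<omega>}" for t
      using sol that by (auto simp: is_sol_def intro!: has_vector_derivative_diff has_vector_derivative_cnj)
    show "norm (rhs n p t (\<phi> t) - cnj (rhs n p t (\<phi> t))) \<le> L * norm (\<phi> t - cnj (\<phi> t))" if "t \<in> {0..\<omega>}" for t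
      unfolding cnj using R[OF that] that by (intro L[OF M(1)]) auto
    show "\<phi> s - cnj (\<phi> s) = 0"
      using s by (simp add: complex_eq_iff)
  qed (use s t in auto)
  then show ?thesis
    by (simp add: complex_eq_iff)
qed

lemma is_sol_cnj:
  assumes "is_sol n p \<omega> c \<phi>"
  shows "is_sol n p \<omega> (cnj c) (\<lambda>t. cnj (\<phi> t))"
proof -
  have "cnj (rhs n p t z) = rhs n p t (cnj z)" for t z
    by (simp add: rhs_def)
  then show ?thesis
    using assms has_vector_derivative_cnj by (fastforce simp: is_sol_def)
qed

text \<open>A periodic solution that leaves the disc of radius \<open>r\<close> once stays outside
  its interior, so it omits \<open>0\<close>. Being real of one sign or confined to a half plane, it
  has a logarithm with periodic imaginary part, and the sector bounds apply; conjugation disposes of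
  the lower half plane.\<close>

theorem periodic_sol_bounded:
  fixes \<omega> M r :: real
  assumes n: "n \<ge> 5" and "\<omega> > 0" "M \<ge> 0" "r > 0"
  obtains R where "R > 0" "\<And>p \<sigma> c \<phi> t. sector_conditions n r \<sigma> \<omega> p \<Longrightarrow> bounded_coeffs n \<omega> M p \<Longrightarrow>
    is_sol n p \<omega> c \<phi> \<Longrightarrow> \<phi> \<omega> = c \<Longrightarrow> t \<in> {0..\<omega>} \<Longrightarrow> norm (\<phi> t) \<le> R"
proof -
  obtain B where B: "\<And>p l \<theta> k t. polar_sol n p \<omega> l \<theta> \<Longrightarrow> bounded_coeffs n \<omega> M p \<Longrightarrow>
    (\<forall>t\<in>{0..\<omega>}. \<theta> t = 0) \<or> (\<forall>t\<in>{0..\<omega>}. \<theta> t = pi) \<or> (\<forall>t\<in>{0..\<omega>}. 0 < \<theta> t \<and> \<theta> t < pi) \<Longrightarrow>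
    k + 2 < n \<Longrightarrow> (\<And>t. t \<in> {0..\<omega>} \<Longrightarrow> real k * pi / (real n - 2) \<le> \<theta> t) \<Longrightarrow>
    (\<And>t. t \<in> {0..\<omega>} \<Longrightarrow> \<theta> t \<le> real (k + 1) * pi / (real n - 2)) \<Longrightarrow>
    (\<And>t. t \<in> {0..\<omega>} \<Longrightarrow> l t \<ge> ln r) \<Longrightarrow> t \<in> {0..\<omega>} \<Longrightarrow> l t \<le> B"
    by (rule polar_sol_in_sector_bounded[OF assms(1-3), of "ln r"]) blast
  show thesis
  proof (rule that[of "max r (exp B)"])
    fix p \<sigma> c \<phi> t0
    assume cond: "sector_conditions n r \<sigma> \<omega> p" and M: "bounded_coeffs n \<omega> M p"
      and sol: "is_sol n p \<omega> c \<phi>" "\<phi> \<omega> = c" and t0: "t0 \<in> {0..\<omega>}"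
    show "norm (\<phi> t0) \<le> max r (exp B)"
    proof (cases "norm (\<phi> t0) \<le> r")
      case False
      have outside: "norm (\<phi> t) \<ge> r" if "t \<in> {0..\<omega>}" for t
        using periodic_sol_outside_disc[OF _ \<open>\<omega> > 0\<close> \<open>r > 0\<close> cond sol t0 _ that] n False by auto
      have nonzero: "\<phi> t \<noteq> 0" if "t \<in> {0..\<omega>}" for t
        using outside[OF that] \<open>r > 0\<close> by auto
      have nz: "\<psi> t \<noteq> 0" if "norm (\<psi> t) = norm (\<phi> t)" "t \<in> {0..\<omega>}" for t and \<psi> :: "real \<Rightarrow> complex"
        using outside[OF that(2)] that(1) \<open>r > 0\<close> by auto
      \<comment> \<open>Stated for any solution \<open>\<psi>\<close> of the same modulus, to cover
        both \<open>\<phi>\<close> and its conjugate.\<close>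
      have bound: "norm (\<phi> t0) \<le> exp B"
        if sol': "is_sol n p \<omega> c' \<psi>" "\<psi> \<omega> = c'" and norm: "\<And>t. norm (\<psi> t) = norm (\<phi> t)"
        and L: "\<And>t. t \<in> {0..\<omega>} \<Longrightarrow> exp (L t) = \<psi> t" "L \<omega> = L 0"
        and L': "\<And>t. t \<in> {0..\<omega>} \<Longrightarrow> (L has_vector_derivative rhs n p t (\<psi> t) / \<psi> t) (at t within {0..\<omega>})"
        and cases: "(\<forall>t\<in>{0..\<omega>}. Im (L t) = 0) \<or> (\<forall>t\<in>{0..\<omega>}. Im (L t) = pi) \<or> (\<forall>t\<in>{0..\<omega>}. 0 < Im (L t) \<and> Im (L t) < pi)"
        for c' \<psi> L
      proof -
        have polar: "polar_sol n p \<omega> (\<lambda>t. Re (L t)) (\<lambda>t. Im (L t))"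
          by (rule polar_sol_of_logarithm[OF sol' L L'])
        have normL: "exp (Re (L t)) = norm (\<phi> t)" if "t \<in> {0..\<omega>}" for t
          using L(1)[OF that] norm[of t] by (metis norm_exp_eq_Re)
        have l: "ln r \<le> Re (L t)" if "t \<in> {0..\<omega>}" for t
          using outside[OF that] \<open>r > 0\<close> unfolding normL[OF that, symmetric]
          by (metis ln_exp ln_le_cancel_iff exp_gt_zero)
        have "\<And>t. t \<in> {0..\<omega>} \<Longrightarrow> 0 \<le> Im (L t) \<and> Im (L t) \<le> pi"
          using cases by fastforce
        from periodic_polar_sol_in_sector[OF n \<open>\<omega> > 0\<close> \<open>r > 0\<close> cond polar l this]
        obtain k where k: "k + 2 < n" "\<And>t. t \<in> {0..\<omega>} \<Longrightarrow> real k * pi / (real n - 2) \<le> Im (L t)"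
          "\<And>t. t \<in> {0..\<omega>} \<Longrightarrow> Im (L t) \<le> real (k + 1) * pi / (real n - 2)"
          by metis
        have "Re (L t0) \<le> B"
          by (rule B[OF polar M cases k l t0])
        then show ?thesis
          using normL[OF t0] by (metis exp_le_cancel_iff)
      qed
      have d: "(\<psi> has_vector_derivative rhs n p t (\<psi> t)) (at t within {0..\<omega>})"
        if "is_sol n p \<omega> c' \<psi>" "t \<in> {0..\<omega>}" for c' \<psi> t
        using that by (simp add: is_sol_def)
      have per: "\<phi> \<omega> = \<phi> 0"
        using sol by (simp add: is_sol_def)
      have cont: "continuous_on {0..\<omega>} \<phi>"
        by (rule is_sol_continuous[OF sol(1)])
      have upper: "norm (\<phi> t0) \<le> exp B"
        if sol': "is_sol n p \<omega> c' \<psi>" "\<psi> \<omega> = c'" and norm: "\<And>t. norm (\<psi> t) = norm (\<phi> t)"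
        and Im: "\<And>t. t \<in> {0..\<omega>} \<Longrightarrow> Im (\<psi> t) > 0" for c' \<psi>
      proof (rule bound[OF sol' norm, of "\<lambda>t. Ln (\<psi> t)"])
        show "exp (Ln (\<psi> t)) = \<psi> t" if "t \<in> {0..\<omega>}" for t
          using nz[of \<psi> t] norm that by simp
        show "((\<lambda>t. Ln (\<psi> t)) has_vector_derivative rhs n p t (\<psi> t) / \<psi> t) (at t within {0..\<omega>})"
          if "t \<in> {0..\<omega>}" for t
          using Im[OF that] by (intro logarithm_has_vector_derivative d[OF sol'(1) that]) (auto simp: complex_nonpos_Reals_iff)
        show "Ln (\<psi> \<omega>) = Ln (\<psi> 0)"
          using sol' by (simp add: is_sol_def)
        show "(\<forall>t\<in>{0..\<omega>}. Im (Ln (\<psi> t)) = 0) \<or> (\<forall>t\<in>{0..\<omega>}. Im (Ln (\<psi> t)) = pi) \<or>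
            (\<forall>t\<in>{0..\<omega>}. 0 < Im (Ln (\<psi> t)) \<and> Im (Ln (\<psi> t)) < pi)"
          using Im nz[of \<psi>] norm by (auto simp: Im_Ln_pos_lt_imp)
      qed
      have const_sign: "(\<forall>t\<in>{0..\<omega>}. f (\<phi> t) > 0) \<or> (\<forall>t\<in>{0..\<omega>}. f (\<phi> t) < 0)"
        if f: "continuous_on UNIV f" and "\<And>t. t \<in> {0..\<omega>} \<Longrightarrow> f (\<phi> t) \<noteq> 0" for f :: "complex \<Rightarrow> real"
      proof (rule ccontr)
        assume "\<not> ?thesis"
        then obtain a b where ab: "a \<in> {0..\<omega>}" "b \<in> {0..\<omega>}" "f (\<phi> a) \<le> 0" "f (\<phi> b) \<ge> 0"
          by (auto simp: not_less)
        have c: "connected ((\<lambda>t. f (\<phi> t)) ` {0..\<omega>})"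
          by (intro connected_continuous_image continuous_on_compose2[OF f cont]) auto
        have "0 \<in> (\<lambda>t. f (\<phi> t)) ` {0..\<omega>}"
          by (rule connectedD_interval[OF c, of "f (\<phi> a)" "f (\<phi> b)"]) (use ab in auto)
        then show False
          using that(2) by auto
      qed
      have "norm (\<phi> t0) \<le> exp B"
      proof (cases "\<exists>s\<in>{0..\<omega>}. Im (\<phi> s) = 0")
        case True
        then have real: "Im (\<phi> t) = 0" if "t \<in> {0..\<omega>}" for t
          using is_sol_real[OF M \<open>M \<ge> 0\<close> sol(1) _ _ that] by blast
        have "Re (\<phi> t) \<noteq> 0" if "t \<in> {0..\<omega>}" for t
          using real[OF that] nonzero[OF that] by (simp add: complex_eq_iff)
        then have "(\<forall>t\<in>{0..\<omega>}. Re (\<phi> t) > 0) \<or> (\<forall>t\<in>{0..\<omega>}. Re (\<phi> t) < 0)"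
          by (intro const_sign) (auto intro: continuous_intros)
        then consider "\<forall>t\<in>{0..\<omega>}. Re (\<phi> t) > 0" | "\<forall>t\<in>{0..\<omega>}. Re (\<phi> t) < 0"
          by blast
        then show ?thesis
        proof cases
          case 1
          show ?thesis
          proof (rule bound[OF sol refl, of "\<lambda>t. Ln (\<phi> t)"])
            show "exp (Ln (\<phi> t)) = \<phi> t" if "t \<in> {0..\<omega>}" for t
              using nonzero[OF that] by simp
            show "((\<lambda>t. Ln (\<phi> t)) has_vector_derivative rhs n p t (\<phi> t) / \<phi> t) (at t within {0..\<omega>})"
              if "t \<in> {0..\<omega>}" for t
              using bspec[OF 1 that] by (intro logarithm_has_vector_derivative d[OF sol(1) that]) (auto simp: complex_nonpos_Reals_iff)
            have "Im (Ln (\<phi> t)) = 0" if "t \<in> {0..\<omega>}" for t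
              using bspec[OF 1 that] real[OF that] nonzero[OF that] by (simp add: Im_Ln_eq_0)
            then show "(\<forall>t\<in>{0..\<omega>}. Im (Ln (\<phi> t)) = 0) \<or> (\<forall>t\<in>{0..\<omega>}. Im (Ln (\<phi> t)) = pi) \<or>
              (\<forall>t\<in>{0..\<omega>}. 0 < Im (Ln (\<phi> t)) \<and> Im (Ln (\<phi> t)) < pi)"
              by blast
          qed (simp add: per)
        next
          case 2
          show ?thesis
          \<comment> \<open>The principal logarithm has its cut on the negative axis; the branch
            with imaginary part \<open>pi\<close> is used instead.\<close>
          proof (rule bound[OF sol refl, of "\<lambda>t. Ln (- \<phi> t) + \<i> * pi"])
            show "exp (Ln (- \<phi> t) + \<i> * pi) = \<phi> t" if "t \<in> {0..\<omega>}" for t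
              using nonzero[OF that] by (simp add: exp_add)
            show "((\<lambda>t. Ln (- \<phi> t) + \<i> * pi) has_vector_derivative rhs n p t (\<phi> t) / \<phi> t) (at t within {0..\<omega>})"
              if "t \<in> {0..\<omega>}" for t
              using bspec[OF 2 that] logarithm_has_vector_derivative[OF has_vector_derivative_minus[OF d[OF sol(1) that]]]
              by (auto simp: complex_nonpos_Reals_iff intro!: derivative_eq_intros)
            have "Im (Ln (- \<phi> t)) = 0" if "t \<in> {0..\<omega>}" for t
              using bspec[OF 2 that] real[OF that] nonzero[OF that] by (simp add: Im_Ln_eq_0)
            then show "(\<forall>t\<in>{0..\<omega>}. Im (Ln (- \<phi> t) + \<i> * pi) = 0) \<or> (\<forall>t\<in>{0..\<omega>}. Im (Ln (- \<phi> t) + \<i> * pi) = pi) \<or>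
              (\<forall>t\<in>{0..\<omega>}. 0 < Im (Ln (- \<phi> t) + \<i> * pi) \<and> Im (Ln (- \<phi> t) + \<i> * pi) < pi)"
              by simp
          qed (simp add: per)
        qed
      next
        case False
        then have "(\<forall>t\<in>{0..\<omega>}. Im (\<phi> t) > 0) \<or> (\<forall>t\<in>{0..\<omega>}. Im (\<phi> t) < 0)"
          by (intro const_sign) (auto intro: continuous_intros)
        then show ?thesis
          using upper[OF sol refl] upper[OF is_sol_cnj[OF sol(1)]] sol(2) by auto
      qed
      then show ?thesis
        by simp
    qed simp
  qed (use \<open>r > 0\<close> in \<open>simp add: less_max_iff_disj\<close>)
qed

section \<open>Holomorphic dependence on the initial value\<close>

lemma has_field_derivative_of_quadratic_remainder:
  fixes f :: "'a::real_normed_field \<Rightarrow> 'a"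
  assumes "\<delta> > 0" and rem: "\<And>h. norm h < \<delta> \<Longrightarrow> norm (f (c + h) - f c - E * h) \<le> K * (norm h)\<^sup>2"
  shows "(f has_field_derivative E) (at c)"
proof -
  have "((\<lambda>h. (f (c + h) - f c) / h - E) \<longlongrightarrow> 0) (at 0)"
  proof (rule Lim_null_comparison)
    show "eventually (\<lambda>h. norm ((f (c + h) - f c) / h - E) \<le> K * norm h) (at 0)"
      unfolding eventually_at
    proof (intro exI[of _ \<delta>] conjI ballI impI)
      fix h :: 'a assume h: "h \<noteq> 0 \<and> dist h 0 < \<delta>"
      have "(f (c + h) - f c) / h - E = (f (c + h) - f c - E * h) / h"
        using h by (simp add: diff_divide_distrib)
      also have "norm \<dots> \<le> K * (norm h)\<^sup>2 / norm h"
        unfolding norm_divide using h by (intro divide_right_mono rem) auto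
      also have "\<dots> = K * norm h"
        using h by (simp add: power2_eq_square)
      finally show "norm ((f (c + h) - f c) / h - E) \<le> K * norm h" .
    qed (fact \<open>\<delta> > 0\<close>)
    show "((\<lambda>h. K * norm h) \<longlongrightarrow> 0) (at (0::'a))"
      by (auto intro!: tendsto_eq_intros)
  qed
  then show ?thesis
    by (simp add: DERIV_def LIM_zero_iff)
qed

text \<open>
  The truncated equation has global solutions; those that stay in the ball of radius \<open>R\<close> are
  solutions of the original equation.
\<close>

locale coefficient_family =
  fixes n :: nat and \<omega> M D R :: real and p :: "real \<Rightarrow> nat \<Rightarrow> real \<Rightarrow> real"
  assumes \<omega>_pos: "\<omega> > 0" and M_nonneg: "M \<ge> 0" and R_pos: "R > 0"
    and coeffs: "s \<in> {0..1} \<Longrightarrow> bounded_coeffs n \<omega> M (p s)"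
    and cont_coeffs: "s \<in> {0..1} \<Longrightarrow> i < n \<Longrightarrow> continuous_on {0..\<omega>} (p s i)"
    and lip_coeffs: "s \<in> {0..1} \<Longrightarrow> s' \<in> {0..1} \<Longrightarrow> i < n \<Longrightarrow> t \<in> {0..\<omega>} \<Longrightarrow>
      \<bar>p s i t - p s' i t\<bar> \<le> D * \<bar>s - s'\<bar>"
begin

text \<open>The nearest-point map is \<open>1\<close>-Lipschitz and the identity on the ball, so
  composing with it makes the polynomial field globally Lipschitz. It is not holomorphic outside,
  which is why holomorphy is claimed only where the truncation is inactive.\<close>

definition trunc :: "complex \<Rightarrow> complex" where
  "trunc = closest_point (cball 0 R)"

definition trunc_sol :: "real \<Rightarrow> complex \<Rightarrow> (real \<Rightarrow> complex) \<Rightarrow> bool" where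
  "trunc_sol s c \<phi> \<longleftrightarrow> \<phi> 0 = c \<and>
     (\<forall>t\<in>{0..\<omega>}. (\<phi> has_vector_derivative rhs n (p s) t (trunc (\<phi> t))) (at t within {0..\<omega>}))"

definition flow :: "real \<Rightarrow> complex \<Rightarrow> real \<Rightarrow> complex" where
  "flow s c = (SOME \<phi>. trunc_sol s c \<phi>)"

text \<open>This replaces the domain of the displacement function: below \<open>R\<close> the
  truncated trajectory solves the original equation, and the dependence on \<open>s\<close> and
  \<open>c\<close> is Lipschitz, so the sublevel sets are open.\<close>

definition amplitude :: "real \<Rightarrow> complex \<Rightarrow> real" where
  "amplitude s c = (SUP t\<in>{0..\<omega>}. norm (flow s c t))"

definition displacement :: "real \<Rightarrow> complex \<Rightarrow> complex" where
  "displacement s c = flow s c \<omega> - c"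

lemma trunc_norm: "norm (trunc z) \<le> R"
  using closest_point_in_set[of "cball 0 R" z] R_pos by (simp add: trunc_def)

lemma trunc_id: "norm z \<le> R \<Longrightarrow> trunc z = z"
  by (simp add: trunc_def closest_point_self)

lemma trunc_lipschitz: "norm (trunc z - trunc w) \<le> norm (z - w)"
  using closest_point_lipschitz[of "cball 0 R" z w] R_pos by (simp add: trunc_def dist_norm)

lemma trunc_rhs_lipschitz:
  obtains L where "L > 0" "\<And>s t z w. s \<in> {0..1} \<Longrightarrow> t \<in> {0..\<omega>} \<Longrightarrow>
    norm (rhs n (p s) t (trunc z) - rhs n (p s) t (trunc w)) \<le> L * norm (z - w)"
proof (rule rhs_lipschitz_on_ball[OF M_nonneg, of n \<omega> R])
  fix L :: real
  assume L: "L > 0" "\<And>p t z w. bounded_coeffs n \<omega> M p \<Longrightarrow> t \<in> {0..\<omega>} \<Longrightarrow> norm z \<le> R \<Longrightarrow> norm w \<le> R \<Longrightarrow>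
       norm (rhs n p t z - rhs n p t w) \<le> L * norm (z - w)"
  show thesis
  proof (rule that[OF L(1)])
    fix s t z w assume "s \<in> {0..1::real}" "t \<in> {0..\<omega>}"
    then have "norm (rhs n (p s) t (trunc z) - rhs n (p s) t (trunc w)) \<le> L * norm (trunc z - trunc w)"
      by (intro L(2) coeffs trunc_norm)
    also have "\<dots> \<le> L * norm (z - w)"
      using L(1) trunc_lipschitz by (intro mult_left_mono) auto
    finally show "norm (rhs n (p s) t (trunc z) - rhs n (p s) t (trunc w)) \<le> L * norm (z - w)" .
  qed
qed

lemma flow: assumes s: "s \<in> {0..1}" shows "trunc_sol s c (flow s c)"
proof -
  obtain L where L: "L > 0" "\<And>s t z w. s \<in> {0..1} \<Longrightarrow> t \<in> {0..\<omega>} \<Longrightarrow>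
    norm (rhs n (p s) t (trunc z) - rhs n (p s) t (trunc w)) \<le> L * norm (z - w)"
    by (rule trunc_rhs_lipschitz) blast
  have trunc: "continuous_on S (\<lambda>x. trunc (snd x))" for S :: "(real \<times> complex) set"
    unfolding trunc_def using R_pos
    by (intro continuous_on_compose2[OF continuous_on_closest_point[of "cball 0 R"]] continuous_intros) auto
  have coeff: "continuous_on ({0..\<omega>} \<times> UNIV) (\<lambda>x::real \<times> complex. p s i (fst x))" if "i < n" for i
    by (rule continuous_on_compose2[OF cont_coeffs[OF s that]]) (auto intro: continuous_intros)
  have "continuous_on ({0..\<omega>} \<times> UNIV) (\<lambda>x. rhs n (p s) (fst x) (trunc (snd x)))"
    unfolding rhs_def by (intro continuous_intros trunc coeff) auto
  then have "\<exists>\<phi>. trunc_sol s c \<phi>"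
    unfolding trunc_sol_def using \<omega>_pos L s
    by (intro lipschitz_ivp_solution_exists[of _ L]) (auto simp: case_prod_unfold)
  then show ?thesis
    unfolding flow_def by (rule someI_ex)
qed

text \<open>Gronwall with the change of the coefficients, at most
  \<open>G * \<bar>s - s'\<bar>\<close>, as inhomogeneity.\<close>

lemma trunc_sol_estimate:
  obtains C where "C > 0" "\<And>s s' c c' \<phi> \<psi> t. s \<in> {0..1} \<Longrightarrow> s' \<in> {0..1} \<Longrightarrow> trunc_sol s c \<phi> \<Longrightarrow>
    trunc_sol s' c' \<psi> \<Longrightarrow> t \<in> {0..\<omega>} \<Longrightarrow> norm (\<phi> t - \<psi> t) \<le> C * (\<bar>s - s'\<bar> + norm (c - c'))"
proof -
  obtain L where L: "L > 0" "\<And>s t z w. s \<in> {0..1} \<Longrightarrow> t \<in> {0..\<omega>} \<Longrightarrow>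
    norm (rhs n (p s) t (trunc z) - rhs n (p s) t (trunc w)) \<le> L * norm (z - w)"
    by (rule trunc_rhs_lipschitz) blast
  define G where "G = \<bar>D\<bar> * (\<Sum>i<n. R ^ i)"
  define E where "E = exp (2 * L * \<omega>)"
  define C where "C = 2 * (1 + G * \<omega>) * E"
  have G: "G \<ge> 0"
    using R_pos by (auto simp: G_def intro!: mult_nonneg_nonneg sum_nonneg)
  show thesis
  proof (rule that[of C])
    show "C > 0"
      using G \<omega>_pos by (simp add: C_def E_def add_pos_nonneg)
    fix s s' c c' \<phi> \<psi> t
    assume s: "s \<in> {0..1}" "s' \<in> {0..1}" and sol: "trunc_sol s c \<phi>" "trunc_sol s' c' \<psi>" and t: "t \<in> {0..\<omega>}"
    have "norm (\<phi> t - \<psi> t) \<le> 2 * (norm (\<phi> 0 - \<psi> 0) + (G * \<bar>s - s'\<bar>) * \<omega>) * exp (2 * L * t)"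
    proof (rule gronwall_bound[OF L(1)])
      show "((\<lambda>t. \<phi> t - \<psi> t) has_vector_derivative rhs n (p s) t (trunc (\<phi> t)) - rhs n (p s') t (trunc (\<psi> t)))
        (at t within {0..\<omega>})" if "t \<in> {0..\<omega>}" for t
        using sol that by (auto simp: trunc_sol_def intro!: has_vector_derivative_diff)
      show "norm (rhs n (p s) t (trunc (\<phi> t)) - rhs n (p s') t (trunc (\<psi> t))) \<le> L * norm (\<phi> t - \<psi> t) + G * \<bar>s - s'\<bar>"
        if "t \<in> {0..\<omega>}" for t
      proof -
        have "norm (rhs n (p s) t (trunc (\<psi> t)) - rhs n (p s') t (trunc (\<psi> t))) \<le> (\<bar>D\<bar> * \<bar>s - s'\<bar>) * (\<Sum>i<n. R ^ i)"
        proof (rule rhs_coeff_perturbation[OF _ trunc_norm])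
          fix i assume "i < n"
          have "\<bar>p s i t - p s' i t\<bar> \<le> D * \<bar>s - s'\<bar>"
            using lip_coeffs[OF s \<open>i < n\<close> that] .
          also have "\<dots> \<le> \<bar>D\<bar> * \<bar>s - s'\<bar>"
            by (intro mult_right_mono) auto
          finally show "\<bar>p s i t - p s' i t\<bar> \<le> \<bar>D\<bar> * \<bar>s - s'\<bar>" .
        qed
        then show ?thesis
          using L(2)[OF s(1) that, of "\<phi> t" "\<psi> t"]
            norm_triangle_ineq[of "rhs n (p s) t (trunc (\<phi> t)) - rhs n (p s) t (trunc (\<psi> t))"
              "rhs n (p s) t (trunc (\<psi> t)) - rhs n (p s') t (trunc (\<psi> t))"]
          by (simp add: G_def mult_ac)
      qed
    qed (use G t in auto)
    also have "\<dots> \<le> 2 * (norm (\<phi> 0 - \<psi> 0) + (G * \<bar>s - s'\<bar>) * \<omega>) * E"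
      using G t L(1) \<omega>_pos unfolding E_def by (intro mult_left_mono) auto
    also have "\<dots> \<le> 2 * ((1 + G * \<omega>) * (\<bar>s - s'\<bar> + norm (c - c'))) * E"
      using G \<omega>_pos sol by (intro mult_right_mono mult_left_mono) (auto simp: trunc_sol_def E_def algebra_simps)
    finally show "norm (\<phi> t - \<psi> t) \<le> C * (\<bar>s - s'\<bar> + norm (c - c'))"
      by (simp add: C_def algebra_simps)
  qed
qed

lemma trunc_sol_continuous:
  assumes "trunc_sol s c \<phi>"
  shows "continuous_on {0..\<omega>} \<phi>"
  by (rule continuous_on_vector_derivative) (use assms in \<open>auto simp: trunc_sol_def\<close>)

lemma trunc_sol_iff_is_sol:
  assumes "\<And>t. t \<in> {0..\<omega>} \<Longrightarrow> norm (\<phi> t) \<le> R"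
  shows "trunc_sol s c \<phi> \<longleftrightarrow> is_sol n (p s) \<omega> c \<phi>"
  using assms by (simp add: trunc_sol_def is_sol_def trunc_id)

lemma trunc_sol_unique:
  assumes "s \<in> {0..1}" "trunc_sol s c \<phi>" "trunc_sol s c \<psi>" "t \<in> {0..\<omega>}"
  shows "\<phi> t = \<psi> t"
proof (rule trunc_sol_estimate)
  fix C :: real
  assume C: "\<And>s s' c c' \<phi> \<psi> t. s \<in> {0..1} \<Longrightarrow> s' \<in> {0..1} \<Longrightarrow> trunc_sol s c \<phi> \<Longrightarrow>
    trunc_sol s' c' \<psi> \<Longrightarrow> t \<in> {0..\<omega>} \<Longrightarrow> norm (\<phi> t - \<psi> t) \<le> C * (\<bar>s - s'\<bar> + norm (c - c'))"
  show ?thesis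
    using C[OF assms(1) assms(1) assms(2-4)] by simp
qed

lemma norm_flow_le_amplitude:
  assumes "s \<in> {0..1}" "t \<in> {0..\<omega>}"
  shows "norm (flow s c t) \<le> amplitude s c"
proof -
  have "bounded (flow s c ` {0..\<omega>})"
    using trunc_sol_continuous[OF flow[OF assms(1)]] by (intro compact_imp_bounded compact_continuous_image) auto
  then obtain b where "\<forall>z\<in>flow s c ` {0..\<omega>}. norm z \<le> b"
    unfolding bounded_iff ..
  then have "bdd_above ((\<lambda>t. norm (flow s c t)) ` {0..\<omega>})"
    by (intro bdd_aboveI2[of _ _ b]) auto
  then show ?thesis
    unfolding amplitude_def using assms by (intro cSUP_upper)
qed

lemma amplitude_le:
  assumes "\<And>t. t \<in> {0..\<omega>} \<Longrightarrow> norm (flow s c t) \<le> b"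
  shows "amplitude s c \<le> b"
  unfolding amplitude_def using assms \<omega>_pos by (intro cSUP_least) auto

lemma norm_le_amplitude: "s \<in> {0..1} \<Longrightarrow> norm c \<le> amplitude s c"
  using norm_flow_le_amplitude[of s 0 c] flow[of s c] \<omega>_pos by (simp add: trunc_sol_def)

lemma amplitude_displacement_estimate:
  obtains C where "C > 0"
    "\<And>s s' c c'. s \<in> {0..1} \<Longrightarrow> s' \<in> {0..1} \<Longrightarrow> \<bar>amplitude s c - amplitude s' c'\<bar> \<le> C * (\<bar>s - s'\<bar> + norm (c - c'))"
    "\<And>s s' c c'. s \<in> {0..1} \<Longrightarrow> s' \<in> {0..1} \<Longrightarrow>
      norm (displacement s c - displacement s' c') \<le> C * (\<bar>s - s'\<bar> + norm (c - c'))"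
proof (rule trunc_sol_estimate)
  fix C :: real
  assume C: "C > 0" "\<And>s s' c c' \<phi> \<psi> t. s \<in> {0..1} \<Longrightarrow> s' \<in> {0..1} \<Longrightarrow> trunc_sol s c \<phi> \<Longrightarrow>
    trunc_sol s' c' \<psi> \<Longrightarrow> t \<in> {0..\<omega>} \<Longrightarrow> norm (\<phi> t - \<psi> t) \<le> C * (\<bar>s - s'\<bar> + norm (c - c'))"
  note est = C(2)[OF _ _ flow flow]
  have one: "amplitude s c \<le> amplitude s' c' + C * (\<bar>s - s'\<bar> + norm (c - c'))"
    if "s \<in> {0..1}" "s' \<in> {0..1}" for s s' c c'
  proof (rule amplitude_le)
    fix t assume t: "t \<in> {0..\<omega>}"
    show "norm (flow s c t) \<le> amplitude s' c' + C * (\<bar>s - s'\<bar> + norm (c - c'))"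
      using est[OF that that t, of c c'] norm_flow_le_amplitude[OF that(2) t, of c']
        norm_triangle_ineq2[of "flow s c t" "flow s' c' t"] by linarith
  qed
  show thesis
  proof (rule that[of "C + 1"])
    fix s s' :: real and c c' :: complex assume s: "s \<in> {0..1::real}" "s' \<in> {0..1::real}"
    have le: "C * (\<bar>s - s'\<bar> + norm (c - c')) + norm (c - c') \<le> (C + 1) * (\<bar>s - s'\<bar> + norm (c - c'))"
      by (simp add: algebra_simps)
    have sym: "\<bar>s' - s\<bar> + norm (c' - c) = \<bar>s - s'\<bar> + norm (c - c')"
      by (simp add: norm_minus_commute)
    show "\<bar>amplitude s c - amplitude s' c'\<bar> \<le> (C + 1) * (\<bar>s - s'\<bar> + norm (c - c'))"
      using one[OF s, of c c'] one[OF s(2,1), of c' c, unfolded sym] le norm_ge_zero[of "c - c'"] by linarith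
    show "norm (displacement s c - displacement s' c') \<le> (C + 1) * (\<bar>s - s'\<bar> + norm (c - c'))"
      using est[OF s s, of \<omega> c c'] le \<omega>_pos
        norm_triangle_ineq4[of "flow s c \<omega> - flow s' c' \<omega>" "c - c'"]
      by (simp add: displacement_def algebra_simps)
  qed (use C in simp)
qed

text \<open>The variational equation along the trajectory is scalar and linear, so its solution is
  the exponential of an integral. Gronwall bounds the deviation from it by a multiple of
  \<open>(norm h)\<^sup>2\<close>. The explicit value later decides the multiplicities at the
  Bernoulli end.\<close>

lemma displacement_has_field_derivative:
  assumes s: "s \<in> {0..1}" and c: "amplitude s c < R"
  shows "(displacement s has_field_derivative
           exp (integral {0..\<omega>} (\<lambda>t. drhs n (p s) t (flow s c t))) - 1) (at c)"
proof (rule rhs_taylor_on_ball[OF M_nonneg, of n \<omega> R], rule amplitude_displacement_estimate, rule trunc_sol_estimate)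
  fix A B C :: real
  assume A: "A > 0"
    "\<And>p t z w. bounded_coeffs n \<omega> M p \<Longrightarrow> t \<in> {0..\<omega>} \<Longrightarrow> norm z \<le> R \<Longrightarrow> norm w \<le> R \<Longrightarrow>
       norm (rhs n p t z - rhs n p t w - drhs n p t w * (z - w)) \<le> A * (norm (z - w))\<^sup>2"
    "\<And>p t w. bounded_coeffs n \<omega> M p \<Longrightarrow> t \<in> {0..\<omega>} \<Longrightarrow> norm w \<le> R \<Longrightarrow> norm (drhs n p t w) \<le> A"
  assume B: "B > 0" "\<And>s s' c c'. s \<in> {0..1} \<Longrightarrow> s' \<in> {0..1} \<Longrightarrow> \<bar>amplitude s c - amplitude s' c'\<bar> \<le> B * (\<bar>s - s'\<bar> + norm (c - c'))"
  assume C: "C > 0" "\<And>s s' c c' \<phi> \<psi> t. s \<in> {0..1} \<Longrightarrow> s' \<in> {0..1} \<Longrightarrow> trunc_sol s c \<phi> \<Longrightarrow>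
    trunc_sol s' c' \<psi> \<Longrightarrow> t \<in> {0..\<omega>} \<Longrightarrow> norm (\<phi> t - \<psi> t) \<le> C * (\<bar>s - s'\<bar> + norm (c - c'))"
  define a where "a t = drhs n (p s) t (flow s c t)" for t
  have "continuous_on {0..\<omega>} a"
    unfolding a_def [abs_def] drhs_def
    by (intro continuous_intros trunc_sol_continuous[OF flow[OF s]] cont_coeffs[OF s]) auto
  then have I: "((\<lambda>t. integral {0..t} a) has_vector_derivative a t) (at t within {0..\<omega>})" if "t \<in> {0..\<omega>}" for t
    using that by (rule integral_has_vector_derivative)
  define E where "E t = exp (integral {0..t} a)" for t
  have E: "(E has_vector_derivative a t * E t) (at t within {0..\<omega>})" if "t \<in> {0..\<omega>}" for t
  proof -
    have "(exp has_field_derivative E t) (at (integral {0..t} a) within (\<lambda>t. integral {0..t} a) ` {0..\<omega>})"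
      unfolding E_def by (auto intro!: derivative_eq_intros)
    from field_vector_diff_chain_within[OF I[OF that] this] show ?thesis
      by (simp add: E_def [abs_def] o_def)
  qed
  \<comment> \<open>\<open>B\<close> is a Lipschitz constant of the amplitude, so the truncation
    stays inactive for \<open>norm h < \<delta>\<close>.\<close>
  define \<delta> where "\<delta> = (R - amplitude s c) / B"
  have ball: "norm (flow s (c + h) t) \<le> R" if "norm h < \<delta>" "t \<in> {0..\<omega>}" for h t
  proof -
    have "B * norm h < R - amplitude s c"
      using that B(1) by (simp add: \<delta>_def field_simps)
    then show ?thesis
      using B(2)[OF s s, of "c + h" c] norm_flow_le_amplitude[OF s that(2), of "c + h"] by simp
  qed
  have deriv: "(flow s (c + h) has_vector_derivative rhs n (p s) t (flow s (c + h) t)) (at t within {0..\<omega>})"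
    if "norm h < \<delta>" "t \<in> {0..\<omega>}" for h t
    using flow[OF s, of "c + h", unfolded trunc_sol_def, THEN conjunct2, rule_format, OF that(2)]
      trunc_id[OF ball[OF that]] by simp
  have "\<delta> > 0"
    using c B(1) by (simp add: \<delta>_def)
  have "(displacement s has_field_derivative E \<omega> - 1) (at c)"
  proof (rule has_field_derivative_of_quadratic_remainder[OF \<open>\<delta> > 0\<close>])
    fix h :: complex assume h: "norm h < \<delta>"
    define y where "y t = flow s (c + h) t - flow s c t - E t * h" for t
    define d where "d t = rhs n (p s) t (flow s (c + h) t) - rhs n (p s) t (flow s c t) - a t * (flow s (c + h) t - flow s c t)" for t
    have "norm (y \<omega>) \<le> 2 * (norm (y 0) + A * (C * norm h)\<^sup>2 * \<omega>) * exp (2 * A * \<omega>)"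
    proof (rule gronwall_bound[OF \<open>A > 0\<close>])
      show "(y has_vector_derivative d t + a t * y t) (at t within {0..\<omega>})" if "t \<in> {0..\<omega>}" for t
      proof -
        have "(y has_vector_derivative rhs n (p s) t (flow s (c + h) t) - rhs n (p s) t (flow s c t) - a t * E t * h) (at t within {0..\<omega>})"
          unfolding y_def [abs_def] using deriv[OF h that] deriv[of 0 t] that \<open>\<delta> > 0\<close>
          by (intro has_vector_derivative_diff has_vector_derivative_mult_left E) auto
        then show ?thesis
          by (simp add: d_def y_def algebra_simps)
      qed
      show "norm (d t + a t * y t) \<le> A * norm (y t) + A * (C * norm h)\<^sup>2" if t: "t \<in> {0..\<omega>}" for t
      proof -
        have ball0: "norm (flow s c t) \<le> R"
          using ball[of 0 t] \<open>\<delta> > 0\<close> t by simp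
        have "norm (d t) \<le> A * (norm (flow s (c + h) t - flow s c t))\<^sup>2"
          unfolding d_def a_def by (intro A coeffs s t ball ball0 h)
        also have "\<dots> \<le> A * (C * norm h)\<^sup>2"
          using C(2)[OF s s flow[OF s] flow[OF s] t, of "c + h" c] A(1)
          by (intro mult_left_mono power_mono) auto
        moreover have "norm (a t * y t) \<le> A * norm (y t)"
          unfolding norm_mult a_def by (intro mult_right_mono A coeffs s t ball0) auto
        ultimately show ?thesis
          by (intro order_trans[OF norm_triangle_ineq]) linarith
      qed
    qed (use A \<omega>_pos in auto)
    moreover have "y 0 = 0"
      using flow[OF s, of c] flow[OF s, of "c + h"] by (simp add: y_def E_def trunc_sol_def)
    moreover have "displacement s (c + h) - displacement s c - (E \<omega> - 1) * h = y \<omega>"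
      by (simp add: displacement_def y_def algebra_simps)
    ultimately show "norm (displacement s (c + h) - displacement s c - (E \<omega> - 1) * h) \<le>
        (2 * A * C\<^sup>2 * \<omega> * exp (2 * A * \<omega>)) * (norm h)\<^sup>2"
      by (simp add: power_mult_distrib mult_ac)
  qed
  then show ?thesis
    by (simp add: E_def a_def [abs_def])
qed

end

section \<open>Invariance of the number of zeros under homotopy\<close>

text \<open>The domains \<open>{c. N s c < \<rho>}\<close> move with \<open>s\<close>. The gap
  between \<open>b\<close> and \<open>\<rho>\<close> prevents zeros from leaving through the
  boundary, and \<open>norm_le\<close> prevents them from escaping to infinity.\<close>

locale zero_family =
  fixes T :: "real \<Rightarrow> complex \<Rightarrow> complex" and N :: "real \<Rightarrow> complex \<Rightarrow> real" and b \<rho> C :: real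
  assumes C_pos: "C > 0" and b_less: "b < \<rho>"
    and T_lip: "s \<in> {0..1} \<Longrightarrow> s' \<in> {0..1} \<Longrightarrow> norm (T s c - T s' c') \<le> C * (\<bar>s - s'\<bar> + norm (c - c'))"
    and N_lip: "s \<in> {0..1} \<Longrightarrow> s' \<in> {0..1} \<Longrightarrow> \<bar>N s c - N s' c'\<bar> \<le> C * (\<bar>s - s'\<bar> + norm (c - c'))"
    and norm_le: "s \<in> {0..1} \<Longrightarrow> norm c \<le> N s c"
    and holo: "s \<in> {0..1} \<Longrightarrow> T s holomorphic_on {c. N s c < \<rho>}"
    and zero_le: "s \<in> {0..1} \<Longrightarrow> T s c = 0 \<Longrightarrow> N s c < \<rho> \<Longrightarrow> N s c \<le> b"
begin

definition zeros :: "real \<Rightarrow> complex set" where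
  "zeros s = {c. N s c < \<rho> \<and> T s c = 0}"

definition count :: "real \<Rightarrow> int" where
  "count s = (\<Sum>c\<in>zeros s. zorder (T s) c)"

lemma continuous_T: assumes "s \<in> {0..1}" shows "continuous_on S (T s)"
proof (rule continuous_on_subset)
  show "continuous_on UNIV (T s)"
    by (rule lipschitz_on_continuous_on[of C], rule lipschitz_onI)
      (use T_lip[OF assms assms] C_pos in \<open>auto simp: dist_norm\<close>)
qed auto

lemma continuous_N: assumes "s \<in> {0..1}" shows "continuous_on S (N s)"
proof (rule continuous_on_subset)
  show "continuous_on UNIV (N s)"
    by (rule lipschitz_on_continuous_on[of C], rule lipschitz_onI)
      (use N_lip[OF assms assms] C_pos in \<open>auto simp: dist_norm\<close>)
qed auto

lemma open_domain: "s \<in> {0..1} \<Longrightarrow> open {c. N s c < \<rho>}"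
  by (intro open_Collect_less continuous_N continuous_intros)

text \<open>The gap replaces the strict inequality by a weak one, which makes the set of zeros
  closed.\<close>

lemma zeros_eq: "s \<in> {0..1} \<Longrightarrow> zeros s = {c. N s c \<le> b} \<inter> {c. T s c = 0}"
  using zero_le b_less by (fastforce simp: zeros_def)

lemma compact_zeros: assumes s: "s \<in> {0..1}" shows "compact (zeros s)"
proof -
  have "closed (zeros s)"
    unfolding zeros_eq[OF s]
    by (intro closed_Int closed_Collect_le closed_Collect_eq continuous_T[OF s] continuous_N[OF s] continuous_intros)
  moreover have "bounded (zeros s)"
    by (intro boundedI[of _ \<rho>] order_trans[OF norm_le[OF s]]) (simp add: zeros_def)
  ultimately show ?thesis
    by (simp add: compact_eq_bounded_closed)
qed

text \<open>The domain need not be connected, so the identity theorem is applied on small balls: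
  every limit point of zeros is interior to the set of zeros. If there were one, that interior would
  be nonempty, open and closed, thus the whole plane, against compactness.\<close>

lemma finite_zeros: assumes s: "s \<in> {0..1}" shows "finite (zeros s)"
proof (rule ccontr)
  assume "infinite (zeros s)"
  then obtain x where x: "x \<in> zeros s" "x islimpt zeros s"
    using compact_zeros[OF s] by (meson compact_eq_Bolzano_Weierstrass order_refl)
  have spread: "y \<in> interior (zeros s)" if y: "y \<in> zeros s" "y islimpt zeros s" for y
  proof -
    obtain e where e: "e > 0" "ball y e \<subseteq> {c. N s c < \<rho>}"
      using y open_domain[OF s] by (auto simp: zeros_def open_contains_ball)
    have limpt: "y islimpt zeros s \<inter> ball y e"
      using y(2) e(1) by (intro islimpt_Int_eventually eventually_at_in_open') auto
    have "T s w = 0" if "w \<in> ball y e" for w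
      by (rule analytic_continuation[OF holomorphic_on_subset[OF holo[OF s] e(2)] _ _ _ _ limpt _ that])
        (use e in \<open>auto simp: zeros_def\<close>)
    then have "ball y e \<subseteq> zeros s"
      using e by (auto simp: zeros_def)
    then show ?thesis
      using e(1) by (auto simp: interior_def)
  qed
  have "closure (interior (zeros s)) \<subseteq> interior (zeros s)"
  proof
    fix y assume y: "y \<in> closure (interior (zeros s))"
    show "y \<in> interior (zeros s)"
    proof (cases "y \<in> interior (zeros s)")
      case False
      then have "y islimpt interior (zeros s)"
        using y by (auto simp: closure_def)
      then have "y islimpt zeros s"
        using interior_subset islimpt_subset by blast
      moreover have "y \<in> zeros s"
        using \<open>y islimpt zeros s\<close> compact_imp_closed[OF compact_zeros[OF s]] by (auto simp: closed_limpt)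
      ultimately show ?thesis
        by (rule spread[rotated])
    qed
  qed
  then have "closed (interior (zeros s))"
    by (metis closure_subset closure_eq subset_antisym)
  then have "interior (zeros s) = {} \<or> interior (zeros s) = UNIV"
    using open_interior by (auto simp: clopen[symmetric])
  then have "zeros s = UNIV"
    using spread[OF x] interior_subset by blast
  then show False
    using compact_imp_bounded[OF compact_zeros[OF s]] by (simp add: not_bounded_UNIV)
qed

lemma separated_zeros:
  assumes s: "s \<in> {0..1}"
  obtains \<epsilon> where "\<epsilon> > 0" "\<And>a. a \<in> zeros s \<Longrightarrow> cball a (2 * \<epsilon>) \<subseteq> {c. N s c < \<rho>}"
    "\<And>a a'. a \<in> zeros s \<Longrightarrow> a' \<in> zeros s \<Longrightarrow> a \<noteq> a' \<Longrightarrow> 4 * \<epsilon> < dist a a'"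
proof -
  have "\<exists>e>0. cball a e \<subseteq> {c. N s c < \<rho>} \<and> (\<forall>x\<in>zeros s. x \<noteq> a \<longrightarrow> e \<le> dist a x)" if "a \<in> zeros s" for a
  proof -
    have "a \<in> {c. N s c < \<rho>}"
      using that by (simp add: zeros_def)
    with open_domain[OF s] obtain e1 where "e1 > 0" "cball a e1 \<subseteq> {c. N s c < \<rho>}"
      by (metis open_contains_cball)
    moreover obtain e2 where "e2 > 0" "\<forall>x\<in>zeros s. x \<noteq> a \<longrightarrow> e2 \<le> dist a x"
      using finite_set_avoid[OF finite_zeros[OF s], of a] by blast
    moreover have "cball a (min e1 e2) \<subseteq> cball a e1"
      by (intro subset_cball) simp
    ultimately show ?thesis
      by (intro exI[of _ "min e1 e2"]) auto
  qed
  then obtain e where e: "\<And>a. a \<in> zeros s \<Longrightarrow> e a > 0" "\<And>a. a \<in> zeros s \<Longrightarrow> cball a (e a) \<subseteq> {c. N s c < \<rho>}"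
    "\<And>a x. a \<in> zeros s \<Longrightarrow> x \<in> zeros s \<Longrightarrow> x \<noteq> a \<Longrightarrow> e a \<le> dist a x"
    by metis
  \<comment> \<open>The inserted \<open>1\<close> covers the case without zeros; dividing by
    \<open>5\<close> makes the separation by \<open>4 * \<epsilon>\<close> strict.\<close>
  define \<epsilon> where "\<epsilon> = Min (insert 1 (e ` zeros s)) / 5"
  have \<epsilon>: "\<epsilon> > 0" "\<And>a. a \<in> zeros s \<Longrightarrow> 5 * \<epsilon> \<le> e a"
    using finite_zeros[OF s] e(1) by (auto simp: \<epsilon>_def)
  show thesis
  proof (rule that[OF \<epsilon>(1)])
    fix a assume a: "a \<in> zeros s"
    have "cball a (2 * \<epsilon>) \<subseteq> cball a (e a)"
      using \<epsilon>(1) \<epsilon>(2)[OF a] by (intro subset_cball) linarith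
    then show "cball a (2 * \<epsilon>) \<subseteq> {c. N s c < \<rho>}"
      using e(2)[OF a] by blast
    fix a' assume "a' \<in> zeros s" "a \<noteq> a'"
    then show "4 * \<epsilon> < dist a a'"
      using e(3)[OF a, of a'] \<epsilon>(1) \<epsilon>(2)[OF a] by auto
  qed
qed

lemma compact_positive_minimum:
  fixes h :: "complex \<Rightarrow> real"
  assumes "compact S" "continuous_on S h" "\<And>x. x \<in> S \<Longrightarrow> h x > 0"
  obtains \<mu> where "\<mu> > 0" "\<And>x. x \<in> S \<Longrightarrow> \<mu> \<le> h x"
proof (cases "S = {}")
  case False
  then obtain x where "x \<in> S" "\<forall>y\<in>S. h x \<le> h y"
    using continuous_attains_inf assms by blast
  then show ?thesis
    using assms(3) by (intro that[of "h x"]) auto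
qed (use that[of 1] in auto)

text \<open>Three margins suffice for Rouche on small circles about the zeros: \<open>\<mu>1\<close>
  keeps the discs inside the nearby domains, \<open>\<mu>2\<close> keeps the perturbation smaller
  than the function on the circles, and \<open>\<mu>3\<close> excludes zeros elsewhere.\<close>

lemma count_locally_constant:
  assumes s0: "s0 \<in> {0..1}"
  obtains \<delta> where "\<delta> > 0" "\<And>s. s \<in> {0..1} \<Longrightarrow> \<bar>s - s0\<bar> < \<delta> \<Longrightarrow> count s = count s0"
proof -
  define A where "A = zeros s0"
  have finA: "finite A"
    using finite_zeros[OF s0] by (simp add: A_def)
  obtain \<epsilon> where \<epsilon>: "\<epsilon> > 0" "\<And>a. a \<in> A \<Longrightarrow> cball a (2 * \<epsilon>) \<subseteq> {c. N s0 c < \<rho>}"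
    "\<And>a a'. a \<in> A \<Longrightarrow> a' \<in> A \<Longrightarrow> a \<noteq> a' \<Longrightarrow> 4 * \<epsilon> < dist a a'"
    unfolding A_def by (rule separated_zeros[OF s0]) blast
  have sphere_nz: "T s0 x \<noteq> 0" if a: "a \<in> A" and x: "x \<in> sphere a \<epsilon>" for a x
  proof
    assume "T s0 x = 0"
    moreover have "x \<in> cball a (2 * \<epsilon>)"
      using x \<epsilon>(1) by auto
    ultimately have "x \<in> A"
      using \<epsilon>(2)[OF a] by (auto simp: A_def zeros_def)
    then show False
      using \<epsilon>(3)[OF a, of x] \<epsilon>(1) x by auto
  qed
  obtain \<mu>1 where \<mu>1: "\<mu>1 > 0" "\<And>x. x \<in> (\<Union>a\<in>A. cball a (2 * \<epsilon>)) \<Longrightarrow> \<mu>1 \<le> \<rho> - N s0 x"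
  proof (rule compact_positive_minimum[of "\<Union>a\<in>A. cball a (2 * \<epsilon>)" "\<lambda>x. \<rho> - N s0 x"])
    show "continuous_on (\<Union>a\<in>A. cball a (2 * \<epsilon>)) (\<lambda>x. \<rho> - N s0 x)"
      by (intro continuous_intros continuous_N[OF s0])
    show "compact (\<Union>a\<in>A. cball a (2 * \<epsilon>))"
      using finA by (intro compact_UN) auto
    show "\<rho> - N s0 x > 0" if "x \<in> (\<Union>a\<in>A. cball a (2 * \<epsilon>))" for x
      using that \<epsilon>(2) by fastforce
  qed blast
  obtain \<mu>2 where \<mu>2: "\<mu>2 > 0" "\<And>x. x \<in> (\<Union>a\<in>A. sphere a \<epsilon>) \<Longrightarrow> \<mu>2 \<le> norm (T s0 x)"
  proof (rule compact_positive_minimum[of "\<Union>a\<in>A. sphere a \<epsilon>" "\<lambda>x. norm (T s0 x)"])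
    show "continuous_on (\<Union>a\<in>A. sphere a \<epsilon>) (\<lambda>x. norm (T s0 x))"
      by (intro continuous_intros continuous_T[OF s0])
    show "compact (\<Union>a\<in>A. sphere a \<epsilon>)"
      using finA by (intro compact_UN) auto
    show "norm (T s0 x) > 0" if "x \<in> (\<Union>a\<in>A. sphere a \<epsilon>)" for x
      using that sphere_nz by fastforce
  qed blast
  \<comment> \<open>Vanishes exactly at the zeros with \<open>N s0 c \<le> b\<close>. At a zero for
    a nearby \<open>s\<close>, each summand is at most \<open>C * \<bar>s - s0\<bar>\<close>, whence
    the factor \<open>2\<close> in \<open>\<delta>\<close>.\<close>
  define h where "h c = norm (T s0 c) + max 0 (N s0 c - b)" for c
  have h_pos: "h x > 0" if "x \<in> cball 0 \<rho> - (\<Union>a\<in>A. ball a \<epsilon>)" for x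
  proof (rule ccontr)
    assume "\<not> h x > 0"
    then have "norm (T s0 x) \<le> 0" "max 0 (N s0 x - b) \<le> 0"
      using norm_ge_zero[of "T s0 x"] max.cobounded1[of 0 "N s0 x - b"] unfolding h_def by linarith+
    then have "T s0 x = 0" "N s0 x \<le> b"
      by auto
    then have "x \<in> A"
      using b_less by (auto simp: A_def zeros_def)
    then show False
      using that \<epsilon>(1) by auto
  qed
  obtain \<mu>3 where \<mu>3: "\<mu>3 > 0" "\<And>x. x \<in> cball 0 \<rho> - (\<Union>a\<in>A. ball a \<epsilon>) \<Longrightarrow> \<mu>3 \<le> h x"
  proof (rule compact_positive_minimum[of "cball 0 \<rho> - (\<Union>a\<in>A. ball a \<epsilon>)" h])
    show "continuous_on (cball 0 \<rho> - (\<Union>a\<in>A. ball a \<epsilon>)) h"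
      unfolding h_def [abs_def] by (intro continuous_intros continuous_T[OF s0] continuous_N[OF s0])
  qed (use h_pos in \<open>auto intro!: compact_diff\<close>)
  define \<delta> where "\<delta> = Min {\<mu>1, \<mu>2, \<mu>3} / (2 * C)"
  have "\<delta> > 0"
    using \<mu>1 \<mu>2 \<mu>3 C_pos by (auto simp: \<delta>_def)
  show thesis
  proof (rule that[OF \<open>\<delta> > 0\<close>])
    fix s assume s: "s \<in> {0..1}" "\<bar>s - s0\<bar> < \<delta>"
    have "2 * (C * \<bar>s - s0\<bar>) < Min {\<mu>1, \<mu>2, \<mu>3}"
      using s(2) C_pos by (simp add: \<delta>_def field_simps)
    then have small: "2 * (C * \<bar>s - s0\<bar>) < \<mu>1" "2 * (C * \<bar>s - s0\<bar>) < \<mu>2" "2 * (C * \<bar>s - s0\<bar>) < \<mu>3"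
      by auto
    have nonneg: "0 \<le> C * \<bar>s - s0\<bar>"
      using C_pos by simp
    have T_close: "norm (T s x - T s0 x) \<le> C * \<bar>s - s0\<bar>" and N_close: "\<bar>N s x - N s0 x\<bar> \<le> C * \<bar>s - s0\<bar>" for x
      using T_lip[OF s(1) s0, of x x] N_lip[OF s(1) s0, of x x] by simp_all
    have domain: "N s x < \<rho>" if "a \<in> A" "x \<in> cball a (2 * \<epsilon>)" for a x
      using \<mu>1(2)[of x] that N_close[of x] small nonneg by force
    have near: "\<exists>a\<in>A. c \<in> ball a \<epsilon>" if c: "c \<in> zeros s" for c
    proof (rule ccontr)
      assume "\<not> ?thesis"
      moreover have "norm c \<le> \<rho>"
        using c norm_le[OF s(1), of c] by (simp add: zeros_def)
      ultimately have "\<mu>3 \<le> h c"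
        by (intro \<mu>3) auto
      moreover have "T s c = 0" "N s c \<le> b"
        using c by (auto simp: zeros_eq[OF s(1)])
      then have "h c \<le> 2 * (C * \<bar>s - s0\<bar>)"
        using T_close[of c] N_close[of c] nonneg by (auto simp: h_def norm_minus_commute)
      ultimately show False
        using small by linarith
    qed
    have local: "(\<Sum>c\<in>zeros s \<inter> ball a \<epsilon>. zorder (T s) c) = zorder (T s0) a" if a: "a \<in> A" for a
    proof -
      \<comment> \<open>A domain somewhat larger than the circle of radius
        \<open>\<epsilon>\<close>. The separation of the zeros ensures that every zero of
        \<open>T s\<close> in it already lies inside the circle, where the winding number is
        \<open>1\<close>.\<close>
      define B where "B = ball a (2 * \<epsilon>)"
      have sub: "B \<subseteq> {c. N s c < \<rho>}" "B \<subseteq> {c. N s0 c < \<rho>}"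
        using domain[OF a] \<epsilon>(2)[OF a] ball_subset_cball[of a "2 * \<epsilon>"] unfolding B_def by blast+
      have zeros_B: "{p \<in> B. T s p = 0} = zeros s \<inter> ball a \<epsilon>"
      proof (intro equalityI subsetI)
        fix c assume c: "c \<in> {p \<in> B. T s p = 0}"
        then have "c \<in> zeros s"
          using sub by (auto simp: zeros_def)
        then obtain a' where a': "a' \<in> A" "c \<in> ball a' \<epsilon>"
          using near by blast
        have "dist a a' < 4 * \<epsilon>"
          using c a' \<epsilon>(1) dist_triangle[of a a' c] by (simp add: B_def dist_commute)
        then have "a' = a"
          using \<epsilon>(3)[OF a a'(1)] by force
        then show "c \<in> zeros s \<inter> ball a \<epsilon>"
          using a' \<open>c \<in> zeros s\<close> by simp
      qed (use \<epsilon>(1) in \<open>auto simp: zeros_def B_def\<close>)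
      have zeros_B0: "{p \<in> B. T s0 p = 0} = {a}"
      proof (intro equalityI subsetI)
        fix c assume c: "c \<in> {p \<in> B. T s0 p = 0}"
        then have "c \<in> A"
          using sub by (auto simp: A_def zeros_def)
        moreover have "dist a c < 2 * \<epsilon>"
          using c by (auto simp: B_def)
        ultimately show "c \<in> {a}"
          using \<epsilon>(1) \<epsilon>(3)[OF a, of c] by force
      qed (use a \<epsilon>(1) in \<open>auto simp: A_def zeros_def B_def\<close>)
      have [simp]: "(\<lambda>p. T s0 p + (T s p - T s0 p)) = T s"
        by auto
      have "(\<Sum>p\<in>{p \<in> B. T s p = 0}. winding_number (circlepath a \<epsilon>) p * zorder (T s) p) =
          (\<Sum>p\<in>{p \<in> B. T s0 p = 0}. winding_number (circlepath a \<epsilon>) p * zorder (T s0) p)"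
      proof (rule Rouche_theorem[of B "T s0" "\<lambda>p. T s p - T s0 p" "circlepath a \<epsilon>", simplified])
        show "open B" "connected B"
          by (simp_all add: B_def)
        show "finite {p \<in> B. T s p = 0}" "finite {p \<in> B. T s0 p = 0}"
          unfolding zeros_B zeros_B0 using finite_zeros[OF s(1)] by auto
        show "T s0 holomorphic_on B" "(\<lambda>p. T s p - T s0 p) holomorphic_on B"
          using holo[OF s(1)] holo[OF s0] sub by (auto intro!: holomorphic_intros elim: holomorphic_on_subset)
        show "sphere a \<bar>\<epsilon>\<bar> \<subseteq> B"
          using \<epsilon>(1) by (auto simp: B_def)
        show "\<forall>z\<in>sphere a \<bar>\<epsilon>\<bar>. cmod (T s z - T s0 z) < cmod (T s0 z)"
        proof
          fix z assume "z \<in> sphere a \<bar>\<epsilon>\<bar>"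
          then have "\<mu>2 \<le> norm (T s0 z)"
            using a \<epsilon>(1) by (intro \<mu>2) auto
          then show "cmod (T s z - T s0 z) < cmod (T s0 z)"
            using T_close[of z] small nonneg by linarith
        qed
        show "\<forall>z. z \<notin> B \<longrightarrow> winding_number (circlepath a \<epsilon>) z = 0"
          using \<epsilon>(1) by (intro allI impI winding_number_zero_outside[of _ "cball a \<epsilon>"]) (auto simp: B_def)
      qed
      then have "(\<Sum>p\<in>zeros s \<inter> ball a \<epsilon>. winding_number (circlepath a \<epsilon>) p * zorder (T s) p) = zorder (T s0) a"
        unfolding zeros_B zeros_B0 using \<epsilon>(1) by (simp add: winding_number_circlepath)
      moreover have "(\<Sum>p\<in>zeros s \<inter> ball a \<epsilon>. winding_number (circlepath a \<epsilon>) p * zorder (T s) p) =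
          (\<Sum>p\<in>zeros s \<inter> ball a \<epsilon>. of_int (zorder (T s) p))"
        by (intro sum.cong refl) (simp add: winding_number_circlepath dist_norm norm_minus_commute)
      ultimately show ?thesis
        by (metis of_int_sum of_int_eq_iff)
    qed
    have "zeros s = (\<Union>a\<in>A. zeros s \<inter> ball a \<epsilon>)"
      using near by blast
    then have "count s = (\<Sum>c\<in>(\<Union>a\<in>A. zeros s \<inter> ball a \<epsilon>). zorder (T s) c)"
      by (simp add: count_def)
    also have "\<dots> = (\<Sum>a\<in>A. \<Sum>c\<in>zeros s \<inter> ball a \<epsilon>. zorder (T s) c)"
    proof (rule sum.UNION_disjoint)
      show "\<forall>a\<in>A. \<forall>a'\<in>A. a \<noteq> a' \<longrightarrow> (zeros s \<inter> ball a \<epsilon>) \<inter> (zeros s \<inter> ball a' \<epsilon>) = {}"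
      proof (intro ballI impI)
        fix a a' assume "a \<in> A" "a' \<in> A" "a \<noteq> a'"
        then have "4 * \<epsilon> < dist a a'"
          by (rule \<epsilon>(3))
        then have "ball a \<epsilon> \<inter> ball a' \<epsilon> = {}"
          using \<epsilon>(1) by (intro disjoint_ballI) auto
        then show "(zeros s \<inter> ball a \<epsilon>) \<inter> (zeros s \<inter> ball a' \<epsilon>) = {}"
          by blast
      qed
    qed (use finA finite_zeros[OF s(1)] in auto)
    also have "\<dots> = count s0"
      using local by (simp add: count_def A_def)
    finally show "count s = count s0" .
  qed
qed

theorem count_constant: "count 0 = count 1"
proof -
  have "count constant_on {0..1}"
  proof (rule locally_constant_imp_constant)
    fix s0 :: real assume s0: "s0 \<in> {0..1}"
    then obtain \<delta> where \<delta>: "\<delta> > 0" "\<And>s. s \<in> {0..1} \<Longrightarrow> \<bar>s - s0\<bar> < \<delta> \<Longrightarrow> count s = count s0"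
      by (rule count_locally_constant) blast
    have "openin (top_of_set {0..1}) ({0..1} \<inter> ball s0 \<delta>)"
      by (rule openin_open_Int) simp
    moreover have "s0 \<in> {0..1} \<inter> ball s0 \<delta>"
      using s0 \<delta>(1) by simp
    moreover have "count s = count s0" if "s \<in> {0..1} \<inter> ball s0 \<delta>" for s
      using that by (intro \<delta>(2)) (auto simp: dist_real_def)
    ultimately show "\<exists>U. openin (top_of_set {0..1}) U \<and> s0 \<in> U \<and> (\<forall>s\<in>U. count s = count s0)"
      by blast
  qed simp
  then obtain k where "\<forall>s\<in>{0..1}. count s = k"
    unfolding constant_on_def by blast
  then show ?thesis
    by simp
qed

end

section \<open>The deformation to a Bernoulli equation\<close>

lemma convex_comb_le:
  fixes a b c d s :: real
  assumes "a \<le> b" "c \<le> d" "0 \<le> s" "s \<le> 1"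
  shows "(1 - s) * a + s * c \<le> (1 - s) * b + s * d"
  using assms by (intro add_mono mult_left_mono) auto

text \<open>Absolute values enter every condition on its convex side. A common
  \<open>\<sigma>\<close> is essential: it makes the condition on the linear coefficient linear and
  keeps that coefficient from passing through \<open>0\<close>.\<close>

lemma sector_conditions_convex:
  assumes p: "sector_conditions n r \<sigma> \<omega> p" and q: "sector_conditions n r \<sigma> \<omega> q"
    and n: "n \<ge> 5" and r: "r > 0" and s: "0 \<le> s" "s \<le> 1"
  shows "sector_conditions n r \<sigma> \<omega> (\<lambda>i t. (1 - s) * p i t + s * q i t)"
  unfolding sector_conditions_def
proof (intro conjI ballI)
  show "\<sigma> = 1 \<or> \<sigma> = - 1"
    using p by (simp add: sector_conditions_def)
  fix t assume t: "t \<in> {0..\<omega>}"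
  define \<beta> where "\<beta> = sin (pi / real (n - 2))"
  have \<beta>: "\<beta> \<ge> 0"
    unfolding \<beta>_def using n by (intro sin_ge_zero) (auto simp: field_simps)
  have abs_le: "\<bar>(1 - s) * a + s * b\<bar> \<le> (1 - s) * \<bar>a\<bar> + s * \<bar>b\<bar>" for a b
    using s abs_triangle_ineq[of "(1 - s) * a" "s * b"] by (simp add: abs_mult)
  have P: "\<bar>p 0 t\<bar> < r ^ n" "p (n - 2) t \<le> 0"
      "\<And>i. i \<in> {2..n-3} \<Longrightarrow> \<bar>p i t\<bar> * r ^ i \<le> (r ^ n - r ^ (n - 2) * p (n - 2) t - \<bar>p 0 t\<bar>) / real (n - 4) * \<beta>"
      "r ^ n + \<bar>p 0 t\<bar> + (\<Sum>i\<in>{2..<n}. \<bar>p i t\<bar> * r ^ i) \<le> \<sigma> * p 1 t * r"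
    and Q: "\<bar>q 0 t\<bar> < r ^ n" "q (n - 2) t \<le> 0"
      "\<And>i. i \<in> {2..n-3} \<Longrightarrow> \<bar>q i t\<bar> * r ^ i \<le> (r ^ n - r ^ (n - 2) * q (n - 2) t - \<bar>q 0 t\<bar>) / real (n - 4) * \<beta>"
      "r ^ n + \<bar>q 0 t\<bar> + (\<Sum>i\<in>{2..<n}. \<bar>q i t\<bar> * r ^ i) \<le> \<sigma> * q 1 t * r"
    using p q t by (auto simp: sector_conditions_def \<beta>_def)
  show "\<bar>(1 - s) * p 0 t + s * q 0 t\<bar> < r ^ n"
  proof -
    have "(1 - s) * \<bar>p 0 t\<bar> + s * \<bar>q 0 t\<bar> \<le> (1 - s) * max \<bar>p 0 t\<bar> \<bar>q 0 t\<bar> + s * max \<bar>p 0 t\<bar> \<bar>q 0 t\<bar>"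
      using s by (intro convex_comb_le) auto
    also have "\<dots> = max \<bar>p 0 t\<bar> \<bar>q 0 t\<bar>"
      by (simp add: algebra_simps)
    finally show ?thesis
      using abs_le[of "p 0 t" "q 0 t"] P(1) Q(1) by linarith
  qed
  show "(1 - s) * p (n - 2) t + s * q (n - 2) t \<le> 0"
    using s P(2) Q(2) convex_comb_le[of "p (n - 2) t" 0 "q (n - 2) t" 0 s] by simp
  show "r ^ n + \<bar>(1 - s) * p 0 t + s * q 0 t\<bar> + (\<Sum>i\<in>{2..<n}. \<bar>(1 - s) * p i t + s * q i t\<bar> * r ^ i)
      \<le> \<sigma> * ((1 - s) * p 1 t + s * q 1 t) * r"
  proof -
    have "(\<Sum>i\<in>{2..<n}. \<bar>(1 - s) * p i t + s * q i t\<bar> * r ^ i) \<le>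
        (\<Sum>i\<in>{2..<n}. ((1 - s) * \<bar>p i t\<bar> + s * \<bar>q i t\<bar>) * r ^ i)"
      using r by (intro sum_mono mult_right_mono abs_le) auto
    also have "\<dots> = (1 - s) * (\<Sum>i\<in>{2..<n}. \<bar>p i t\<bar> * r ^ i) + s * (\<Sum>i\<in>{2..<n}. \<bar>q i t\<bar> * r ^ i)"
      by (simp add: sum_distrib_left distrib_right sum.distrib mult.assoc)
    finally have "r ^ n + \<bar>(1 - s) * p 0 t + s * q 0 t\<bar> + (\<Sum>i\<in>{2..<n}. \<bar>(1 - s) * p i t + s * q i t\<bar> * r ^ i) \<le>
        (1 - s) * (r ^ n + \<bar>p 0 t\<bar> + (\<Sum>i\<in>{2..<n}. \<bar>p i t\<bar> * r ^ i)) +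
        s * (r ^ n + \<bar>q 0 t\<bar> + (\<Sum>i\<in>{2..<n}. \<bar>q i t\<bar> * r ^ i))"
      using abs_le[of "p 0 t" "q 0 t"] by (simp add: algebra_simps)
    also have "\<dots> \<le> (1 - s) * (\<sigma> * p 1 t * r) + s * (\<sigma> * q 1 t * r)"
      using P(4) Q(4) s by (rule convex_comb_le)
    finally show ?thesis
      by (simp add: algebra_simps)
  qed
  fix i assume i: "i \<in> {2..n-3}"
  define S where "S a b = (r ^ n - r ^ (n - 2) * a - b) / real (n - 4) * \<beta>" for a b
  have "\<bar>(1 - s) * p i t + s * q i t\<bar> * r ^ i \<le> ((1 - s) * \<bar>p i t\<bar> + s * \<bar>q i t\<bar>) * r ^ i"
    using r by (intro mult_right_mono abs_le) auto
  also have "\<dots> = (1 - s) * (\<bar>p i t\<bar> * r ^ i) + s * (\<bar>q i t\<bar> * r ^ i)"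
    by (simp add: algebra_simps)
  also have "\<dots> \<le> (1 - s) * S (p (n - 2) t) \<bar>p 0 t\<bar> + s * S (q (n - 2) t) \<bar>q 0 t\<bar>"
    unfolding S_def using P(3)[OF i] Q(3)[OF i] s by (rule convex_comb_le)
  also have "\<dots> = S ((1 - s) * p (n - 2) t + s * q (n - 2) t) ((1 - s) * \<bar>p 0 t\<bar> + s * \<bar>q 0 t\<bar>)"
    by (simp add: S_def divide_inverse algebra_simps)
  also have "\<dots> \<le> S ((1 - s) * p (n - 2) t + s * q (n - 2) t) \<bar>(1 - s) * p 0 t + s * q 0 t\<bar>"
    unfolding S_def using \<beta> abs_le[of "p 0 t" "q 0 t"] by (intro mult_right_mono divide_right_mono diff_left_mono) auto
  finally show "\<bar>(1 - s) * p i t + s * q i t\<bar> * r ^ i \<le> (r ^ n - r ^ (n - 2) * ((1 - s) * p (n - 2) t + s * q (n - 2) t) -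
      \<bar>(1 - s) * p 0 t + s * q 0 t\<bar>) / real (n - 4) * sin (pi / real (n - 2))"
    by (simp only: S_def \<beta>_def)
qed

section \<open>The Bernoulli end point\<close>

definition linear_coeff :: "real \<Rightarrow> nat \<Rightarrow> real \<Rightarrow> real" where
  "linear_coeff \<alpha> i t = (if i = 1 then \<alpha> else 0)"

lemma sum_linear_coeff:
  fixes f :: "nat \<Rightarrow> complex"
  assumes "n \<ge> 2"
  shows "(\<Sum>i<n. of_real (linear_coeff \<alpha> i t) * f i) = of_real \<alpha> * f 1"
proof -
  have "(\<Sum>i<n. of_real (linear_coeff \<alpha> i t) * f i) = (\<Sum>i\<in>{1}. of_real (linear_coeff \<alpha> i t) * f i)"
    using assms by (intro sum.mono_neutral_right) (auto simp: linear_coeff_def)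
  then show ?thesis
    by (simp add: linear_coeff_def)
qed

lemma rhs_linear_coeff:
  assumes "n \<ge> 2"
  shows "rhs n (linear_coeff \<alpha>) t z = z * (z ^ (n - 1) + of_real \<alpha>)"
proof -
  have "z ^ n = z * z ^ (n - 1)"
    using assms by (cases n) auto
  then show ?thesis
    unfolding rhs_def sum_linear_coeff[OF assms] by (simp add: algebra_simps)
qed

lemma drhs_linear_coeff:
  "n \<ge> 2 \<Longrightarrow> drhs n (linear_coeff \<alpha>) t z = of_nat n * z ^ (n - 1) + of_real \<alpha>"
  unfolding drhs_def by (simp add: sum_linear_coeff)

text \<open>The substitution \<open>u = 1 / \<phi> ^ m\<close> linearises the equation to
  \<open>u' = - m * (1 + \<alpha> * u)\<close>. It is legitimate because \<open>0\<close> is an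
  equilibrium, so a solution that starts elsewhere never vanishes.\<close>

lemma periodic_bernoulli_constant:
  assumes n: "n \<ge> 2" and \<alpha>: "\<alpha> \<noteq> 0" and "\<omega> > 0"
    and sol: "is_sol n (linear_coeff \<alpha>) \<omega> c \<phi>" "\<phi> \<omega> = c"
  shows "c = 0 \<or> c ^ (n - 1) = - of_real \<alpha>"
proof (cases "c = 0")
  case False
  define m where "m = n - 1"
  have m: "m > 0" "n = Suc m"
    using n by (auto simp: m_def)
  have \<phi>': "(\<phi> has_vector_derivative \<phi> t * (\<phi> t ^ m + of_real \<alpha>)) (at t within {0..\<omega>})" if "t \<in> {0..\<omega>}" for t
    using sol that n by (simp add: is_sol_def rhs_linear_coeff m_def)
  obtain R where R: "\<forall>z\<in>\<phi> ` {0..\<omega>}. norm z \<le> R"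
    using is_sol_bounded[OF sol(1)] unfolding bounded_iff ..
  have nz: "\<phi> t \<noteq> 0" if "t \<in> {0..\<omega>}" for t
  proof
    assume "\<phi> t = 0"
    have "\<phi> 0 = 0"
    proof (rule zero_of_linear_growth_bound[OF _ \<phi>' _ that \<open>\<phi> t = 0\<close>])
      show "\<bar>R\<bar> ^ m + \<bar>\<alpha>\<bar> > 0"
        using \<alpha> by (simp add: add_nonneg_pos)
      show "norm (\<phi> t * (\<phi> t ^ m + of_real \<alpha>)) \<le> (\<bar>R\<bar> ^ m + \<bar>\<alpha>\<bar>) * norm (\<phi> t)" if "t \<in> {0..\<omega>}" for t
      proof -
        have "norm (\<phi> t) \<le> \<bar>R\<bar>"
          using R that by force
        then have "norm (\<phi> t ^ m + of_real \<alpha>) \<le> \<bar>R\<bar> ^ m + \<bar>\<alpha>\<bar>"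
          by (intro order_trans[OF norm_triangle_ineq] add_mono) (auto simp: norm_power intro: power_mono)
        then show ?thesis
          by (simp add: norm_mult mult.commute mult_left_mono)
      qed
    qed (use \<open>\<omega> > 0\<close> in auto)
    then show False
      using sol False by (simp add: is_sol_def)
  qed
  \<comment> \<open>A first integral. Equality of its end values, with
    \<open>\<phi> \<omega> = c\<close>, gives \<open>1 + \<alpha> / c ^ m = 0\<close>, since
    \<open>exp (m * \<alpha> * \<omega>)\<close> differs from \<open>1\<close>.\<close>
  define v where "v t = (1 + of_real \<alpha> / \<phi> t ^ m) * exp (of_real (real m * \<alpha> * t))" for t
  have "(v has_vector_derivative 0) (at t within {0..\<omega>})" if t: "t \<in> {0..\<omega>}" for t
  proof -
    obtain k where k: "m = Suc k"
      using m(1) by (cases m) auto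
    have "((\<lambda>z. z ^ m) has_field_derivative of_nat m * \<phi> t ^ (m - 1)) (at (\<phi> t) within \<phi> ` {0..\<omega>})"
      by (auto intro!: derivative_eq_intros)
    then have "((\<lambda>z. 1 + of_real \<alpha> / z ^ m) has_field_derivative
        0 + (0 * \<phi> t ^ m - of_real \<alpha> * (of_nat m * \<phi> t ^ (m - 1))) / (\<phi> t ^ m * \<phi> t ^ m)) (at (\<phi> t) within \<phi> ` {0..\<omega>})"
      using nz[OF t] by (intro DERIV_add DERIV_divide DERIV_const) auto
    also have "0 + (0 * \<phi> t ^ m - of_real \<alpha> * (of_nat m * \<phi> t ^ (m - 1))) / (\<phi> t ^ m * \<phi> t ^ m) =
        - (of_nat m * of_real \<alpha> / \<phi> t ^ Suc m)"
      using nz[OF t] by (simp add: k field_simps)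
    finally have "((\<lambda>z. 1 + of_real \<alpha> / z ^ m) has_field_derivative - (of_nat m * of_real \<alpha> / \<phi> t ^ Suc m))
        (at (\<phi> t) within \<phi> ` {0..\<omega>})" .
    from field_vector_diff_chain_within[OF \<phi>'[OF t] this]
    have 1: "((\<lambda>t. 1 + of_real \<alpha> / \<phi> t ^ m) has_vector_derivative
        \<phi> t * (\<phi> t ^ m + of_real \<alpha>) * - (of_nat m * of_real \<alpha> / \<phi> t ^ Suc m)) (at t within {0..\<omega>})"
      by (simp add: o_def)
    have "((\<lambda>t. complex_of_real (real m * \<alpha> * t)) has_vector_derivative of_real (real m * \<alpha>)) (at t within {0..\<omega>})"
      by (rule has_vector_derivative_of_real) (auto intro!: derivative_eq_intros)
    from field_vector_diff_chain_within[OF this has_field_derivative_at_within[OF DERIV_exp]]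
    have 2: "((\<lambda>t. exp (of_real (real m * \<alpha> * t))) has_vector_derivative
        of_real (real m * \<alpha>) * exp (complex_of_real (real m * \<alpha> * t))) (at t within {0..\<omega>})"
      by (simp add: o_def)
    show ?thesis
      unfolding v_def [abs_def]
      by (rule has_vector_derivative_eq_rhs[OF has_vector_derivative_mult[OF 1 2]]) (use nz[OF t] in \<open>simp add: field_simps\<close>)
  qed
  then obtain k where "\<And>t. t \<in> {0..\<omega>} \<Longrightarrow> v t = k"
    using has_vector_derivative_zero_constant[of "{0..\<omega>}" v] by auto
  then have "v \<omega> = v 0"
    using \<open>\<omega> > 0\<close> by simp
  then have "(1 + of_real \<alpha> / c ^ m) * (exp (of_real (real m * \<alpha> * \<omega>)) - 1) = 0"
    using sol by (simp add: v_def is_sol_def algebra_simps)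
  moreover have "exp (complex_of_real (real m * \<alpha> * \<omega>)) \<noteq> 1"
    unfolding exp_of_real of_real_eq_1_iff using m \<alpha> \<open>\<omega> > 0\<close> by simp
  ultimately have "1 + of_real \<alpha> / c ^ m = 0"
    by simp
  then have "c ^ m = - of_real \<alpha>"
    using False by (simp add: field_simps add_eq_0_iff2)
  then show ?thesis
    by (simp add: m_def)
qed simp

section \<open>Counting periodic solutions along a family\<close>

lemma zorder_eq_1_of_deriv:
  assumes "f holomorphic_on S" "open S" "z \<in> S" "f z = 0" "(f has_field_derivative d) (at z)" "d \<noteq> 0"
  shows "zorder f z = 1"
  using assms DERIV_imp_deriv[OF assms(5)] by (intro zorder_zero_eqI[of f S z 1]) auto

text \<open>A solution is unconstrained outside \<open>{0..\<omega>}\<close>, so the choice in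
  \<open>displ\<close> is not determined as a function; uniqueness determines its value at
  \<open>\<omega>\<close>.\<close>

lemma displ_eq:
  assumes "bounded_coeffs n \<omega> M p" "M \<ge> 0" "\<omega> \<ge> 0" "is_sol n p \<omega> c \<phi>"
  shows "displ n p \<omega> c = \<phi> \<omega> - c"
proof -
  have "is_sol n p \<omega> c (SOME \<phi>. is_sol n p \<omega> c \<phi>)"
    using assms(4) by (rule someI[of "is_sol n p \<omega> c"])
  then have "(SOME \<phi>. is_sol n p \<omega> c \<phi>) \<omega> = \<phi> \<omega>"
    using assms by (intro is_sol_unique[OF assms(1,2)]) auto
  then show ?thesis
    by (simp add: displ_def)
qed

text \<open>The a priori bound lies strictly inside the truncation radius: every periodic solution
  survives the truncation with amplitude at most \<open>b\<close>, which provides the gap required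
  by \<open>zero_family\<close>.\<close>

locale bounded_periodic_family = coefficient_family +
  fixes b :: real
  assumes b_less: "b < R"
    and periodic_le: "s \<in> {0..1} \<Longrightarrow> is_sol n (p s) \<omega> c \<phi> \<Longrightarrow> \<phi> \<omega> = c \<Longrightarrow> t \<in> {0..\<omega>} \<Longrightarrow> norm (\<phi> t) \<le> b"
begin

lemma flow_is_sol:
  assumes "s \<in> {0..1}" "amplitude s c \<le> R"
  shows "is_sol n (p s) \<omega> c (flow s c)"
  using flow[OF assms(1), of c] norm_flow_le_amplitude[OF assms(1), of _ c] assms(2)
  by (subst trunc_sol_iff_is_sol[symmetric]) (auto intro: order_trans)

lemma amplitude_le_of_zero:
  assumes "s \<in> {0..1}" "displacement s c = 0" "amplitude s c < R"
  shows "amplitude s c \<le> b"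
  using assms periodic_le[OF assms(1) flow_is_sol, of c] by (intro amplitude_le) (auto simp: displacement_def)

lemma displacement_eq_displ:
  assumes "s \<in> {0..1}" "amplitude s c < R"
  shows "displacement s c = displ n (p s) \<omega> c"
  using assms displ_eq[OF coeffs M_nonneg _ flow_is_sol, of s c] \<omega>_pos by (simp add: displacement_def)

lemma displacement_holomorphic:
  assumes "s \<in> {0..1}"
  shows "displacement s holomorphic_on {c. amplitude s c < R}"
  unfolding holomorphic_on_def field_differentiable_def
  using displacement_has_field_derivative[OF assms] by (blast intro: has_field_derivative_at_within)

lemma periodic_inits_eq:
  assumes s: "s \<in> {0..1}"
  shows "periodic_inits n (p s) \<omega> = {c. amplitude s c < R \<and> displacement s c = 0}"
proof (intro equalityI subsetI)
  fix c assume "c \<in> periodic_inits n (p s) \<omega>"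
  then obtain \<phi> where \<phi>: "is_sol n (p s) \<omega> c \<phi>" and "displ n (p s) \<omega> c = 0"
    by (auto simp: periodic_inits_def Qset_def)
  then have per: "\<phi> \<omega> = c"
    using displ_eq[OF coeffs[OF s] M_nonneg _ \<phi>] \<omega>_pos by simp
  have b: "norm (\<phi> t) \<le> b" if "t \<in> {0..\<omega>}" for t
    using periodic_le[OF s \<phi> per that] .
  then have "trunc_sol s c \<phi>"
    using \<phi> b_less by (subst trunc_sol_iff_is_sol) (auto intro: order_trans less_imp_le)
  then have eq: "flow s c t = \<phi> t" if "t \<in> {0..\<omega>}" for t
    using trunc_sol_unique[OF s flow[OF s] _ that] by simp
  then have "amplitude s c \<le> b"
    using b by (intro amplitude_le) simp
  then show "c \<in> {c. amplitude s c < R \<and> displacement s c = 0}"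
    using b_less eq[of \<omega>] per \<omega>_pos by (simp add: displacement_def)
next
  fix c assume "c \<in> {c. amplitude s c < R \<and> displacement s c = 0}"
  then show "c \<in> periodic_inits n (p s) \<omega>"
    using flow_is_sol[OF s, of c] displacement_eq_displ[OF s, of c]
    by (auto simp: periodic_inits_def Qset_def)
qed

lemma open_amplitude_less:
  assumes s: "s \<in> {0..1}"
  shows "open {c. amplitude s c < R}"
proof (rule amplitude_displacement_estimate)
  fix C :: real
  assume C: "C > 0" "\<And>s s' c c'. s \<in> {0..1} \<Longrightarrow> s' \<in> {0..1} \<Longrightarrow>
    \<bar>amplitude s c - amplitude s' c'\<bar> \<le> C * (\<bar>s - s'\<bar> + norm (c - c'))"
  have "continuous_on UNIV (amplitude s)"
    by (rule lipschitz_on_continuous_on[of C], rule lipschitz_onI)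
      (use C(2)[OF s s] C(1) in \<open>auto simp: dist_norm\<close>)
  then show ?thesis
    by (intro open_Collect_less continuous_intros)
qed

lemma zorder_displacement:
  assumes s: "s \<in> {0..1}" and c: "amplitude s c < R"
  shows "zorder (displacement s) c = zorder (displ n (p s) \<omega>) c"
proof (rule zorder_cong)
  have "eventually (\<lambda>c. c \<in> {c. amplitude s c < R}) (nhds c)"
    using open_amplitude_less[OF s] c by (intro eventually_nhds_in_open) auto
  then have "eventually (\<lambda>c. c \<in> {c. amplitude s c < R}) (at c)"
    by (rule eventually_nhds_conv_at[THEN iffD1, THEN conjunct1])
  then show "eventually (\<lambda>c. displacement s c = displ n (p s) \<omega> c) (at c)"
    by eventually_elim (use displacement_eq_displ[OF s] in simp)
qed simp

text \<open>At the parameter \<open>0\<close> the count is expressed by \<open>displ\<close>, as the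
  final claim needs it; at \<open>1\<close> by \<open>displacement\<close>, whose derivative is
  explicit.\<close>

lemma periodic_count_constant:
  "finite (periodic_inits n (p 0) \<omega>)"
  "(\<Sum>c\<in>periodic_inits n (p 0) \<omega>. zorder (displ n (p 0) \<omega>) c) =
   (\<Sum>c\<in>periodic_inits n (p 1) \<omega>. zorder (displacement 1) c)"
proof -
  obtain C where C: "C > 0"
    "\<And>s s' c c'. s \<in> {0..1} \<Longrightarrow> s' \<in> {0..1} \<Longrightarrow> \<bar>amplitude s c - amplitude s' c'\<bar> \<le> C * (\<bar>s - s'\<bar> + norm (c - c'))"
    "\<And>s s' c c'. s \<in> {0..1} \<Longrightarrow> s' \<in> {0..1} \<Longrightarrow>
      norm (displacement s c - displacement s' c') \<le> C * (\<bar>s - s'\<bar> + norm (c - c'))"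
    by (rule amplitude_displacement_estimate) blast
  interpret zero_family displacement amplitude b R C
    by unfold_locales (fact C b_less norm_le_amplitude displacement_holomorphic amplitude_le_of_zero)+
  have zeros: "zeros s = periodic_inits n (p s) \<omega>" if "s \<in> {0..1}" for s
    using periodic_inits_eq[OF that] by (simp add: zeros_def)
  show "finite (periodic_inits n (p 0) \<omega>)"
    using finite_zeros[of 0] zeros[of 0] by simp
  have "(\<Sum>c\<in>periodic_inits n (p 0) \<omega>. zorder (displ n (p 0) \<omega>) c) =
      (\<Sum>c\<in>periodic_inits n (p 0) \<omega>. zorder (displacement 0) c)"
    by (intro sum.cong refl zorder_displacement[symmetric]) (auto simp: periodic_inits_eq)
  then show "(\<Sum>c\<in>periodic_inits n (p 0) \<omega>. zorder (displ n (p 0) \<omega>) c) =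
      (\<Sum>c\<in>periodic_inits n (p 1) \<omega>. zorder (displacement 1) c)"
    using count_constant zeros[of 0] zeros[of 1] by (simp add: count_def)
qed

end

text \<open>The linearisation at an equilibrium is a nonzero real number: \<open>\<alpha>\<close> at
  \<open>0\<close>, and \<open>n * c ^ (n - 1) + \<alpha> = - (n - 1) * \<alpha>\<close> at the
  roots. So the derivative \<open>exp (\<omega> * \<lambda>) - 1\<close> of the displacement does
  not vanish and all \<open>n\<close> zeros are simple.\<close>

lemma (in bounded_periodic_family) periodic_count_bernoulli:
  assumes n: "n \<ge> 2" and \<alpha>: "\<alpha> \<noteq> 0" and p1: "p 1 = linear_coeff \<alpha>"
  shows "(\<Sum>c\<in>periodic_inits n (p 1) \<omega>. zorder (displacement 1) c) = int n"
proof -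
  define Z where "Z = insert 0 {c. c ^ (n - 1) = - complex_of_real \<alpha>}"
  have const: "is_sol n (p 1) \<omega> c (\<lambda>_. c)" if "c \<in> Z" for c
    using that n by (auto simp: is_sol_def p1 rhs_linear_coeff Z_def)
  have "periodic_inits n (p 1) \<omega> \<subseteq> Z"
  proof
    fix c assume "c \<in> periodic_inits n (p 1) \<omega>"
    then have "is_sol n (p 1) \<omega> c (flow 1 c)" "flow 1 c \<omega> = c"
      using flow_is_sol[of 1 c] by (auto simp: periodic_inits_eq displacement_def)
    then show "c \<in> Z"
      using periodic_bernoulli_constant[OF n \<alpha> \<omega>_pos, of c "flow 1 c"] by (auto simp: p1 Z_def)
  qed
  moreover have "Z \<subseteq> periodic_inits n (p 1) \<omega>"
    using const displ_eq[OF coeffs[of 1] M_nonneg _ const] \<omega>_pos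
    by (auto simp: periodic_inits_def Qset_def)
  ultimately have Z: "periodic_inits n (p 1) \<omega> = Z"
    by blast
  have "zorder (displacement 1) c = 1" if c: "c \<in> Z" for c
  proof -
    have amp: "amplitude 1 c < R" "displacement 1 c = 0"
      using c unfolding Z[symmetric] by (auto simp: periodic_inits_eq)
    have "flow 1 c t = c" if "t \<in> {0..\<omega>}" for t
      using is_sol_unique[OF coeffs M_nonneg flow_is_sol const[OF c] that] amp by simp
    then have "integral {0..\<omega>} (\<lambda>t. drhs n (p 1) t (flow 1 c t)) = integral {0..\<omega>} (\<lambda>t. of_nat n * c ^ (n - 1) + of_real \<alpha>)"
      by (intro integral_cong) (simp add: p1 drhs_linear_coeff[OF n])
    also have "\<dots> = of_real (\<omega> * (if c = 0 then \<alpha> else - (real n - 1) * \<alpha>))"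
      using c n \<omega>_pos by (auto simp: Z_def scaleR_conv_of_real algebra_simps)
    finally have I: "integral {0..\<omega>} (\<lambda>t. drhs n (p 1) t (flow 1 c t)) = \<dots>" .
    have "\<omega> * (if c = 0 then \<alpha> else - (real n - 1) * \<alpha>) \<noteq> 0"
      using \<alpha> \<omega>_pos n by auto
    then have "exp (integral {0..\<omega>} (\<lambda>t. drhs n (p 1) t (flow 1 c t))) - 1 \<noteq> 0"
      unfolding I exp_of_real right_minus_eq of_real_eq_1_iff by simp
    then show ?thesis
      using amp by (intro zorder_eq_1_of_deriv[OF displacement_holomorphic open_amplitude_less _ _
            displacement_has_field_derivative]) auto
  qed
  moreover have "card Z = n"
  proof -
    have "card {c. c ^ (n - 1) = - complex_of_real \<alpha>} = n - 1"
      using \<alpha> n by (intro card_nth_roots) auto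
    moreover have "finite {c. c ^ (n - 1) = - complex_of_real \<alpha>}"
      using \<alpha> n by (intro finite_nth_roots) auto
    moreover have "0 \<notin> {c. c ^ (n - 1) = - complex_of_real \<alpha>}"
      using \<alpha> n by (simp add: power_0_left)
    ultimately show ?thesis
      using n by (simp add: Z_def)
  qed
  ultimately show ?thesis
    unfolding Z by simp
qed

text \<open>This explains the constants in the hypothesis on \<open>P 1\<close>: the
  \<open>n - 3\<close> indices other than \<open>n - 2\<close> contribute at most \<open>S\<close>
  each, which yields the factor \<open>(n - 3) / (n - 4)\<close>, and the index \<open>n - 2\<close>
  contributes \<open>- r ^ (n - 2) * P (n - 2) t\<close>.\<close>

lemma sector_conditions_of_hypotheses:
  fixes n :: nat and \<omega> K \<sigma> :: real and P :: "nat \<Rightarrow> real \<Rightarrow> real"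
  assumes n5: "n \<ge> 5" and K: "K > 0" and r: "r = K powr (1 / real n)" and \<sigma>: "\<sigma> = 1 \<or> \<sigma> = - 1"
    and P0: "\<forall>t\<in>{0..\<omega>}. \<bar>P 0 t\<bar> < K"
    and Pn2: "\<forall>t\<in>{0..\<omega>}. P (n - 2) t \<le> 0"
    and Pi: "\<forall>t\<in>{0..\<omega>}. \<forall>i\<in>{2..n-1} - {n-2}.
       \<bar>P i t\<bar> \<le> (K - K powr (real (n-2) / real n) * P (n-2) t - \<bar>P 0 t\<bar>)
                   / (real (n-4) * K powr (real i / real n)) * sin (pi / real (n-2))"
    and P1: "\<forall>t\<in>{0..\<omega>}.
       \<bar>P 1 t\<bar> \<ge> (K + \<bar>P 0 t\<bar> - K powr (real (n-2) / real n) * P (n-2) t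
                   + real (n-3) / real (n-4) * (K - K powr (real (n-2) / real n) * P (n-2) t - \<bar>P 0 t\<bar>)
                     * sin (pi / real (n-2))) / K powr (1 / real n)"
    and P1_sign: "\<forall>t\<in>{0..\<omega>}. \<sigma> * P 1 t = \<bar>P 1 t\<bar>"
  shows "sector_conditions n r \<sigma> \<omega> P"
  unfolding sector_conditions_def
proof (intro conjI ballI)
  have "r > 0"
    using K by (simp add: r)
  have pow: "K powr (real i / real n) = r ^ i" for i
    using K by (simp add: r powr_powr flip: powr_realpow)
  have rn: "r ^ n = K"
    using pow[of n] K n5 by simp
  fix t assume t: "t \<in> {0..\<omega>}"
  define S where "S = (K - r ^ (n - 2) * P (n - 2) t - \<bar>P 0 t\<bar>) / real (n - 4) * sin (pi / real (n - 2))"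
  have term_le: "\<bar>P i t\<bar> * r ^ i \<le> S" if "i \<in> {2..n-1} - {n-2}" for i
  proof -
    have "\<bar>P i t\<bar> \<le> S / r ^ i"
      using Pi[rule_format, OF t that] by (simp add: pow S_def)
    then show ?thesis
      using \<open>r > 0\<close> by (simp add: field_simps)
  qed
  show "\<bar>P 0 t\<bar> < r ^ n"
    using P0 t by (simp add: rn)
  show "P (n - 2) t \<le> 0"
    using Pn2 t by simp
  show "\<bar>P i t\<bar> * r ^ i \<le> (r ^ n - r ^ (n - 2) * P (n - 2) t - \<bar>P 0 t\<bar>) / real (n - 4) * sin (pi / real (n - 2))"
    if "i \<in> {2..n-3}" for i
  proof -
    have "i \<in> {2..n-1} - {n-2}"
      using that n5 by auto
    then show ?thesis
      using term_le by (simp add: S_def rn)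
  qed
  have "{2..<n} - {n - 2} = {2..n-1} - {n-2}" "n - 2 \<in> {2..<n}"
    using n5 by auto
  then have "(\<Sum>i\<in>{2..<n}. \<bar>P i t\<bar> * r ^ i) = \<bar>P (n - 2) t\<bar> * r ^ (n - 2) + (\<Sum>i\<in>{2..n-1} - {n-2}. \<bar>P i t\<bar> * r ^ i)"
    using sum.remove[of "{2..<n}" "n - 2" "\<lambda>i. \<bar>P i t\<bar> * r ^ i"] by (simp only: finite_atLeastLessThan)
  also have "\<dots> \<le> \<bar>P (n - 2) t\<bar> * r ^ (n - 2) + (\<Sum>i\<in>{2..n-1} - {n-2}. S)"
    using term_le by (intro add_left_mono sum_mono)
  also have "(\<Sum>i\<in>{2..n-1} - {n-2}. S) = real (n - 3) * S"
  proof -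
    have "card ({2..n-1} - {n-2}) = n - 3"
      using n5 by (subst card_Diff_singleton) auto
    then show ?thesis
      by simp
  qed
  also have "\<bar>P (n - 2) t\<bar> = - P (n - 2) t"
    using Pn2 t by simp
  finally have sum_le: "r ^ n + \<bar>P 0 t\<bar> + (\<Sum>i\<in>{2..<n}. \<bar>P i t\<bar> * r ^ i) \<le>
      K + \<bar>P 0 t\<bar> - r ^ (n - 2) * P (n - 2) t + real (n - 3) * S"
    by (simp add: rn mult.commute)
  have "(K + \<bar>P 0 t\<bar> - r ^ (n - 2) * P (n - 2) t + real (n - 3) * S) / r \<le> \<bar>P 1 t\<bar>"
    using P1[rule_format, OF t] unfolding pow r[symmetric] by (simp add: S_def mult.assoc)
  then have "K + \<bar>P 0 t\<bar> - r ^ (n - 2) * P (n - 2) t + real (n - 3) * S \<le> \<bar>P 1 t\<bar> * r"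
    using \<open>r > 0\<close> by (simp add: field_simps)
  then show "r ^ n + \<bar>P 0 t\<bar> + (\<Sum>i\<in>{2..<n}. \<bar>P i t\<bar> * r ^ i) \<le> \<sigma> * P 1 t * r"
    using sum_le P1_sign t by simp
qed (fact \<sigma>)

theorem theorem1p2:
  fixes n :: nat and \<omega> K :: real and P :: "nat \<Rightarrow> real \<Rightarrow> real"
  assumes n5: "n \<ge> 5"
    and \<omega>pos: "\<omega> > 0"
    and cont: "\<forall>i<n. continuous_on {0..\<omega>} (P i)"
    and Kgt: "K > (SUP t\<in>{0..\<omega>}. \<bar>P 0 t\<bar>)"
    and Pn2: "\<forall>t\<in>{0..\<omega>}. P (n - 2) t \<le> 0"
    and Pi: "\<forall>t\<in>{0..\<omega>}. \<forall>i\<in>{2..n-1} - {n-2}.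
       \<bar>P i t\<bar> \<le> (K - K powr (real (n-2) / real n) * P (n-2) t - \<bar>P 0 t\<bar>)
                   / (real (n-4) * K powr (real i / real n)) * sin (pi / real (n-2))"
    and P1: "\<forall>t\<in>{0..\<omega>}.
       \<bar>P 1 t\<bar> \<ge> (K + \<bar>P 0 t\<bar> - K powr (real (n-2) / real n) * P (n-2) t
                   + real (n-3) / real (n-4) * (K - K powr (real (n-2) / real n) * P (n-2) t - \<bar>P 0 t\<bar>)
                     * sin (pi / real (n-2))) / K powr (1 / real n)"
  shows "finite (periodic_inits n P \<omega>) \<and>
         (\<Sum>c\<in>periodic_inits n P \<omega>. zorder (displ n P \<omega>) c) = int n"
proof -
  have bounded_P: "\<exists>B. \<forall>t\<in>{0..\<omega>}. \<bar>P i t\<bar> \<le> B" if "i < n" for i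
  proof -
    have "bounded (P i ` {0..\<omega>})"
      using cont that by (intro compact_imp_bounded compact_continuous_image) auto
    then show ?thesis
      by (simp add: bounded_iff)
  qed
  have P0: "\<forall>t\<in>{0..\<omega>}. \<bar>P 0 t\<bar> < K"
  proof
    fix t assume t: "t \<in> {0..\<omega>}"
    obtain B where "\<forall>t\<in>{0..\<omega>}. \<bar>P 0 t\<bar> \<le> B"
      using bounded_P[of 0] n5 by auto
    then have "bdd_above ((\<lambda>t. \<bar>P 0 t\<bar>) ` {0..\<omega>})"
      by (intro bdd_aboveI2[of _ _ B]) simp
    then have "\<bar>P 0 t\<bar> \<le> (SUP t\<in>{0..\<omega>}. \<bar>P 0 t\<bar>)"
      using t by (rule cSUP_upper2) simp
    then show "\<bar>P 0 t\<bar> < K"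
      using Kgt by linarith
  qed
  then have "\<bar>P 0 0\<bar> < K"
    using \<omega>pos by simp
  then have K: "K > 0"
    by linarith
  define r where "r = K powr (1 / real n)"
  have r: "r > 0"
    using K by (simp add: r_def)
  \<comment> \<open>By continuity \<open>P 1\<close> then has a constant sign on the interval, which
    defines \<open>\<sigma>\<close>.\<close>
  have P1_nz: "P 1 t \<noteq> 0" if t: "t \<in> {0..\<omega>}" for t
  proof -
    define S where "S = K - K powr (real (n-2) / real n) * P (n-2) t - \<bar>P 0 t\<bar>"
    have "K powr (real (n-2) / real n) * P (n-2) t \<le> 0"
      using Pn2 t by (intro mult_nonneg_nonpos) auto
    moreover have "S \<ge> 0"
      using P0 t calculation by (force simp: S_def)
    moreover have "sin (pi / real (n - 2)) \<ge> 0"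
      using n5 by (intro sin_ge_zero) (auto simp: field_simps)
    ultimately have "(K + \<bar>P 0 t\<bar> - K powr (real (n-2) / real n) * P (n-2) t +
        real (n-3) / real (n-4) * S * sin (pi / real (n-2))) / K powr (1 / real n) > 0"
      using K by (intro divide_pos_pos add_pos_nonneg mult_nonneg_nonneg) auto
    then show ?thesis
      using P1[rule_format, OF t] by (auto simp: S_def)
  qed
  obtain \<sigma> :: real where \<sigma>: "\<sigma> = 1 \<or> \<sigma> = - 1" "\<forall>t\<in>{0..\<omega>}. \<sigma> * P 1 t = \<bar>P 1 t\<bar>"
  proof (cases "\<exists>t\<in>{0..\<omega>}. P 1 t < 0")
    case True
    then obtain a where a: "a \<in> {0..\<omega>}" "P 1 a < 0"
      by blast
    have conn: "connected (P 1 ` {0..\<omega>})"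
      using cont n5 by (intro connected_continuous_image) auto
    have "P 1 t < 0" if t: "t \<in> {0..\<omega>}" for t
    proof (rule ccontr)
      assume "\<not> P 1 t < 0"
      then have "0 \<in> P 1 ` {0..\<omega>}"
        using a(2) by (intro connectedD_interval[OF conn imageI[OF a(1)] imageI[OF t]]) simp_all
      then show False
        using P1_nz by auto
    qed
    then have "\<forall>t\<in>{0..\<omega>}. - 1 * P 1 t = \<bar>P 1 t\<bar>"
      by (auto simp: abs_if)
    then show thesis
      by (rule that[rotated]) simp
  next
    case False
    then have "\<forall>t\<in>{0..\<omega>}. 1 * P 1 t = \<bar>P 1 t\<bar>"
      by (simp add: not_less)
    then show thesis
      by (rule that[rotated]) simp
  qed
  have base: "sector_conditions n r \<sigma> \<omega> P"
    by (rule sector_conditions_of_hypotheses[OF n5 K r_def \<sigma>(1) P0 Pn2 Pi P1 \<sigma>(2)])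
  \<comment> \<open>The number with \<open>\<sigma> * \<alpha> * r = r ^ n\<close>, so the Bernoulli
    coefficients satisfy the domination condition with equality.\<close>
  define \<alpha> where "\<alpha> = \<sigma> * r ^ (n - 1)"
  have \<alpha>: "\<alpha> \<noteq> 0"
    using \<sigma>(1) r by (auto simp: \<alpha>_def)
  have target: "sector_conditions n r \<sigma> \<omega> (linear_coeff \<alpha>)"
  proof -
    have "sin (pi / real (n - 2)) \<ge> 0"
      using n5 by (intro sin_ge_zero) (auto simp: field_simps)
    moreover have "\<sigma> * \<alpha> * r = r ^ n"
      using \<sigma>(1) n5 by (cases n) (auto simp: \<alpha>_def)
    ultimately show ?thesis
      using \<sigma>(1) r n5 by (auto simp: sector_conditions_def linear_coeff_def)
  qed
  obtain B where B: "\<And>i t. i < n \<Longrightarrow> t \<in> {0..\<omega>} \<Longrightarrow> \<bar>P i t\<bar> \<le> B i"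
    using bounded_P by metis
  \<comment> \<open>Bounds the sum of the absolute values at both ends, hence serves as bound of all
    intermediate coefficients and as their Lipschitz constant in \<open>s\<close>.\<close>
  define M where "M = (\<Sum>i<n. \<bar>B i\<bar>) + \<bar>\<alpha>\<bar>"
  have M: "M \<ge> 0" "\<And>i t. i < n \<Longrightarrow> t \<in> {0..\<omega>} \<Longrightarrow> \<bar>P i t\<bar> + \<bar>linear_coeff \<alpha> i t\<bar> \<le> M"
  proof -
    show "M \<ge> 0"
      by (auto simp: M_def intro!: add_nonneg_nonneg sum_nonneg)
    fix i t assume "i < n" "t \<in> {0..\<omega>}"
    then have "\<bar>P i t\<bar> \<le> (\<Sum>i<n. \<bar>B i\<bar>)"
      using B[of i t] member_le_sum[of i "{..<n}" "\<lambda>i. \<bar>B i\<bar>"] by auto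
    then show "\<bar>P i t\<bar> + \<bar>linear_coeff \<alpha> i t\<bar> \<le> M"
      by (auto simp: M_def linear_coeff_def)
  qed
  obtain b where b: "b > 0" "\<And>p \<sigma> c \<phi> t. sector_conditions n r \<sigma> \<omega> p \<Longrightarrow> bounded_coeffs n \<omega> M p \<Longrightarrow>
    is_sol n p \<omega> c \<phi> \<Longrightarrow> \<phi> \<omega> = c \<Longrightarrow> t \<in> {0..\<omega>} \<Longrightarrow> norm (\<phi> t) \<le> b"
    by (rule periodic_sol_bounded[OF n5 \<omega>pos M(1) r]) blast
  define p where "p s i t = (1 - s) * P i t + s * linear_coeff \<alpha> i t" for s i t
  have p_bound: "bounded_coeffs n \<omega> M (p s)" if "s \<in> {0..1}" for s
    unfolding bounded_coeffs_def
  proof (intro allI impI ballI)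
    fix i t assume i: "i < n" and t: "t \<in> {0..\<omega>}"
    have "\<bar>p s i t\<bar> \<le> (1 - s) * \<bar>P i t\<bar> + s * \<bar>linear_coeff \<alpha> i t\<bar>"
      using that abs_triangle_ineq[of "(1 - s) * P i t" "s * linear_coeff \<alpha> i t"] by (simp add: p_def abs_mult)
    also have "\<dots> \<le> 1 * \<bar>P i t\<bar> + 1 * \<bar>linear_coeff \<alpha> i t\<bar>"
      using that by (intro add_mono mult_right_mono) auto
    finally show "\<bar>p s i t\<bar> \<le> M"
      using M(2)[OF i t] by linarith
  qed
  have p_cond: "sector_conditions n r \<sigma> \<omega> (p s)" if "s \<in> {0..1}" for s
    unfolding p_def [abs_def] using that by (intro sector_conditions_convex base target n5 r) auto
  \<comment> \<open>The truncation radius \<open>b + 1\<close> may be any number above the a priori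
    bound \<open>b\<close>.\<close>
  interpret bounded_periodic_family n \<omega> M M "b + 1" p b
  proof unfold_locales
    show "continuous_on {0..\<omega>} (p s i)" if "i < n" for s i
      unfolding p_def [abs_def] linear_coeff_def using cont that by (auto intro!: continuous_intros)
    show "\<bar>p s i t - p s' i t\<bar> \<le> M * \<bar>s - s'\<bar>" if "i < n" "t \<in> {0..\<omega>}" for s s' i t
    proof -
      have "p s i t - p s' i t = (linear_coeff \<alpha> i t - P i t) * (s - s')"
        by (simp add: p_def algebra_simps)
      moreover have "\<bar>linear_coeff \<alpha> i t - P i t\<bar> \<le> M"
        using M(2)[OF that] by linarith
      ultimately show ?thesis
        by (simp add: abs_mult mult_right_mono)
    qed
    show "norm (\<phi> t) \<le> b" if "s \<in> {0..1}" "is_sol n (p s) \<omega> c \<phi>" "\<phi> \<omega> = c" "t \<in> {0..\<omega>}" for s c \<phi> t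
      using that by (intro b(2)[OF p_cond p_bound])
  qed (use \<omega>pos M(1) b(1) p_bound in auto)
  have p0: "p 0 = P" and p1: "p 1 = linear_coeff \<alpha>"
    by (simp_all add: p_def fun_eq_iff)
  have "n \<ge> 2"
    using n5 by simp
  from periodic_count_bernoulli[OF this \<alpha> p1] periodic_count_constant
  show ?thesis
    by (simp add: p0)
qed

end
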